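(* Let $R\subset\mathbf C^{2n}$ be a linear subspace, let $a(t)$, $0\le t\le T$, be a (continuous) path in $\mathrm{GL}(n,\mathbf C)$, and let $R'=\{(x,y)\in\mathbf C^{2n}:(a(0)x,a(T)y)\in R\}$. Let $\gamma$ be a symplectic path, i.e. a continuous path in $\mathrm{GL}(2n,\mathbf C)$ with $\gamma(t)^*J_{2,n}\gamma(t)=J_{2,n}$ for all $0\le t\le T$, where $J_{2,n}=\begin{pmatrix}0&-I_n\\ I_n&0\end{pmatrix}$. Define the symplectic path $\gamma'$ by $$\gamma'(t)=\mathrm{diag}(a(t)^*,a(t)^{-1})\,\gamma(t)\,\mathrm{diag}((a(0)^* )^{-1},a(0)).$$ Then $$i_{W_2(R')}(\gamma')-i_{W_2(R)}(\gamma)=\dim\big(\mathrm{Gr}(I_n)\cap(R')^{2,b}\big)-\dim\big(\mathrm{Gr}(I_n)\cap R^{2,b}\big).$$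
   Context: $\langle\cdot,\cdot\rangle$ is the standard Hermitian inner product (linear in the first variable), $A^*$ the conjugate transpose, $\dim$ the complex dimension, $\mathrm{Gr}(M)=\{(x,Mx)\}$. For a subspace $Q\subset\mathbf C^{2n}$: $Q^{2,b}=\{(x_1,x_2)\in\mathbf C^{2n}:\langle x_1,y_1\rangle-\langle x_2,y_2\rangle=0\ \forall(y_1,y_2)\in Q\}$ and $W_2(Q)=\{(x_1,x_2,x_3,x_4)\in\mathbf C^{4n}:x_i\in\mathbf C^n,\ (x_1,x_3)\in Q^{2,b},\ (x_2,x_4)\in Q\}$. **Maslov(-type) index.** Let $(V,\omega)$ be a finite-dimensional complex symplectic space ($\omega$ sesquilinear, linear in the first variable, $\omega(y,x)=-\overline{\omega(x,y)}$, nondegenerate); $\lambda\subset V$ is Lagrangian if it equals its $\omega$-annihilator. Choose an $\omega$-orthogonal splitting $V=V^+\oplus V^-$ with $-\sqrt{-1}\,\omega$ positive definite on $V^+$ and negative definite on $V^-$. Each Lagrangian subspace is the graph of a unique $U:V^+\to V^-$ with $\omega(Ux,Uy)=-\omega(x,y)$. For continuous paths of Lagrangians $\lambda_t=\mathrm{Gr}(U_t)$, $\mu_t=\mathrm{Gr}(V_t)$, $t\in[a,b]$, the map $U_tV_t^{-1}$ is unitary on $(V^-,\sqrt{-1}\,\omega)$. Choose $a=t_0<\dots<t_N=b$ and $\epsilon_k\in(0,\pi)$ with $e^{\pm\sqrt{-1}\epsilon_k}\notin\sigma(U_tV_t^{-1})$ on $[t_k,t_{k+1}]$, and let $d_k(t)$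 be the number, with multiplicity, of eigenvalues of $U_tV_t^{-1}$ in $\{e^{\sqrt{-1}\theta}:-\epsilon_k\le\theta<0\}$. Then $\mathrm{Mas}\{\lambda_t,\mu_t\}=-\sum_k(d_k(t_k)-d_k(t_{k+1}))$. With $\omega(x,y)=\langle J_{2,n}x,y\rangle$ on $\mathbf C^{2n}$ and $W$ a Lagrangian subspace of $(\mathbf C^{2n}\oplus\mathbf C^{2n},(-\omega)\oplus\omega)$ (such as $W_2(Q)$), $i_W(\gamma)=\mathrm{Mas}\{\mathrm{Gr}(\gamma(t)),W;\,0\le t\le T\}$.
   Formalization: The formal theorem additionally assumes $\gamma(0)=I_{2n}$; without it the identity fails, e.g. for $n=1$, $T=1$, $\gamma(t)=J_{2,1}$ constant, $a(t)=1+t$, $R=\mathrm{span}\{(1,1)\}$, where the left side is $0$ and the right side is $-1$. *)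

theory Defs
  imports "HOL-Analysis.Analysis"
begin

text \<open>
  A direct sum of two coordinate spaces is the coordinate space over the sum of the index types, so
  \<^typ>\<open>complex ^ ('n + 'n)\<close> is the space of pairs \<open>(x, y)\<close>. Complex subspaces and dimensions are
  those of the interpretation \<open>vec\<close> (scalar multiplication \<open>*s\<close>).
\<close>

section \<open>Vectors and matrices in blocks\<close>

definition vpair :: "'a ^ 'm \<Rightarrow> 'a ^ 'n \<Rightarrow> 'a ^ ('m::finite + 'n::finite)" where
  "vpair x y = (\<chi> i. case i of Inl j \<Rightarrow> x $ j | Inr j \<Rightarrow> y $ j)"

definition vfst :: "'a ^ ('m::finite + 'n::finite) \<Rightarrow> 'a ^ 'm" where
  "vfst v = (\<chi> i. v $ Inl i)"

definition vsnd :: "'a ^ ('m::finite + 'n::finite) \<Rightarrow> 'a ^ 'n" where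
  "vsnd v = (\<chi> i. v $ Inr i)"

definition block_mat ::
  "'a ^ 'n ^ 'n \<Rightarrow> 'a ^ 'n ^ 'n \<Rightarrow> 'a ^ 'n ^ 'n \<Rightarrow> 'a ^ 'n ^ 'n
    \<Rightarrow> 'a ^ ('n::finite + 'n) ^ ('n + 'n)" where
  "block_mat A B C D = (\<chi> i j. case i of
     Inl k \<Rightarrow> (case j of Inl l \<Rightarrow> A $ k $ l | Inr l \<Rightarrow> B $ k $ l)
   | Inr k \<Rightarrow> (case j of Inl l \<Rightarrow> C $ k $ l | Inr l \<Rightarrow> D $ k $ l))"

abbreviation block_diag ::
  "complex ^ 'n ^ 'n \<Rightarrow> complex ^ 'n ^ 'n \<Rightarrow> complex ^ ('n::finite + 'n) ^ ('n + 'n)" where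
  "block_diag A D \<equiv> block_mat A 0 0 D"

definition ctranspose :: "complex ^ 'n ^ 'm \<Rightarrow> complex ^ 'm ^ 'n" where
  "ctranspose A = (\<chi> i j. cnj (A $ j $ i))"

definition herm :: "complex ^ 'n \<Rightarrow> complex ^ 'n \<Rightarrow> complex" where
  "herm x y = (\<Sum>i\<in>UNIV. x $ i * cnj (y $ i))"

definition J2 :: "complex ^ ('n::finite + 'n) ^ ('n + 'n)" where
  "J2 = block_mat 0 (- mat 1) (mat 1) 0"

definition Gr :: "complex ^ 'n ^ 'n \<Rightarrow> (complex ^ ('n::finite + 'n)) set" where
  "Gr M = {vpair x (M *v x) | x. True}"

section \<open>The subspaces attached to a boundary condition\<close>

definition ann2b :: "(complex ^ ('n::finite + 'n)) set \<Rightarrow> (complex ^ ('n + 'n)) set" where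
  "ann2b Q = {vpair x1 x2 | x1 x2.
     \<forall>y1 y2. vpair y1 y2 \<in> Q \<longrightarrow> herm x1 y1 - herm x2 y2 = 0}"

definition W2 ::
  "(complex ^ ('n::finite + 'n)) set \<Rightarrow> (complex ^ (('n + 'n) + ('n + 'n))) set" where
  "W2 Q = {vpair (vpair x1 x2) (vpair x3 x4) | x1 x2 x3 x4.
     vpair x1 x3 \<in> ann2b Q \<and> vpair x2 x4 \<in> Q}"

section \<open>The Maslov index\<close>

text \<open>
  The symplectic space is all of \<^typ>\<open>complex ^ 'm\<close> with the form \<open>w\<close>. As \<open>w\<close> is skew-Hermitian,
  \<open>- \<i> * w x x\<close> is real, so taking real parts in the definiteness conditions loses nothing.
\<close>

definition symplectic_splitting ::
  "(complex ^ 'm \<Rightarrow> complex ^ 'm \<Rightarrow> complex)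
    \<Rightarrow> (complex ^ 'm) set \<Rightarrow> (complex ^ 'm::finite) set \<Rightarrow> bool" where
  "symplectic_splitting w Vp Vm \<longleftrightarrow>
     vec.subspace Vp \<and> vec.subspace Vm \<and>
     Vp \<inter> Vm = {0} \<and> (\<forall>v. \<exists>x\<in>Vp. \<exists>y\<in>Vm. v = x + y) \<and>
     (\<forall>x\<in>Vp. \<forall>y\<in>Vm. w x y = 0) \<and>
     (\<forall>x\<in>Vp. x \<noteq> 0 \<longrightarrow> Re (- \<i> * w x x) > 0) \<and>
     (\<forall>x\<in>Vm. x \<noteq> 0 \<longrightarrow> Re (- \<i> * w x x) < 0)"

text \<open>
  For Lagrangian \<open>L\<close>, \<open>graph_map Vm L\<close> restricted to \<open>Vp\<close> is the unique map \<open>U : Vp \<rightarrow> Vm\<close> with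
  \<open>L = {x + U x | x \<in> Vp}\<close>; its values outside \<open>Vp\<close> are never used.
\<close>

definition graph_map ::
  "(complex ^ 'm) set \<Rightarrow> (complex ^ 'm) set \<Rightarrow> complex ^ 'm \<Rightarrow> complex ^ 'm::finite" where
  "graph_map Vm L x = (THE y. y \<in> Vm \<and> x + y \<in> L)"

definition pair_op ::
  "(complex ^ 'm) set \<Rightarrow> (complex ^ 'm) set \<Rightarrow> (complex ^ 'm) set \<Rightarrow> (complex ^ 'm) set
    \<Rightarrow> complex ^ 'm \<Rightarrow> complex ^ 'm::finite" where
  "pair_op Vp Vm L M y = graph_map Vm L (inv_into Vp (graph_map Vm M) y)"

definition eigenspace_on ::
  "(complex ^ 'm) set \<Rightarrow> (complex ^ 'm \<Rightarrow> complex ^ 'm) \<Rightarrow> complex \<Rightarrow> (complex ^ 'm::finite) set"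
  where "eigenspace_on S f z = {x \<in> S. f x = z *s x}"

definition spectrum_on ::
  "(complex ^ 'm) set \<Rightarrow> (complex ^ 'm \<Rightarrow> complex ^ 'm::finite) \<Rightarrow> complex set" where
  "spectrum_on S f = {z. \<exists>x\<in>eigenspace_on S f z. x \<noteq> 0}"

text \<open>
  Only used for unitary, hence diagonalizable, operators \<open>f\<close> on \<open>S\<close>, so the multiplicity of an
  eigenvalue is the dimension of its eigenspace.
\<close>

definition arc_count ::
  "(complex ^ 'm) set \<Rightarrow> (complex ^ 'm \<Rightarrow> complex ^ 'm::finite) \<Rightarrow> real \<Rightarrow> nat" where
  "arc_count S f e =
     (\<Sum>z \<in> {z \<in> spectrum_on S f. \<exists>\<theta>. - e \<le> \<theta> \<and> \<theta> < 0 \<and> z = cis \<theta>}.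
        vec.dim (eigenspace_on S f z))"

text \<open>
  \<open>maslov_value w L M a b m\<close>: some admissible choice of splitting, subdivision
  \<open>a = t 0 < \<dots> < t N = b\<close> and angles \<open>e k\<close> produces the value \<open>m\<close>. For continuous paths of
  Lagrangian subspaces such choices exist and all of them produce the same value, which
  is the Maslov index.
\<close>

definition maslov_value ::
  "(complex ^ 'm \<Rightarrow> complex ^ 'm \<Rightarrow> complex)
    \<Rightarrow> (real \<Rightarrow> (complex ^ 'm) set) \<Rightarrow> (real \<Rightarrow> (complex ^ 'm::finite) set)
    \<Rightarrow> real \<Rightarrow> real \<Rightarrow> int \<Rightarrow> bool" where
  "maslov_value w L M a b m \<longleftrightarrow>
     (\<exists>Vp Vm (N::nat) (t :: nat \<Rightarrow> real) (e :: nat \<Rightarrow> real).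
        symplectic_splitting w Vp Vm \<and>
        t 0 = a \<and> t N = b \<and> (\<forall>k<N. t k < t (Suc k)) \<and>
        (\<forall>k<N. 0 < e k \<and> e k < pi) \<and>
        (\<forall>k<N. \<forall>s\<in>{t k..t (Suc k)}.
           cis (e k) \<notin> spectrum_on Vm (pair_op Vp Vm (L s) (M s)) \<and>
           cis (- e k) \<notin> spectrum_on Vm (pair_op Vp Vm (L s) (M s))) \<and>
        m = - (\<Sum>k<N. int (arc_count Vm (pair_op Vp Vm (L (t k)) (M (t k))) (e k))
                    - int (arc_count Vm (pair_op Vp Vm (L (t (Suc k))) (M (t (Suc k)))) (e k))))"

definition Mas ::
  "(complex ^ 'm \<Rightarrow> complex ^ 'm \<Rightarrow> complex)
    \<Rightarrow> (real \<Rightarrow> (complex ^ 'm) set) \<Rightarrow> (real \<Rightarrow> (complex ^ 'm::finite) set)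
    \<Rightarrow> real \<Rightarrow> real \<Rightarrow> int" where
  "Mas w L M a b = (THE m. maslov_value w L M a b m)"

definition omega :: "complex ^ ('n::finite + 'n) \<Rightarrow> complex ^ ('n + 'n) \<Rightarrow> complex" where
  "omega x y = herm (J2 *v x) y"

text \<open>The form \<open>(- \<omega>) \<oplus> \<omega>\<close>, for which graphs of symplectic matrices are Lagrangian.\<close>

definition omega_sum ::
  "complex ^ (('n::finite + 'n) + ('n + 'n)) \<Rightarrow> complex ^ (('n + 'n) + ('n + 'n)) \<Rightarrow> complex" where
  "omega_sum x y = - omega (vfst x) (vfst y) + omega (vsnd x) (vsnd y)"

definition maslov_type_index ::
  "(complex ^ (('n::finite + 'n) + ('n + 'n))) set \<Rightarrow> real
    \<Rightarrow> (real \<Rightarrow> complex ^ ('n + 'n) ^ ('n + 'n)) \<Rightarrow> int" where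
  "maslov_type_index W T \<gamma> = Mas omega_sum (\<lambda>t. Gr (\<gamma> t)) (\<lambda>t. W) 0 T"

end

theory Submission
  imports Defs "HOL-Computational_Algebra.Fundamental_Theorem_Algebra"
begin

text \<open>
  The block diagonal maps \<open>S t = D 0 \<oplus> D t\<close> with \<open>D t = diag (a(t)\<^sup>*, a(t)\<^sup>-\<^sup>1)\<close> preserve the form
  \<open>(- \<omega>) \<oplus> \<omega>\<close>. They carry the graph of \<open>\<gamma> t\<close> to the graph of \<open>\<gamma>' t\<close>, and \<open>S T\<close> carries \<open>W2 R\<close> to
  \<open>W2 R'\<close>. Undoing \<open>S t\<close> at each time, the index of \<open>\<gamma>'\<close> is the Maslov index of the pair of paths
  \<open>Gr (\<gamma> t)\<close> and \<open>W t = S t\<^sup>-\<^sup>1 (S T (W2 R))\<close>, with respect to a moving splitting. In the square of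
  parameters of \<open>Gr (\<gamma> t)\<close> and \<open>W s\<close> the diagonal is homotopic to the path along two edges: the
  first keeps \<open>Gr (\<gamma> 0)\<close>, the diagonal subspace, and moves \<open>W\<close> to \<open>W T = W2 R\<close>, the second is the
  pair that defines the index of \<open>\<gamma>\<close>. So the difference of the two indices is the Maslov index of
  the diagonal against the path \<open>W t\<close> (\<open>maslov_index_difference\<close>).

  That index is computed by a symmetry. The reflection \<open>(x1, x2, x3, x4) \<mapsto> (x1, - x2, x3, - x4)\<close>
  preserves the diagonal and all \<open>W t\<close> and exchanges the positive and the negative space of the
  standard splitting. Hence the eigenvalues of the unitary operators come in conjugate pairs
  (\<open>dim_eigenspace_cnj_le\<close>): whenever two eigenvalues leave 1, one goes up and one goes down. The
  index is therefore half of the drop of the multiplicity of the eigenvalue 1, that is of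
  \<open>dim (Gr I \<inter> W t)\<close> (\<open>symmetric_flow\<close>). This intersection splits as
  \<open>(Gr I \<inter> Q\<^sup>b) \<oplus> (Gr I \<inter> Q)\<close> if \<open>W t = W2 Q\<close>, and since \<open>Gr I\<close> is its own annihilator the
  dimensions of the two parts differ by \<open>n - dim Q\<close>, which is the same at both ends.

  The rest is the theory of the index: its independence of the subdivision, of the angles and
  of the splitting, and its homotopy invariance. The number of eigenvalues of a unitary operator
  \<open>f\<close> in the arc \<open>- e \<le> \<theta> < 0\<close>, if \<open>cis (- e)\<close> is none, is the positive index of the Hermitian form
  \<open>Re (cis (e / 2) \<langle>f v, v\<rangle>) - cos (e / 2) \<langle>v, v\<rangle>\<close>. Positive and negative indices are lower
  semicontinuous, because definiteness on a subspace is an open condition; both together show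
  that a count is locally constant as long as \<open>cis (- e)\<close> is no eigenvalue and the multiplicity of
  1 does not change, and that two counts with different \<open>e\<close> differ by a locally constant number.
  These two facts are all that uniqueness and homotopy invariance need (locale \<open>gauged\<close>). Any
  two splittings are joined by a path (\<open>splitting_path\<close>), so that independence of the splitting
  is one more instance of homotopy invariance.
\<close>

section \<open>Flows along an interval\<close>

text \<open>
  The inductive form of the sums over subdivisions by which the Maslov index is defined: one step
  for each interval of the subdivision, with one gauge \<open>e\<close> that is admissible on all of it.
\<close>
inductive flow :: "(real \<Rightarrow> real \<Rightarrow> bool) \<Rightarrow> (real \<Rightarrow> real \<Rightarrow> int) \<Rightarrow> real \<Rightarrow> real \<Rightarrow> int \<Rightarrow> bool"
  for good d where
  flow_refl: "flow good d a a 0"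
| flow_step: "flow good d a b m \<Longrightarrow> b < c \<Longrightarrow> 0 < e \<Longrightarrow> e < pi \<Longrightarrow> (\<And>t. t \<in> {b..c} \<Longrightarrow> good e t)
     \<Longrightarrow> flow good d a c (m + (d e c - d e b))"

lemma flow_le: "flow good d a b m \<Longrightarrow> a \<le> b"
  by (induction rule: flow.induct) auto

lemma flow_trans:
  assumes "flow good d b c m'" "flow good d a b m"
  shows "flow good d a c (m + m')"
  using assms
proof (induction rule: flow.induct)
  case (flow_refl a)
  then show ?case by simp
next
  case (flow_step b c m' c' e)
  from flow.flow_step[OF flow_step.IH[OF flow_step.prems] flow_step.hyps(2-5)]
  show ?case by (simp add: algebra_simps)
qed

lemma flow_cong:
  assumes "flow good d a b m"
    and "\<And>e t. a \<le> t \<Longrightarrow> t \<le> b \<Longrightarrow> good e t \<Longrightarrow> good' e t"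
    and "\<And>e t. a \<le> t \<Longrightarrow> t \<le> b \<Longrightarrow> d e t = d' e t"
  shows "flow good' d' a b m"
  using assms
proof (induction rule: flow.induct)
  case (flow_refl a)
  then show ?case by (simp add: flow.flow_refl)
next
  case (flow_step a b m c e)
  note ab = flow_le[OF flow_step.hyps(1)]
  have 1: "flow good' d' a b m"
    by (rule flow_step.IH) (use flow_step in auto)
  have "d e c = d' e c" "d e b = d' e b"
    using flow_step.prems ab flow_step.hyps(2) by auto
  moreover have "flow good' d' a c (m + (d' e c - d' e b))"
    by (rule flow.flow_step[OF 1 flow_step.hyps(2-4)])
      (use flow_step.hyps flow_step.prems(1) ab in auto)
  ultimately show ?case by simp
qed

text \<open>
  The step that contains \<open>b\<close> is cut there; its gauge serves for both halves.
\<close>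
lemma flow_split:
  assumes "flow good d a c m" "a \<le> b" "b \<le> c"
  shows "\<exists>m1 m2. flow good d a b m1 \<and> flow good d b c m2 \<and> m = m1 + m2"
  using assms
proof (induction rule: flow.induct)
  case (flow_refl a)
  then have "b = a" by simp
  then show ?case using flow.flow_refl[of good d a] by fastforce
next
  case (flow_step a b' m c e)
  show ?case
  proof (cases "b \<le> b'")
    case True
    then obtain m1 m2 where m: "flow good d a b m1" "flow good d b b' m2" "m = m1 + m2"
      using flow_step by blast
    have "flow good d b c (m2 + (d e c - d e b'))"
      by (rule flow.flow_step[OF m(2)]) (use flow_step in auto)
    then show ?thesis using m by fastforce
  next
    case False
    have 1: "flow good d a b (m + (d e b - d e b'))"
      by (rule flow.flow_step) (use flow_step False in auto)
    have 2: "flow good d b c (d e c - d e b)"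
    proof (cases "b = c")
      case True then show ?thesis by (simp add: flow.flow_refl)
    next
      case False
      have "flow good d b c (0 + (d e c - d e b))"
        by (rule flow.flow_step[OF flow.flow_refl]) (use flow_step False \<open>\<not> b \<le> b'\<close> in auto)
      then show ?thesis by simp
    qed
    show ?thesis using 1 2 by fastforce
  qed
qed

lemma locally_constant_on_interval:
  fixes g :: "real \<Rightarrow> 'a"
  assumes "a \<le> b"
    and "\<And>x. a \<le> x \<Longrightarrow> x \<le> b \<Longrightarrow> \<forall>\<^sub>F y in nhds x. a \<le> y \<longrightarrow> y \<le> b \<longrightarrow> g y = g x"
  shows "g b = g a"
proof -
  have "g constant_on {a..b}"
  proof (rule locally_constant_imp_constant)
    show "connected {a..b}" by simp
    fix x assume x: "x \<in> {a..b}"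
    then have "\<forall>\<^sub>F y in nhds x. y \<in> {a..b} \<longrightarrow> g y = g x"
      using assms(2)[of x] by (auto elim: eventually_mono)
    then obtain T where T: "open T" "x \<in> T" "\<And>y. y \<in> T \<Longrightarrow> y \<in> {a..b} \<longrightarrow> g y = g x"
      unfolding eventually_nhds by blast
    show "\<exists>T. openin (top_of_set {a..b}) T \<and> x \<in> T \<and> (\<forall>x'\<in>T. g x' = g x)"
      by (rule exI[of _ "{a..b} \<inter> T"]) (use T x openin_open_Int in blast)
  qed
  then show ?thesis using assms(1) unfolding constant_on_def by fastforce
qed

text \<open>
  What is needed of the counts \<open>d e\<close>: they may jump, but two of them jump simultaneously wherever
  both gauges are admissible. The parameter space is arbitrary, so that paths and homotopies are
  covered by the same axioms.
\<close>
locale gauged =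
  fixes good :: "real \<Rightarrow> 'x::topological_space \<Rightarrow> bool" and d :: "real \<Rightarrow> 'x \<Rightarrow> int"
  assumes good_open: "0 < e \<Longrightarrow> e < pi \<Longrightarrow> good e x \<Longrightarrow> \<forall>\<^sub>F y in nhds x. good e y"
    and good_ex: "\<exists>e. 0 < e \<and> e < pi \<and> good e x"
    and compat: "0 < e \<Longrightarrow> e < pi \<Longrightarrow> 0 < e' \<Longrightarrow> e' < pi \<Longrightarrow> good e x \<Longrightarrow> good e' x \<Longrightarrow>
        \<forall>\<^sub>F y in nhds x. d e y - d e' y = d e x - d e' x"
begin

abbreviation pflow :: "(real \<Rightarrow> 'x) \<Rightarrow> real \<Rightarrow> real \<Rightarrow> int \<Rightarrow> bool" where
  "pflow p \<equiv> flow (\<lambda>e t. good e (p t)) (\<lambda>e t. d e (p t))"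

lemma eventually_path:
  fixes p :: "'y::topological_space \<Rightarrow> 'x"
  assumes "continuous_on UNIV p" "\<forall>\<^sub>F y in nhds (p t). P y"
  shows "\<forall>\<^sub>F s in nhds t. P (p s)"
proof -
  obtain U where U: "open U" "p t \<in> U" "\<And>y. y \<in> U \<Longrightarrow> P y"
    using assms(2) unfolding eventually_nhds by blast
  then have "open (p -` U)" using assms(1) open_vimage by blast
  then show ?thesis unfolding eventually_nhds using U by blast
qed

text \<open>
  Each step can be recomputed with the common gauge \<open>e\<close>: the difference of the two counts is locally
  constant, hence constant on the interval of the step.
\<close>
lemma flow_single:
  assumes "pflow p b c m" "continuous_on UNIV p" "0 < e" "e < pi"
    and "\<And>t. b \<le> t \<Longrightarrow> t \<le> c \<Longrightarrow> good e (p t)"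
  shows "m = d e (p c) - d e (p b)"
  using assms
proof (induction rule: flow.induct)
  case (flow_refl a)
  then show ?case by simp
next
  case (flow_step a b m c e')
  note ab = flow_le[OF flow_step.hyps(1)]
  have m: "m = d e (p b) - d e (p a)"
    using flow_step by auto
  have "d e' (p c) - d e (p c) = d e' (p b) - d e (p b)"
  proof (rule locally_constant_on_interval[of b c "\<lambda>t. d e' (p t) - d e (p t)"])
    fix x assume x: "b \<le> x" "x \<le> c"
    have "\<forall>\<^sub>F y in nhds (p x). d e' y - d e y = d e' (p x) - d e (p x)"
      by (rule compat) (use flow_step x ab in auto)
    from eventually_path[OF \<open>continuous_on UNIV p\<close> this]
    show "\<forall>\<^sub>F y in nhds x. b \<le> y \<longrightarrow> y \<le> c \<longrightarrow> d e' (p y) - d e (p y) = d e' (p x) - d e (p x)"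
      by (auto elim: eventually_mono)
  qed (use flow_step.hyps(2) in simp)
  then show ?case using m by simp
qed

text \<open>
  The second chain is cut at the division points of the first; on each step of the first both
  values are those of its single gauge.
\<close>
lemma flow_unique:
  assumes "pflow p a c m" "pflow p a c m'" "continuous_on UNIV p"
  shows "m = m'"
  using assms
proof (induction arbitrary: m' rule: flow.induct)
  case (flow_refl a)
  obtain e where "0 < e" "e < pi" "good e (p a)" using good_ex by blast
  moreover have "\<And>t. a \<le> t \<Longrightarrow> t \<le> a \<Longrightarrow> good e (p t)"
    using calculation(3) order.antisym by blast
  ultimately show ?case using flow_single[OF flow_refl.prems, of e] by simp
next
  case (flow_step a b m c e)
  note ab = flow_le[OF flow_step.hyps(1)]
  obtain m1 m2 where m: "pflow p a b m1" "pflow p b c m2" "m' = m1 + m2"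
    using flow_split[OF flow_step.prems(1), of b] ab flow_step.hyps by auto
  have "m2 = d e (p c) - d e (p b)"
    by (rule flow_single[OF m(2)]) (use flow_step in auto)
  moreover have "m = m1" using flow_step.IH m flow_step.prems by blast
  ultimately show ?case using m by simp
qed

text \<open>
  By bisection, as a gauge that is admissible at a point remains so nearby.
\<close>
lemma flow_exists:
  assumes "a \<le> b" "continuous_on UNIV p"
  shows "\<exists>m. pflow p a b m"
  using assms(1)
proof (induction rule: Bolzano)
  case (trans a b c)
  then obtain m1 m2 where "pflow p a b m1" "pflow p b c m2" by blast
  then show ?case using flow_trans[of _ _ b c m2 a m1] by blast
next
  case (local x)
  obtain e where e: "0 < e" "e < pi" "good e (p x)" using good_ex by blast
  from eventually_path[OF assms(2) good_open[OF this]]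
  obtain \<delta> where \<delta>: "\<delta> > 0" "\<And>y. dist y x < \<delta> \<Longrightarrow> good e (p y)"
    unfolding eventually_nhds_metric by blast
  show ?case
  proof (rule exI[of _ \<delta>], safe)
    fix u v assume uv: "u \<le> x" "x \<le> v" "v - u < \<delta>"
    show "\<exists>m. pflow p u v m"
    proof (cases "u = v")
      case True then show ?thesis using flow_refl by metis
    next
      case False
      have g: "good e (p t)" if "t \<in> {u..v}" for t
        by (rule \<delta>(2)) (use that uv in \<open>simp add: dist_real_def, linarith\<close>)
      have "pflow p u v (0 + (d e (p v) - d e (p u)))"
        by (rule flow_step[where e = e]) (use uv False e g in \<open>simp_all add: flow_refl\<close>)
      then show ?thesis by blast
    qed
  qed (use \<delta> in auto)
qed

text \<open>
  An interior division point contributes the difference of the counts for the two adjacent gauges,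
  and this difference does not change under a small deformation. What changes is the contribution
  of the right end, which the induction keeps track of for an arbitrary gauge there.
\<close>
lemma flow_deform:
  fixes H :: "real \<times> real \<Rightarrow> 'x"
  assumes "continuous_on UNIV H"
    and "pflow (\<lambda>t. H (s0, t)) a b m"
    and left: "\<And>e. 0 < e \<Longrightarrow> e < pi \<Longrightarrow> good e (H (s0, a)) \<Longrightarrow>
           \<forall>\<^sub>F s in nhds s0. d e (H (s, a)) = d e (H (s0, a))"
    and "0 < e" "e < pi" "good e (H (s0, b))"
  shows "\<forall>\<^sub>F s in nhds s0. pflow (\<lambda>t. H (s, t)) a b (m + (d e (H (s, b)) - d e (H (s0, b))))"
  using assms(2-)
proof (induction arbitrary: e rule: flow.induct)
  case (flow_refl a)
  from flow_refl.prems(1)[OF flow_refl.prems(2-4)] show ?case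
  proof eventually_elim
    case (elim s)
    then show ?case by (simp add: flow.flow_refl)
  qed
next
  case (flow_step a b m c e')
  have IH: "\<forall>\<^sub>F s in nhds s0. pflow (\<lambda>t. H (s, t)) a b (m + (d e' (H (s, b)) - d e' (H (s0, b))))"
    by (rule flow_step.IH) (use flow_step in auto)
  \<comment> \<open>the gauge of the last interval stays admissible on that whole interval\<close>
  define W where "W = interior {y. good e' y}"
  have "open (H -` W)"
    using assms(1) by (simp add: W_def continuous_on_open_vimage)
  moreover have "{s0} \<times> {b..c} \<subseteq> H -` W"
  proof safe
    fix t assume "t \<in> {b..c}"
    then have "\<forall>\<^sub>F y in nhds (H (s0, t)). good e' y"
      by (intro good_open flow_step.hyps)
    then obtain U where "open U" "H (s0, t) \<in> U" "\<forall>y\<in>U. good e' y"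
      unfolding eventually_nhds by blast
    then show "(s0, t) \<in> H -` W" unfolding W_def by (auto intro: interiorI)
  qed
  ultimately have "\<exists>X0. s0 \<in> X0 \<and> open X0 \<and> X0 \<times> {b..c} \<subseteq> H -` W"
    by (rule Elementary_Topology.tube_lemma[OF compact_Icc])
  then obtain X0 where X0: "s0 \<in> X0" "open X0" "X0 \<times> {b..c} \<subseteq> H -` W"
    by blast
  have tube: "\<forall>\<^sub>F s in nhds s0. \<forall>t\<in>{b..c}. good e' (H (s, t))"
    unfolding eventually_nhds
  proof (rule exI[of _ X0], intro conjI X0 ballI)
    fix s t assume "s \<in> X0" "t \<in> {b..c}"
    then have "H (s, t) \<in> W" using X0 by blast
    then show "good e' (H (s, t))" unfolding W_def using interior_subset by blast
  qed
  have "continuous_on UNIV (\<lambda>s. H (s, c))"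
    using assms(1) by (rule continuous_on_compose2) (auto intro!: continuous_intros)
  from eventually_path[OF this compat[OF flow_step.hyps(3,4) flow_step.prems(2,3) _ flow_step.prems(4)]]
  have "\<forall>\<^sub>F s in nhds s0. d e' (H (s, c)) - d e (H (s, c)) = d e' (H (s0, c)) - d e (H (s0, c))"
    using flow_step.hyps by auto
  from this tube IH show ?case
  proof eventually_elim
    case (elim s)
    have "pflow (\<lambda>t. H (s, t)) a c
      ((m + (d e' (H (s, b)) - d e' (H (s0, b)))) + (d e' (H (s, c)) - d e' (H (s, b))))"
      by (rule flow.flow_step[OF elim(3)]) (use elim flow_step.hyps in auto)
    moreover have "(m + (d e' (H (s, b)) - d e' (H (s0, b)))) + (d e' (H (s, c)) - d e' (H (s, b)))
       = m + (d e' (H (s0, c)) - d e' (H (s0, b))) + (d e (H (s, c)) - d e (H (s0, c)))"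
      using elim(1) by simp
    ultimately show ?case by simp
  qed
qed

theorem flow_homotopy:
  fixes H :: "real \<times> real \<Rightarrow> 'x"
  assumes H: "continuous_on UNIV H" and "a \<le> b"
    and left: "\<And>e s0. 0 < e \<Longrightarrow> e < pi \<Longrightarrow> good e (H (s0, a)) \<Longrightarrow>
           \<forall>\<^sub>F s in nhds s0. d e (H (s, a)) = d e (H (s0, a))"
    and right: "\<And>e s0. 0 < e \<Longrightarrow> e < pi \<Longrightarrow> good e (H (s0, b)) \<Longrightarrow>
           \<forall>\<^sub>F s in nhds s0. d e (H (s, b)) = d e (H (s0, b))"
    and "pflow (\<lambda>t. H (0, t)) a b m"
  shows "pflow (\<lambda>t. H (1, t)) a b m"
proof -
  have cont: "continuous_on UNIV (\<lambda>t. H (s, t))" for s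
    using H by (rule continuous_on_compose2) (auto intro!: continuous_intros)
  define v where "v s = (THE m. pflow (\<lambda>t. H (s, t)) a b m)" for s
  have v_eq: "v s = m" if "pflow (\<lambda>t. H (s, t)) a b m" for s m
    unfolding v_def
  proof (rule the_equality)
    show "pflow (\<lambda>t. H (s, t)) a b m" by (fact that)
    fix m' assume "pflow (\<lambda>t. H (s, t)) a b m'"
    from flow_unique[OF this that cont] show "m' = m" .
  qed
  have v: "pflow (\<lambda>t. H (s, t)) a b (v s)" for s
  proof -
    obtain m where "pflow (\<lambda>t. H (s, t)) a b m" using flow_exists[OF \<open>a \<le> b\<close> cont] by blast
    then show ?thesis using v_eq by simp
  qed
  have "v 1 = v 0"
  proof (rule locally_constant_on_interval)
    fix s0 :: real
    obtain e where e: "0 < e" "e < pi" "good e (H (s0, b))" using good_ex by blast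
    have "\<forall>\<^sub>F s in nhds s0. pflow (\<lambda>t. H (s, t)) a b (v s0 + (d e (H (s, b)) - d e (H (s0, b))))"
      by (rule flow_deform[OF H v _ e]) (rule left)
    from this right[OF e]
    show "\<forall>\<^sub>F s in nhds s0. 0 \<le> s \<longrightarrow> s \<le> 1 \<longrightarrow> v s = v s0"
    proof eventually_elim
      case (elim s)
      then show ?case using v_eq by simp
    qed
  qed simp
  then show ?thesis using v[of 1] v_eq[OF assms(5)] by simp
qed

end

section \<open>Unitary operators on a subspace\<close>

abbreviation clin :: "(complex ^ 'a \<Rightarrow> complex ^ 'b) \<Rightarrow> bool" where
  "clin \<equiv> Vector_Spaces.linear (*s) (*s)"

lemma clinI:
  assumes "\<And>x y. f (x + y) = f x + f y" "\<And>c x. f (c *s x) = c *s f x"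
  shows "clin f"
  by (simp add: Vector_Spaces.linear_iff assms vec.vector_space_axioms)

lemma clin_add: "clin f \<Longrightarrow> f (x + y) = f x + f y"
  and clin_scale: "clin f \<Longrightarrow> f (c *s x) = c *s f x"
  by (simp_all add: Vector_Spaces.linear_iff)

lemma clin_0:
  assumes "clin f" shows "f 0 = 0"
  using clin_scale[OF assms, of 0 0] by simp

lemma clin_neg:
  assumes "clin f" shows "f (- x) = - f x"
  using clin_scale[OF assms, of "-1" x] by simp

lemma clin_diff:
  assumes "clin f" shows "f (x - y) = f x - f y"
  using clin_add[OF assms, of x "- y"] by (simp add: clin_neg[OF assms])

lemma clin_sum:
  assumes "clin f" shows "f (\<Sum>i\<in>I. g i) = (\<Sum>i\<in>I. f (g i))"
  by (induction I rule: infinite_finite_induct) (simp_all add: clin_0[OF assms] clin_add[OF assms])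

lemma scaleR_eq_scalar: "r *\<^sub>R x = complex_of_real r *s (x :: complex ^ 'a)"
  by (simp add: vec_eq_iff scaleR_conv_of_real[where 'a=complex])

lemma clin_scaleR:
  assumes "clin f" shows "f (r *\<^sub>R x) = r *\<^sub>R f x"
  by (simp add: scaleR_eq_scalar clin_scale[OF assms])

text \<open>
  A linear relation among the iterates of a vector reads \<open>p(f) v = 0\<close> for a nonzero polynomial
  \<open>p\<close>. If the degree is least possible, splitting off a linear factor of \<open>p\<close> leaves a vector that
  is an eigenvector.
\<close>
lemma linear_endomorphism_has_eigenvector:
  fixes f :: "complex ^ 'm \<Rightarrow> complex ^ 'm"
  assumes f: "clin f" and S: "vec.subspace S" and inv: "\<And>x. x \<in> S \<Longrightarrow> f x \<in> S"
    and v: "v \<in> S" "v \<noteq> 0"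
  shows "\<exists>c x. x \<in> S \<and> x \<noteq> 0 \<and> f x = c *s x"
proof -
  define P where "P p w = (\<Sum>i\<le>degree p. coeff p i *s (f ^^ i) w)" for p w
  have P: "P p w = (\<Sum>i\<le>N. coeff p i *s (f ^^ i) w)" if "degree p \<le> N" for p w N
    unfolding P_def
  proof (rule sum.mono_neutral_left)
    show "\<forall>i\<in>{..N} - {..degree p}. coeff p i *s (f ^^ i) w = 0"
      by (simp add: coeff_eq_0)
  qed (use that in simp_all)
  have pow: "(f ^^ i) w \<in> S" if "w \<in> S" for i w
    by (induction i) (use that inv in auto)
  have P_in: "P p w \<in> S" if "w \<in> S" for p w
    unfolding P_def by (intro vec.subspace_sum vec.subspace_scale S pow that)
  have P_X: "P ([:- r, 1:] * q) w = f (P q w) - r *s P q w" for r q w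
  proof (cases "q = 0")
    case True
    then show ?thesis by (simp add: P_def clin_0[OF f])
  next
    case False
    let ?n = "degree q"
    have "degree ([:- r, 1:] * q) \<le> Suc ?n"
      using degree_mult_le[of "[:- r, 1:]" q] by simp
    then have "P ([:- r, 1:] * q) w = (\<Sum>i\<le>Suc ?n. coeff ([:- r, 1:] * q) i *s (f ^^ i) w)"
      by (rule P)
    also have "\<dots> = (\<Sum>i\<le>Suc ?n. coeff (pCons 0 q) i *s (f ^^ i) w)
        - (\<Sum>i\<le>Suc ?n. (r * coeff q i) *s (f ^^ i) w)"
      unfolding sum_subtractf[symmetric]
    proof (rule sum.cong[OF refl])
      fix i
      have "coeff ([:- r, 1:] * q) i = coeff (pCons 0 q) i - r * coeff q i" by simp
      then show "coeff ([:- r, 1:] * q) i *s (f ^^ i) w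
          = coeff (pCons 0 q) i *s (f ^^ i) w - (r * coeff q i) *s (f ^^ i) w"
        by (simp only: vector_sub_rdistrib)
    qed
    also have "(\<Sum>i\<le>Suc ?n. coeff (pCons 0 q) i *s (f ^^ i) w) = f (P q w)"
      by (simp add: sum.atMost_Suc_shift P_def clin_sum[OF f] clin_scale[OF f] del: sum.atMost_Suc)
    also have "(\<Sum>i\<le>Suc ?n. (r * coeff q i) *s (f ^^ i) w) = r *s P q w"
      using P[of q "Suc ?n" w]
      by (simp add: vec.scale_sum_right vector_smult_assoc del: sum.atMost_Suc)
    finally show ?thesis .
  qed
  \<comment> \<open>there are more iterates than the dimension allows to be independent\<close>
  have "\<exists>p. p \<noteq> 0 \<and> P p v = 0"
  proof (cases "inj_on (\<lambda>i. (f ^^ i) v) {..CARD('m)}")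
    case False
    then obtain i j where ij: "i < j" "(f ^^ i) v = (f ^^ j) v"
      unfolding inj_on_def by (metis linorder_neqE_nat)
    let ?p = "monom 1 j - monom 1 i :: complex poly"
    have "degree ?p \<le> j"
      using ij by (intro degree_diff_le) (auto simp: degree_monom_eq)
    then have "P ?p v = (\<Sum>l\<le>j. coeff ?p l *s (f ^^ l) v)" by (rule P)
    also have "\<dots> = (\<Sum>l\<le>j. coeff (monom 1 j :: complex poly) l *s (f ^^ l) v)
        - (\<Sum>l\<le>j. coeff (monom 1 i :: complex poly) l *s (f ^^ l) v)"
      unfolding sum_subtractf[symmetric] by (simp only: coeff_diff vector_sub_rdistrib)
    also have "(\<Sum>l\<le>j. coeff (monom 1 i :: complex poly) l *s (f ^^ l) v) = (f ^^ i) v"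
      using ij by (simp add: coeff_monom if_distrib[of "\<lambda>c. c *s _"] cong: if_cong)
    also have "(\<Sum>l\<le>j. coeff (monom 1 j :: complex poly) l *s (f ^^ l) v) = (f ^^ j) v"
      by (simp add: coeff_monom if_distrib[of "\<lambda>c. c *s _"] cong: if_cong)
    finally have "P ?p v = 0" using ij by simp
    moreover have "?p \<noteq> 0" 
    proof
      assume "?p = 0"
      then have "coeff ?p j = 0" by simp
      with ij show False by simp
    qed
    ultimately show ?thesis by blast
  next
    case True
    let ?g = "\<lambda>i. (f ^^ i) v" and ?I = "{..CARD('m)}"
    have "vec.dependent (?g ` ?I)"
    proof (rule ccontr)
      assume "vec.independent (?g ` ?I)"
      then have "card (?g ` ?I) \<le> vec.dim (UNIV :: (complex ^ 'm) set)"
        by (rule vec.independent_card_le_dim[OF subset_UNIV])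
      then show False unfolding card_image[OF True] vec_dim_card by simp
    qed
    then obtain u w where u: "(\<Sum>x\<in>?g ` ?I. u x *s x) = 0" "w \<in> ?g ` ?I" "u w \<noteq> 0"
      unfolding vec.dependent_finite[OF finite_imageI[OF finite_atMost]] by blast
    have sum0: "(\<Sum>i\<in>?I. u (?g i) *s ?g i) = 0"
      using u(1) by (simp add: sum.reindex[OF True])
    let ?p = "\<Sum>i\<in>?I. monom (u (?g i)) i"
    have cf: "coeff ?p i = (if i \<in> ?I then u (?g i) else 0)" for i
      by (simp add: coeff_sum coeff_monom)
    have "degree ?p \<le> CARD('m)"
      by (rule degree_le) (simp add: cf)
    then have "P ?p v = (\<Sum>i\<in>?I. coeff ?p i *s ?g i)" by (rule P)
    also have "\<dots> = 0" using sum0 by (simp add: cf)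
    finally have "P ?p v = 0" .
    moreover have "?p \<noteq> 0"
    proof
      assume z: "?p = 0"
      obtain i where "i \<in> ?I" "w = ?g i" using u(2) by blast
      then have "coeff ?p i = u w" by (simp add: cf)
      with z u(3) show False by simp
    qed
    ultimately show ?thesis by blast
  qed
  \<comment> \<open>a root of a relation of least degree is an eigenvalue\<close>
  then have ex: "\<exists>p. p \<noteq> 0 \<and> (\<exists>w\<in>S. w \<noteq> 0 \<and> P p w = 0)" using v by blast
  define p where "p = arg_min degree (\<lambda>p. p \<noteq> 0 \<and> (\<exists>w\<in>S. w \<noteq> 0 \<and> P p w = 0))"
  from arg_min_nat_lemma[of "\<lambda>p. p \<noteq> 0 \<and> (\<exists>w\<in>S. w \<noteq> 0 \<and> P p w = 0)" _ degree] ex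
  have p: "p \<noteq> 0" "\<exists>w\<in>S. w \<noteq> 0 \<and> P p w = 0"
    and least: "\<And>q. q \<noteq> 0 \<Longrightarrow> \<exists>w\<in>S. w \<noteq> 0 \<and> P q w = 0 \<Longrightarrow> degree p \<le> degree q"
    unfolding p_def by blast+
  obtain w where w: "w \<in> S" "w \<noteq> 0" "P p w = 0" using p by blast
  have "degree p \<noteq> 0"
  proof
    assume "degree p = 0"
    then have "coeff p 0 *s w = 0" using w(3) by (simp add: P_def)
    moreover have "coeff p 0 \<noteq> 0" using \<open>degree p = 0\<close> p(1) leading_coeff_0_iff[of p] by simp
    ultimately show False using w(2) by (simp add: vector_mul_eq_0)
  qed
  then have "\<not> constant (poly p)" by (simp add: constant_degree)
  then obtain r where "poly p r = 0" using fundamental_theorem_of_algebra by blast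
  then obtain q where q: "p = [:- r, 1:] * q" unfolding poly_eq_0_iff_dvd by blast
  then have "q \<noteq> 0" using p by auto
  then have "degree q < degree p" unfolding q by (subst degree_mult_eq) auto
  then have "P q w \<noteq> 0" using least[OF \<open>q \<noteq> 0\<close>] w by force
  moreover have "f (P q w) = r *s P q w" using w(3) P_X[of r q w] unfolding q by simp
  ultimately show ?thesis using P_in[OF w(1)] by blast
qed

definition hermitian_form :: "(complex ^ 'm \<Rightarrow> complex ^ 'm \<Rightarrow> complex) \<Rightarrow> bool" where
  "hermitian_form k \<longleftrightarrow> (\<forall>x y z. k (x + y) z = k x z + k y z) \<and>
     (\<forall>c x z. k (c *s x) z = c * k x z) \<and> (\<forall>x y. k y x = cnj (k x y))"

text \<open>
  The form \<open>k\<close> is defined everywhere but positive on \<open>S\<close> only: it will be a multiple of a symplectic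
  form, and \<open>S\<close> the negative space of a splitting.
\<close>
locale unitary_on =
  fixes S :: "(complex ^ 'm) set"
    and k :: "complex ^ 'm \<Rightarrow> complex ^ 'm \<Rightarrow> complex"
    and f :: "complex ^ 'm \<Rightarrow> complex ^ 'm"
  assumes sub: "vec.subspace S" and lin: "clin f"
    and inv: "x \<in> S \<Longrightarrow> f x \<in> S"
    and hermitian: "hermitian_form k"
    and pos: "x \<in> S \<Longrightarrow> x \<noteq> 0 \<Longrightarrow> 0 < Re (k x x)"
    and iso: "x \<in> S \<Longrightarrow> y \<in> S \<Longrightarrow> k (f x) (f y) = k x y"
begin

lemma k_add1: "k (x + y) z = k x z + k y z"
  and k_scale1: "k (c *s x) z = c * k x z"
  and k_sym: "k y x = cnj (k x y)"
  using hermitian unfolding hermitian_form_def by blast+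

lemma k_scale2: "k z (c *s x) = cnj c * k z x"
  using k_scale1[of c x z] k_sym[of z "c *s x"] k_sym[of z x] by simp

lemma k_zero1: "k 0 z = 0"
  using k_scale1[of 0 0 z] by simp

lemma k_sum1: "k (\<Sum>i\<in>I. g i) z = (\<Sum>i\<in>I. k (g i) z)"
  by (induction I rule: infinite_finite_induct) (simp_all add: k_zero1 k_add1)

lemma k_sum2: "k z (\<Sum>i\<in>I. g i) = (\<Sum>i\<in>I. k z (g i))"
  using k_sum1[of g I z] k_sym[of z "\<Sum>i\<in>I. g i"] k_sym[of z "g _"]
  by (simp add: k_sym[of z])

lemma k_nonneg: "x \<in> S \<Longrightarrow> 0 \<le> Re (k x x)"
  using pos[of x] by (cases "x = 0") (auto simp: k_zero1)

abbreviation es :: "complex \<Rightarrow> (complex ^ 'm) set" where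
  "es \<equiv> eigenspace_on S f"

lemma subspace_es: "vec.subspace (es c)"
proof (rule vec.subspaceI)
  fix x y a
  assume "x \<in> es c" "y \<in> es c"
  then show "x + y \<in> es c"
    unfolding eigenspace_on_def
    by (simp add: vec.subspace_add[OF sub] clin_add[OF lin] vector_add_ldistrib)
next
  fix x a
  assume "x \<in> es c"
  then show "a *s x \<in> es c"
    unfolding eigenspace_on_def
    by (simp add: vec.subspace_scale[OF sub] clin_scale[OF lin] vector_smult_assoc mult.commute)
qed (simp add: eigenspace_on_def vec.subspace_0[OF sub] clin_0[OF lin])

lemma es_subset: "es c \<subseteq> S"
  unfolding eigenspace_on_def by auto

lemma es_eq: "x \<in> es c \<Longrightarrow> f x = c *s x"
  unfolding eigenspace_on_def by simp

lemma eigenvalue_unit: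
  assumes "x \<in> es c" "x \<noteq> 0"
  shows "c * cnj c = 1"
proof -
  have x: "x \<in> S" using assms es_subset by auto
  have "c * cnj c * k x x = k x x"
    using iso[OF x x] es_eq[OF assms(1)] by (simp add: k_scale1 k_scale2 ac_simps)
  moreover have "k x x \<noteq> 0" using pos[OF x assms(2)] by auto
  ultimately show ?thesis by simp
qed

lemma eigenvalue_cmod: "c \<in> spectrum_on S f \<Longrightarrow> cmod c = 1"
proof -
  assume "c \<in> spectrum_on S f"
  then obtain x where "x \<in> es c" "x \<noteq> 0" unfolding spectrum_on_def by blast
  from eigenvalue_unit[OF this] have "complex_of_real ((cmod c)\<^sup>2) = 1"
    by (simp only: complex_norm_square)
  then have "(cmod c)\<^sup>2 = 1" using of_real_eq_1_iff by blast
  then show ?thesis using norm_ge_zero[of c] by (auto simp: power2_eq_1_iff)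
qed

lemma es_orthogonal:
  assumes "x \<in> es c" "y \<in> es c'" "c \<noteq> c'"
  shows "k x y = 0"
proof (cases "x = 0 \<or> y = 0")
  case True
  then show ?thesis using k_zero1 k_sym[of 0 y] k_sym[of 0 x] by auto
next
  case False
  have xy: "x \<in> S" "y \<in> S" using assms es_subset by auto
  have 1: "c * cnj c' * k x y = k x y"
    using iso[OF xy] es_eq[OF assms(1)] es_eq[OF assms(2)] by (simp add: k_scale1 k_scale2 ac_simps)
  have "c' * cnj c' = 1" using eigenvalue_unit[OF assms(2)] False by simp
  then have "c * cnj c' \<noteq> 1"
    using assms(3) by (metis mult.commute mult.left_commute mult_1_right)
  then show ?thesis using 1 by auto
qed

text \<open>
  The sum of the eigenspaces for the numbers in \<open>A\<close>. It is direct by \<open>es_orthogonal\<close>.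
\<close>
definition ES :: "complex set \<Rightarrow> (complex ^ 'm) set" where
  "ES A = {\<Sum>c\<in>A. g c | g. \<forall>c\<in>A. g c \<in> es c}"

lemma ES_subset: "ES A \<subseteq> S"
  unfolding ES_def using es_subset by (auto intro!: vec.subspace_sum[OF sub])

lemma ES_insert:
  assumes "finite A" "c \<notin> A"
  shows "ES (insert c A) = {x + y | x y. x \<in> es c \<and> y \<in> ES A}"
proof (intro equalityI subsetI)
  fix v assume "v \<in> ES (insert c A)"
  then obtain g where "v = (\<Sum>c\<in>insert c A. g c)" "\<forall>c\<in>insert c A. g c \<in> es c"
    unfolding ES_def by blast
  then show "v \<in> {x + y | x y. x \<in> es c \<and> y \<in> ES A}"
    using assms unfolding ES_def by auto
next
  fix v assume "v \<in> {x + y | x y. x \<in> es c \<and> y \<in> ES A}"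
  then obtain x g where v: "v = x + (\<Sum>c\<in>A. g c)" "x \<in> es c" "\<forall>c\<in>A. g c \<in> es c"
    unfolding ES_def by blast
  let ?h = "g(c := x)"
  have "(\<Sum>a\<in>A. ?h a) = (\<Sum>a\<in>A. g a)"
    by (rule sum.cong) (use assms in auto)
  then have "v = (\<Sum>c\<in>insert c A. ?h c)" using v assms by simp
  moreover have "\<forall>a\<in>insert c A. ?h a \<in> es a" using v by auto
  ultimately show "v \<in> ES (insert c A)" unfolding ES_def by blast
qed

lemma ES_subspace_dim:
  assumes "finite A"
  shows "vec.subspace (ES A) \<and> vec.dim (ES A) = (\<Sum>c\<in>A. vec.dim (es c))"
  using assms
proof induction
  case empty
  have "ES {} = {0}" by (simp add: ES_def)
  then show ?case by (simp add: vec.subspace_single_0)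
next
  case (insert c A)
  have "es c \<inter> ES A = {0}"
  proof (intro equalityI subsetI)
    fix x assume x: "x \<in> es c \<inter> ES A"
    then obtain g where g: "x = (\<Sum>c\<in>A. g c)" "\<forall>c\<in>A. g c \<in> es c"
      unfolding ES_def by blast
    have "k x x = (\<Sum>a\<in>A. k x (g a))"
      using k_sum2[of x g A] g(1) by simp
    also have "\<dots> = 0"
      by (rule sum.neutral) (use x g insert.hyps es_orthogonal in blast)
    finally show "x \<in> {0}" using pos[of x] x es_subset by force
  qed (use insert.IH vec.subspace_0 subspace_es in auto)
  then show ?case
    using vec.dim_sums_Int[OF subspace_es conjunct1[OF insert.IH], of c]
      vec.subspace_sums[OF subspace_es conjunct1[OF insert.IH], of c] insert
    by (simp add: ES_insert)
qed

lemma finite_spectrum: "finite (spectrum_on S f)"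
proof -
  have "card A \<le> vec.dim S" if A: "A \<subseteq> spectrum_on S f" "finite A" for A
  proof -
    have "1 \<le> vec.dim (es c)" if c: "c \<in> A" for c
    proof -
      obtain x where "x \<in> es c" "x \<noteq> 0" using c A unfolding spectrum_on_def by blast
      then have "\<not> es c \<subseteq> {0}" by auto
      then show ?thesis by (metis One_nat_def Suc_leI neq0_conv vec.dim_eq_0)
    qed
    then have "(\<Sum>c\<in>A. 1) \<le> (\<Sum>c\<in>A. vec.dim (es c))" by (rule sum_mono)
    also have "\<dots> = vec.dim (ES A)" using ES_subspace_dim[OF A(2)] by simp
    also have "\<dots> \<le> vec.dim S" by (rule vec.dim_subset[OF ES_subset])
    finally show ?thesis by simp
  qed
  then show ?thesis by (meson finite_if_finite_subsets_card_bdd)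
qed

end

text \<open>
  The orthogonal complement of an eigenvector is invariant and of smaller dimension.
\<close>
lemma unitary_spanned_by_eigenvectors:
  fixes S :: "(complex ^ 'm) set"
  assumes "unitary_on S k f"
  shows "S \<subseteq> vec.span (\<Union>c. eigenspace_on S f c)"
  using assms
proof (induction "vec.dim S" arbitrary: S rule: less_induct)
  case less
  interpret unitary_on S k f by fact
  show ?case
  proof
    fix v assume v: "v \<in> S"
    show "v \<in> vec.span (\<Union>c. es c)"
    proof (cases "v = 0")
      case True then show ?thesis by (simp add: vec.span_zero)
    next
      case False
      obtain c x0 where x0: "x0 \<in> S" "x0 \<noteq> 0" "f x0 = c *s x0"
        using linear_endomorphism_has_eigenvector[OF lin sub inv v False] by blast
      have x0': "x0 \<in> es c" using x0 by (simp add: eigenspace_on_def)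
      have kx: "k x0 x0 \<noteq> 0" using pos[OF x0(1,2)] by auto
      define S' where "S' = {x \<in> S. k x x0 = 0}"
      have sub': "vec.subspace S'"
        unfolding S'_def using sub
        by (auto simp: vec.subspace_def k_add1 k_scale1 k_zero1)
      have inv': "f x \<in> S'" if "x \<in> S'" for x
      proof -
        have "cnj c * k (f x) x0 = 0"
          using iso[of x x0] that x0 unfolding S'_def by (simp add: k_scale2)
        moreover have "c \<noteq> 0" using eigenvalue_unit[OF x0' x0(2)] by auto
        ultimately show ?thesis using that inv unfolding S'_def by simp
      qed
      have U: "unitary_on S' k f"
        by (rule unitary_on.intro) (use sub' lin inv' hermitian pos iso in \<open>auto simp: S'_def\<close>)
      have "S' \<subset> S" using x0 kx unfolding S'_def by auto
      then have "vec.dim S' < vec.dim S"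
        using vec.dim_psubset[of S' S] vec.span_eq_iff[THEN iffD2, OF sub']
          vec.span_eq_iff[THEN iffD2, OF sub] by simp
      from less.hyps[OF this U]
      have IH: "S' \<subseteq> vec.span (\<Union>c. eigenspace_on S' f c)" .
      also have "\<dots> \<subseteq> vec.span (\<Union>c. es c)"
        by (rule vec.span_mono) (auto simp: eigenspace_on_def S'_def)
      finally have S': "S' \<subseteq> vec.span (\<Union>c. es c)" .
      define r where "r = k v x0 / k x0 x0"
      have "k (v - r *s x0) x0 = k v x0 - r * k x0 x0"
        using k_add1[of "v - r *s x0" "r *s x0" x0] by (simp add: k_scale1)
      then have "v - r *s x0 \<in> S'"
        using v x0 kx unfolding S'_def r_def
        by (simp add: vec.subspace_diff[OF sub] vec.subspace_scale[OF sub])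
      then have "v - r *s x0 \<in> vec.span (\<Union>c. es c)" using S' by blast
      moreover have "r *s x0 \<in> vec.span (\<Union>c. es c)"
        using x0' by (intro vec.span_scale vec.span_base) blast
      ultimately have "(v - r *s x0) + r *s x0 \<in> vec.span (\<Union>c. es c)"
        by (rule vec.span_add)
      then show ?thesis by simp
    qed
  qed
qed

section \<open>The number of eigenvalues in an arc\<close>

text \<open>
  The arc in which the definition of the Maslov index counts eigenvalues.
\<close>
definition lower_arc :: "real \<Rightarrow> complex set" where
  "lower_arc e = {z. \<exists>\<theta>. - e \<le> \<theta> \<and> \<theta> < 0 \<and> z = cis \<theta>}"

lemma arc_count_eq: "arc_count S f e = (\<Sum>z \<in> spectrum_on S f \<inter> lower_arc e. vec.dim (eigenspace_on S f z))"
  unfolding arc_count_def lower_arc_def by (rule sum.cong) auto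

lemma cis_eq_one_bounds:
  assumes "cis \<theta> = 1" "- (2 * pi) < \<theta>" "\<theta> < 0"
  shows False
proof -
  have "cos \<theta> = 1" using assms(1) by (simp add: complex_eq_iff)
  then obtain n :: int where n: "\<theta> = of_int n * 2 * pi" using cos_one_2pi_int by blast
  have "n < 0" using assms(3) pi_gt_zero unfolding n by (simp add: mult_less_0_iff)
  then have "real_of_int n * (2 * pi) \<le> (- 1) * (2 * pi)"
    by (intro mult_right_mono) auto
  then show False using assms(2) unfolding n by simp
qed

lemma unit_cis_cases:
  assumes "cmod c = 1"
  obtains \<theta> where "c = cis \<theta>" "- (2 * pi) < \<theta>" "\<theta> \<le> 0"
proof -
  have c: "c = cis (Arg2pi c)"
    using complex_norm_eq_1_exp[of c] assms by (simp add: cis_conv_exp)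
  have b: "0 \<le> Arg2pi c" "Arg2pi c < 2 * pi" using Arg2pi[of c] by auto
  show ?thesis
  proof (cases "Arg2pi c = 0")
    case True
    then show ?thesis using that[of 0] c by simp
  next
    case False
    have "c = cis (Arg2pi c - 2 * pi)"
      using c by (simp add: cis_divide[symmetric])
    then show ?thesis using that[of "Arg2pi c - 2 * pi"] b False by simp
  qed
qed

text \<open>
  For \<open>c = cis \<theta>\<close> the function is \<open>- 2 sin ((\<theta> + e) / 2) sin (\<theta> / 2)\<close>, so it vanishes exactly at
  the two ends of the arc and its sign tells the inside from the outside.
\<close>
lemma arc_sign:
  assumes e: "0 < e" "e < 2 * pi" and c: "cmod c = 1"
  defines "\<phi> \<equiv> Re (cis (e / 2) * c) - cos (e / 2)"
  shows "c \<in> lower_arc e \<Longrightarrow> c \<noteq> cis (- e) \<Longrightarrow> 0 < \<phi>"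
    and "c \<in> lower_arc e \<Longrightarrow> 0 \<le> \<phi>"
    and "c \<notin> lower_arc e \<Longrightarrow> c \<noteq> 1 \<Longrightarrow> \<phi> < 0"
    and "c \<notin> lower_arc e \<Longrightarrow> \<phi> \<le> 0"
    and "1 \<notin> lower_arc e"
    and "c = 1 \<Longrightarrow> \<phi> = 0"
proof -
  obtain \<theta> where th: "c = cis \<theta>" "- (2 * pi) < \<theta>" "\<theta> \<le> 0" using unit_cis_cases[OF c] .
  have phi: "\<phi> = - (2 * sin ((\<theta> + e) / 2) * sin (\<theta> / 2))"
  proof -
    have "\<phi> = cos (e / 2 + \<theta>) - cos (e / 2)" unfolding \<phi>_def th by (simp add: cis_mult)
    also have "\<dots> = 2 * sin ((e / 2 + \<theta> + e / 2) / 2) * sin ((e / 2 - (e / 2 + \<theta>)) / 2)"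
      by (rule cos_diff_cos)
    also have "e / 2 + \<theta> + e / 2 = \<theta> + e" by simp
    also have "(e / 2 - (e / 2 + \<theta>)) / 2 = - (\<theta> / 2)" by simp
    finally show ?thesis by simp
  qed
  have one: "1 \<notin> lower_arc e"
    unfolding lower_arc_def using cis_eq_one_bounds e by (smt (verit) mem_Collect_eq)
  then show "1 \<notin> lower_arc e" .
  show "c = 1 \<Longrightarrow> \<phi> = 0" unfolding \<phi>_def by simp
  have neg: "sin (\<theta> / 2) < 0" if "c \<noteq> 1"
  proof -
    have "\<theta> < 0" using that th by (cases "\<theta> = 0") auto
    then have "0 < sin (- (\<theta> / 2))" using th by (intro sin_gt_zero) auto
    then show ?thesis by simp
  qed
  have in_arc: "- e \<le> \<theta> \<and> c \<noteq> 1" if ca: "c \<in> lower_arc e"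
  proof -
    obtain \<theta>' where t: "- e \<le> \<theta>'" "\<theta>' < 0" "c = cis \<theta>'" using ca unfolding lower_arc_def by blast
    have "\<theta> = \<theta>'"
    proof (rule ccontr)
      assume "\<theta> \<noteq> \<theta>'"
      have "cis \<theta> = cis \<theta>'" unfolding t(3)[symmetric] th(1)[symmetric] by (rule refl)
      then have "cis (\<theta> - \<theta>') = 1" "cis (\<theta>' - \<theta>) = 1" by (simp_all add: cis_divide[symmetric])
      then show False
        using cis_eq_one_bounds[of "\<theta> - \<theta>'"] cis_eq_one_bounds[of "\<theta>' - \<theta>"] t th e \<open>\<theta> \<noteq> \<theta>'\<close>
        by linarith
    qed
    then show ?thesis using t one that by auto
  qed
  have strict: "0 < sin ((\<theta> + e) / 2)" if "- e < \<theta>"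
    using that th e by (intro sin_gt_zero) auto
  have le: "\<theta> < - e \<and> \<theta> < 0 \<or> c = 1" if "c \<notin> lower_arc e"
  proof (rule ccontr)
    assume "\<not> ?thesis"
    then have "- e \<le> \<theta>" "\<theta> < 0" using th by (cases "\<theta> = 0"; auto)+
    then show False using that th(1) unfolding lower_arc_def by blast
  qed
  show p1: "0 < \<phi>" if "c \<in> lower_arc e" "c \<noteq> cis (- e)"
  proof -
    have "- e < \<theta>" using in_arc[OF that(1)] that(2) th by (cases "\<theta> = - e") auto
    then show ?thesis unfolding phi using strict neg in_arc[OF that(1)] by (simp add: mult_pos_neg)
  qed
  show "0 \<le> \<phi>" if "c \<in> lower_arc e"
  proof (cases "c = cis (- e)")
    case True
    then have "\<phi> = cos (e / 2 + - e) - cos (e / 2)" unfolding \<phi>_def by (simp add: cis_mult)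
    also have "\<dots> = 0" using cos_minus[of "e / 2"] by (simp add: field_simps)
    finally show ?thesis by simp
  next
    case False then show ?thesis using p1 that by force
  qed
  show p2: "\<phi> < 0" if "c \<notin> lower_arc e" "c \<noteq> 1"
  proof -
    have "\<theta> < - e" using le that by auto
    then have "0 < sin (- ((\<theta> + e) / 2))"
    proof (intro sin_gt_zero)
      show "- ((\<theta> + e) / 2) < pi" using th(2) e(1) by (simp add: field_simps)
    qed simp
    then have "sin ((\<theta> + e) / 2) < 0" by (simp only: sin_minus)
    then show ?thesis unfolding phi using neg[OF that(2)] by (simp add: mult_neg_neg)
  qed
  show "\<phi> \<le> 0" if "c \<notin> lower_arc e"
    using p2 that \<open>c = 1 \<Longrightarrow> \<phi> = 0\<close> by (cases "c = 1") force+
qed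

context unitary_on
begin

abbreviation \<phi> :: "real \<Rightarrow> complex \<Rightarrow> real" where
  "\<phi> e c \<equiv> Re (cis (e / 2) * c) - cos (e / 2)"

text \<open>
  On a unit eigenvector with eigenvalue \<open>c\<close> this form takes the value \<open>\<phi> e c\<close>. So its positive index
  is the number of eigenvalues in the arc if \<open>cis (- e)\<close> is not among them. In contrast to
  eigenvalues, the form is visibly continuous in \<open>f\<close> and \<open>k\<close>.
\<close>
abbreviation arc_form :: "real \<Rightarrow> complex ^ 'm \<Rightarrow> real" where
  "arc_form e v \<equiv> Re (cis (e / 2) * k (f v) v) - cos (e / 2) * Re (k v v)"

lemma k_real: "k x x = complex_of_real (Re (k x x))"
  using k_sym[of x x] by (simp add: complex_eq_iff)

lemma k_eigen_sum:
  assumes "finite A" "\<And>c. c \<in> A \<Longrightarrow> g c \<in> es c"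
  shows "k (\<Sum>c\<in>A. b c *s g c) (\<Sum>c\<in>A. g c) = (\<Sum>c\<in>A. b c * k (g c) (g c))"
proof -
  have "k (\<Sum>c\<in>A. b c *s g c) (\<Sum>c\<in>A. g c) = (\<Sum>c\<in>A. \<Sum>c'\<in>A. b c * k (g c) (g c'))"
    unfolding k_sum1 by (simp only: k_sum2 k_scale1 sum_distrib_left)
  also have "\<dots> = (\<Sum>c\<in>A. b c * k (g c) (g c))"
  proof (rule sum.cong[OF refl])
    fix c assume c: "c \<in> A"
    have "(\<Sum>c'\<in>A. b c * k (g c) (g c')) = (\<Sum>c'\<in>A. if c' = c then b c * k (g c) (g c) else 0)"
      by (rule sum.cong[OF refl]) (use es_orthogonal[of "g c" c] assms(2) c in force)
    then show "(\<Sum>c'\<in>A. b c * k (g c) (g c')) = b c * k (g c) (g c)"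
      using c assms(1) by simp
  qed
  finally show ?thesis .
qed

lemma arc_form_ES:
  assumes "finite A" "v \<in> ES A"
  shows "\<exists>g. (\<forall>c\<in>A. g c \<in> es c) \<and> v = (\<Sum>c\<in>A. g c) \<and>
    arc_form e v = (\<Sum>c\<in>A. \<phi> e c * Re (k (g c) (g c)))"
proof -
  obtain g where g: "\<And>c. c \<in> A \<Longrightarrow> g c \<in> es c" "v = (\<Sum>c\<in>A. g c)"
    using assms(2) unfolding ES_def by blast
  have fv: "f v = (\<Sum>c\<in>A. c *s g c)"
    unfolding g(2) clin_sum[OF lin] by (rule sum.cong[OF refl]) (use g es_eq in blast)
  have "k (f v) v = k (\<Sum>c\<in>A. c *s g c) (\<Sum>c\<in>A. g c)"
    unfolding fv by (simp only: g(2))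
  then have "k (f v) v = (\<Sum>c\<in>A. c * complex_of_real (Re (k (g c) (g c))))"
    using k_eigen_sum[OF assms(1) g(1), of "\<lambda>c. c"] by (simp flip: k_real)
  moreover have "k v v = (\<Sum>c\<in>A. complex_of_real (Re (k (g c) (g c))))"
    using k_eigen_sum[OF assms(1) g(1), of "\<lambda>c. 1"] by (simp add: g(2) flip: k_real)
  ultimately have "arc_form e v = (\<Sum>c\<in>A. Re (cis (e / 2) * (c * complex_of_real (Re (k (g c) (g c))))))
      - (\<Sum>c\<in>A. cos (e / 2) * Re (k (g c) (g c)))"
    by (simp add: sum_distrib_left)
  also have "\<dots> = (\<Sum>c\<in>A. \<phi> e c * Re (k (g c) (g c)))"
    unfolding sum_subtractf[symmetric] by (rule sum.cong[OF refl]) (simp add: algebra_simps)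
  finally show ?thesis using g by blast
qed

lemma Re_k_eigen: "x \<in> es c \<Longrightarrow> 0 \<le> Re (k x x)" "x \<in> es c \<Longrightarrow> x \<noteq> 0 \<Longrightarrow> 0 < Re (k x x)"
  using k_nonneg[of x] pos[of x] es_subset by blast+

lemma arc_form_sign:
  assumes "finite A" "v \<in> ES A"
  shows "(\<And>c. c \<in> A \<Longrightarrow> 0 \<le> \<phi> e c) \<Longrightarrow> 0 \<le> arc_form e v"
    and "(\<And>c. c \<in> A \<Longrightarrow> \<phi> e c \<le> 0) \<Longrightarrow> arc_form e v \<le> 0"
    and "v \<noteq> 0 \<Longrightarrow> (\<And>c. c \<in> A \<Longrightarrow> 0 < \<phi> e c) \<Longrightarrow> 0 < arc_form e v"
    and "v \<noteq> 0 \<Longrightarrow> (\<And>c. c \<in> A \<Longrightarrow> \<phi> e c < 0) \<Longrightarrow> arc_form e v < 0"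
proof -
  obtain g where g: "\<And>c. c \<in> A \<Longrightarrow> g c \<in> es c" "v = (\<Sum>c\<in>A. g c)"
    and h: "arc_form e v = (\<Sum>c\<in>A. \<phi> e c * Re (k (g c) (g c)))"
    using arc_form_ES[OF assms, of e] by (elim exE conjE) (rule that, auto)
  note kg = Re_k_eigen(1)[OF g(1)]
  have ex: "\<exists>c\<in>A. g c \<noteq> 0" if "v \<noteq> 0"
  proof (rule ccontr)
    assume "\<not> ?thesis"
    then have "(\<Sum>c\<in>A. g c) = 0" by (intro sum.neutral) blast
    then show False using that g(2) by simp
  qed
  show "0 \<le> arc_form e v" if "\<And>c. c \<in> A \<Longrightarrow> 0 \<le> \<phi> e c"
    unfolding h by (intro sum_nonneg mult_nonneg_nonneg that kg)
  show "arc_form e v \<le> 0" if "\<And>c. c \<in> A \<Longrightarrow> \<phi> e c \<le> 0"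
    unfolding h by (intro sum_nonpos mult_nonpos_nonneg that kg)
  show "0 < arc_form e v" if v: "v \<noteq> 0" and p: "\<And>c. c \<in> A \<Longrightarrow> 0 < \<phi> e c"
  proof -
    obtain c where c: "c \<in> A" "g c \<noteq> 0" using ex[OF v] by blast
    show ?thesis unfolding h
    proof (rule sum_pos2[OF assms(1) c(1)])
      show "0 < \<phi> e c * Re (k (g c) (g c))"
        by (rule mult_pos_pos[OF p[OF c(1)] Re_k_eigen(2)[OF g(1)[OF c(1)] c(2)]])
      show "0 \<le> \<phi> e c * Re (k (g c) (g c))" if "c \<in> A" for c
        by (rule mult_nonneg_nonneg[OF less_imp_le[OF p[OF that]] kg[OF that]])
    qed
  qed
  show "arc_form e v < 0" if v: "v \<noteq> 0" and p: "\<And>c. c \<in> A \<Longrightarrow> \<phi> e c < 0"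
  proof -
    obtain c where c: "c \<in> A" "g c \<noteq> 0" using ex[OF v] by blast
    have "0 < (\<Sum>c\<in>A. - \<phi> e c * Re (k (g c) (g c)))"
    proof (rule sum_pos2[OF assms(1) c(1)])
      show "0 < - \<phi> e c * Re (k (g c) (g c))"
        using mult_neg_pos[OF p[OF c(1)] Re_k_eigen(2)[OF g(1)[OF c(1)] c(2)]]
        by (simp only: mult_minus_left neg_0_less_iff_less)
      show "0 \<le> - \<phi> e c * Re (k (g c) (g c))" if "c \<in> A" for c
        using mult_nonpos_nonneg[OF less_imp_le[OF p[OF that]] kg[OF that]]
        by (simp only: mult_minus_left neg_0_le_iff_le)
    qed
    then show ?thesis unfolding h by (simp only: mult_minus_left sum_negf neg_0_less_iff_less)
  qed
qed

lemma es_trivial: "c \<notin> spectrum_on S f \<longleftrightarrow> es c = {0}"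
  unfolding spectrum_on_def using vec.subspace_0[OF subspace_es, of c] by auto

lemma dim_es_trivial: "c \<notin> spectrum_on S f \<Longrightarrow> vec.dim (es c) = 0"
  by (simp add: es_trivial)

lemma ES_spectrum: "ES (spectrum_on S f) = S"
proof (rule antisym[OF ES_subset])
  have "es c \<subseteq> ES (spectrum_on S f)" for c
  proof
    fix x assume x: "x \<in> es c"
    show "x \<in> ES (spectrum_on S f)"
    proof (cases "c \<in> spectrum_on S f")
      case True
      let ?g = "\<lambda>a. if a = c then x else 0"
      have "x = (\<Sum>a\<in>spectrum_on S f. ?g a)" using True finite_spectrum by simp
      moreover have "\<forall>a\<in>spectrum_on S f. ?g a \<in> es a"
        using x vec.subspace_0[OF subspace_es] by simp
      ultimately show ?thesis unfolding ES_def by blast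
    next
      case False
      then have "x = 0" using x es_trivial by auto
      then show ?thesis using vec.subspace_0 ES_subspace_dim[OF finite_spectrum] by blast
    qed
  qed
  then have "vec.span (\<Union>c. es c) \<subseteq> ES (spectrum_on S f)"
    using ES_subspace_dim[OF finite_spectrum] by (intro vec.span_minimal) auto
  then show "S \<subseteq> ES (spectrum_on S f)"
    using unitary_spanned_by_eigenvectors unitary_on_axioms by blast
qed

lemma dim_spectrum: "vec.dim S = (\<Sum>c\<in>spectrum_on S f. vec.dim (es c))"
  using ES_subspace_dim[OF finite_spectrum] ES_spectrum by simp

lemma arc_count_ES: "arc_count S f e = vec.dim (ES (spectrum_on S f \<inter> lower_arc e))"
  using ES_subspace_dim[of "spectrum_on S f \<inter> lower_arc e"] finite_spectrum by (simp add: arc_count_eq)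

lemma dim_disjoint:
  assumes "vec.subspace W" "W \<subseteq> S" "finite A" "\<And>v. v \<in> W \<Longrightarrow> v \<in> ES A \<Longrightarrow> v = 0"
  shows "vec.dim W + (\<Sum>c\<in>A. vec.dim (es c)) \<le> vec.dim S"
proof -
  have E: "vec.subspace (ES A)" "vec.dim (ES A) = (\<Sum>c\<in>A. vec.dim (es c))"
    using ES_subspace_dim[OF assms(3)] by auto
  have "W \<inter> ES A \<subseteq> {0}" using assms(4) by blast
  then have "vec.dim (W \<inter> ES A) = 0" by simp
  then have "vec.dim W + vec.dim (ES A) = vec.dim {x + y | x y. x \<in> W \<and> y \<in> ES A}"
    using vec.dim_sums_Int[OF assms(1) E(1)] by linarith
  also have "\<dots> \<le> vec.dim S"
    by (rule vec.dim_subset) (use assms(2) ES_subset vec.subspace_add[OF sub] in blast)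
  finally show ?thesis using E(2) by simp
qed

lemma one_not_in_arc: "0 < e \<Longrightarrow> e < 2 * pi \<Longrightarrow> 1 \<notin> lower_arc e"
  using arc_sign(5)[of e 1] by simp

text \<open>
  A positive subspace meets the sum of the eigenspaces outside the arc only in 0, because the form is
  nonpositive there.
\<close>
lemma positive_subspace_dim_le:
  assumes e: "0 < e" "e < 2 * pi"
    and W: "vec.subspace W" "W \<subseteq> S" "\<And>v. v \<in> W \<Longrightarrow> v \<noteq> 0 \<Longrightarrow> 0 < arc_form e v"
  shows "vec.dim W \<le> arc_count S f e"
proof -
  let ?A = "spectrum_on S f - lower_arc e"
  have "vec.dim W + (\<Sum>c\<in>?A. vec.dim (es c)) \<le> vec.dim S"
  proof (rule dim_disjoint)
    fix v assume v: "v \<in> W" "v \<in> ES ?A"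
    have "arc_form e v \<le> 0"
      by (rule arc_form_sign(2)[OF _ v(2)])
        (use finite_spectrum arc_sign(4)[OF e eigenvalue_cmod] in auto)
    then show "v = 0" using W(3)[OF v(1)] by force
  qed (use W finite_spectrum in auto)
  moreover have "vec.dim S = arc_count S f e + (\<Sum>c\<in>?A. vec.dim (es c))"
    unfolding dim_spectrum arc_count_eq
    using sum.Int_Diff[OF finite_spectrum, of "\<lambda>c. vec.dim (es c)" "lower_arc e"] by simp
  ultimately show ?thesis by simp
qed

text \<open>
  The form is nonnegative on the sum of the eigenspaces for the arc and for its end point 1.
\<close>
lemma negative_subspace_dim_le:
  assumes e: "0 < e" "e < 2 * pi"
    and W: "vec.subspace W" "W \<subseteq> S" "\<And>v. v \<in> W \<Longrightarrow> v \<noteq> 0 \<Longrightarrow> arc_form e v < 0"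
  shows "vec.dim W + arc_count S f e + vec.dim (es 1) \<le> vec.dim S"
proof -
  let ?A = "spectrum_on S f \<inter> lower_arc e"
  have fin: "finite (insert 1 ?A)" using finite_spectrum by simp
  have "vec.dim W + (\<Sum>c\<in>insert 1 ?A. vec.dim (es c)) \<le> vec.dim S"
  proof (rule dim_disjoint[OF W(1,2) fin])
    fix v assume v: "v \<in> W" "v \<in> ES (insert 1 ?A)"
    have "0 \<le> arc_form e v"
    proof (rule arc_form_sign(1)[OF fin v(2)])
      fix c assume "c \<in> insert 1 ?A"
      then show "0 \<le> \<phi> e c"
        using arc_sign(2)[OF e eigenvalue_cmod, of c] by auto
    qed
    then show "v = 0" using W(3)[OF v(1)] by force
  qed
  then show ?thesis
    using one_not_in_arc[OF e] finite_spectrum by (simp add: arc_count_eq)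
qed

lemma ex_positive_subspace:
  assumes e: "0 < e" "e < 2 * pi" and "cis (- e) \<notin> spectrum_on S f"
  obtains W where "vec.subspace W" "W \<subseteq> S" "\<And>v. v \<in> W \<Longrightarrow> v \<noteq> 0 \<Longrightarrow> 0 < arc_form e v"
    "vec.dim W = arc_count S f e"
proof
  let ?A = "spectrum_on S f \<inter> lower_arc e"
  have fin: "finite ?A" using finite_spectrum by simp
  show "vec.subspace (ES ?A)" using ES_subspace_dim[OF fin] by simp
  show "0 < arc_form e v" if "v \<in> ES ?A" "v \<noteq> 0" for v
  proof (rule arc_form_sign(3)[OF fin that])
    fix c assume c: "c \<in> ?A"
    show "0 < \<phi> e c"
      by (rule arc_sign(1)[OF e eigenvalue_cmod]) (use c assms(3) in auto)
  qed
qed (use ES_subset arc_count_ES in auto)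

lemma ex_negative_subspace:
  assumes e: "0 < e" "e < 2 * pi"
  obtains W where "vec.subspace W" "W \<subseteq> S" "\<And>v. v \<in> W \<Longrightarrow> v \<noteq> 0 \<Longrightarrow> arc_form e v < 0"
    "vec.dim W + arc_count S f e + vec.dim (es 1) = vec.dim S"
proof
  let ?A = "spectrum_on S f - insert 1 (lower_arc e)"
  have fin: "finite ?A" using finite_spectrum by simp
  show "vec.subspace (ES ?A)" using ES_subspace_dim[OF fin] by simp
  show "ES ?A \<subseteq> S" by (rule ES_subset)
  show "arc_form e v < 0" if "v \<in> ES ?A" "v \<noteq> 0" for v
  proof (rule arc_form_sign(4)[OF fin that])
    fix c assume c: "c \<in> ?A"
    show "\<phi> e c < 0"
      by (rule arc_sign(3)[OF e eigenvalue_cmod]) (use c in auto)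
  qed
  have "vec.dim S = (\<Sum>c\<in>spectrum_on S f \<inter> insert 1 (lower_arc e). vec.dim (es c)) + vec.dim (ES ?A)"
    unfolding dim_spectrum using ES_subspace_dim[OF fin]
      sum.Int_Diff[OF finite_spectrum, of "\<lambda>c. vec.dim (es c)" "insert 1 (lower_arc e)"] by simp
  also have "(\<Sum>c\<in>spectrum_on S f \<inter> insert 1 (lower_arc e). vec.dim (es c)) = arc_count S f e + vec.dim (es 1)"
    using one_not_in_arc[OF e] finite_spectrum
    by (cases "1 \<in> spectrum_on S f") (simp_all add: arc_count_eq Int_insert_right dim_es_trivial)
  finally show "vec.dim (ES ?A) + arc_count S f e + vec.dim (es 1) = vec.dim S" by simp
qed

lemma unitary_rotate: "unitary_on S k (\<lambda>v. cis a *s f v)"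
proof (rule unitary_on.intro)
  show "clin (\<lambda>v. cis a *s f v)"
    by (rule clinI) (simp_all add: clin_add[OF lin] clin_scale[OF lin] vector_add_ldistrib
        vector_smult_assoc mult.commute)
  fix x y assume "x \<in> S" "y \<in> S"
  then show "k (cis a *s f x) (cis a *s f y) = k x y"
    using cis_cnj[of a] by (simp add: k_scale1 k_scale2 iso cis_mult flip: mult.assoc)
qed (use sub inv vec.subspace_scale[OF sub] hermitian pos in auto)

end

lemma eigenspace_rotate:
  "eigenspace_on S (\<lambda>v. cis a *s f v) c = eigenspace_on S f (cis (- a) * c)"
proof -
  have "cis a *s w = c *s v \<longleftrightarrow> w = (cis (- a) * c) *s v" for w v :: "complex ^ 'm"
  proof
    assume "cis a *s w = c *s v"
    then have "cis (- a) *s (cis a *s w) = cis (- a) *s (c *s v)" by simp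
    then show "w = (cis (- a) * c) *s v" by (simp add: vector_smult_assoc cis_mult)
  next
    assume "w = (cis (- a) * c) *s v"
    then have "cis a *s w = (cis a * (cis (- a) * c)) *s v" by (simp add: vector_smult_assoc)
    also have "cis a * (cis (- a) * c) = c" by (simp add: cis_mult flip: mult.assoc)
    finally show "cis a *s w = c *s v" .
  qed
  then show ?thesis unfolding eigenspace_on_def by blast
qed

lemma spectrum_rotate:
  "c \<in> spectrum_on S (\<lambda>v. cis a *s f v) \<longleftrightarrow> cis (- a) * c \<in> spectrum_on S f"
  unfolding spectrum_on_def eigenspace_rotate by simp

lemma arc_count_rotate:
  "arc_count S (\<lambda>v. cis a *s f v) e =
     (\<Sum>z\<in>spectrum_on S f \<inter> (*) (cis (- a)) ` lower_arc e. vec.dim (eigenspace_on S f z))"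
proof -
  have inj: "inj_on ((*) (cis (- a))) X" for X by (simp add: inj_on_def)
  have "spectrum_on S f \<inter> (*) (cis (- a)) ` lower_arc e
      = (*) (cis (- a)) ` (spectrum_on S (\<lambda>v. cis a *s f v) \<inter> lower_arc e)"
    using spectrum_rotate by blast
  then show ?thesis
    by (simp add: sum.reindex[OF inj] arc_count_eq eigenspace_rotate)
qed

lemma rotated_arc: "(*) (cis b) ` lower_arc e = {cis \<theta> | \<theta>. b - e \<le> \<theta> \<and> \<theta> < b}"
proof (intro equalityI subsetI)
  fix z assume "z \<in> (*) (cis b) ` lower_arc e"
  then obtain \<theta> where "- e \<le> \<theta>" "\<theta> < 0" "z = cis (b + \<theta>)" unfolding lower_arc_def by (auto simp: cis_mult)
  then show "z \<in> {cis \<theta> | \<theta>. b - e \<le> \<theta> \<and> \<theta> < b}" by force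
next
  fix z assume "z \<in> {cis \<theta> | \<theta>. b - e \<le> \<theta> \<and> \<theta> < b}"
  then obtain \<theta> where th: "b - e \<le> \<theta>" "\<theta> < b" "z = cis \<theta>" by blast
  then have "z = cis b * cis (\<theta> - b)" by (simp add: cis_mult)
  moreover have "cis (\<theta> - b) \<in> lower_arc e" unfolding lower_arc_def
    using th by (intro CollectI exI[of _ "\<theta> - b"]) simp
  ultimately show "z \<in> (*) (cis b) ` lower_arc e" by blast
qed

lemma cis_inj:
  assumes "cis \<theta> = cis \<theta>'" "\<bar>\<theta> - \<theta>'\<bar> < 2 * pi"
  shows "\<theta> = \<theta>'"
proof (rule ccontr)
  assume "\<theta> \<noteq> \<theta>'"
  have "cis (\<theta> - \<theta>') = 1" "cis (\<theta>' - \<theta>) = 1" using assms(1) by (simp_all add: cis_divide[symmetric])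
  then show False
    using cis_eq_one_bounds[of "\<theta> - \<theta>'"] cis_eq_one_bounds[of "\<theta>' - \<theta>"] assms(2) \<open>\<theta> \<noteq> \<theta>'\<close>
    by linarith
qed

context unitary_on
begin

text \<open>
  The part of the larger arc beyond \<open>- e\<close> is an arc that ends at \<open>cis (- e)\<close>; turning the operator by
  \<open>cis e\<close> moves this end to 1.
\<close>
lemma arc_count_split:
  assumes "0 < e" "e < e'" "e' < 2 * pi"
  shows "arc_count S f e' = arc_count S f e + arc_count S (\<lambda>v. cis e *s f v) (e' - e)"
proof -
  let ?B = "(*) (cis (- e)) ` lower_arc (e' - e)"
  have B: "?B = {cis \<theta> | \<theta>. - e' \<le> \<theta> \<and> \<theta> < - e}" using rotated_arc[of "- e" "e' - e"] by simp
  have A: "lower_arc e = {cis \<theta> | \<theta>. - e \<le> \<theta> \<and> \<theta> < 0}" "lower_arc e' = {cis \<theta> | \<theta>. - e' \<le> \<theta> \<and> \<theta> < 0}"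
    unfolding lower_arc_def by auto
  have "lower_arc e' = lower_arc e \<union> ?B"
  proof (intro equalityI subsetI)
    fix z assume "z \<in> lower_arc e'"
    then obtain \<theta> where "- e' \<le> \<theta>" "\<theta> < 0" "z = cis \<theta>" unfolding A by blast
    then show "z \<in> lower_arc e \<union> ?B" unfolding A B
      by (cases "- e \<le> \<theta>") (blast, metis (mono_tags, lifting) CollectI UnI2 not_le)
  next
    fix z assume "z \<in> lower_arc e \<union> ?B"
    then show "z \<in> lower_arc e'"
    proof
      assume "z \<in> lower_arc e"
      then obtain \<theta> where "- e \<le> \<theta>" "\<theta> < 0" "z = cis \<theta>" unfolding A by blast
      then show ?thesis unfolding A using assms by (intro CollectI exI[of _ \<theta>]) simp
    next
      assume "z \<in> ?B"
      then obtain \<theta> where "- e' \<le> \<theta>" "\<theta> < - e" "z = cis \<theta>" unfolding B by blast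
      then show ?thesis unfolding A using assms by (intro CollectI exI[of _ \<theta>]) simp
    qed
  qed
  moreover have "lower_arc e \<inter> ?B = {}"
  proof -
    have "cis \<theta> \<noteq> cis \<theta>'" if "- e \<le> \<theta>" "\<theta> < 0" "- e' \<le> \<theta>'" "\<theta>' < - e" for \<theta> \<theta>'
      using cis_inj[of \<theta> \<theta>'] that assms by auto
    then show ?thesis unfolding A B by auto
  qed
  ultimately show ?thesis
    unfolding arc_count_rotate arc_count_eq[of S f] using finite_spectrum
    by (simp add: Int_Un_distrib sum.union_disjoint Int_assoc disjoint_iff)
qed

text \<open>
  If the spectrum is invariant under conjugation, the arcs on both sides of 1 contain equally many
  eigenvalues. Together with the eigenvalue 1 they make up the arc of length \<open>2 * e\<close> around 1, which
  is a lower arc for the operator turned by \<open>cis (- e)\<close>.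
\<close>
lemma arc_count_symmetric:
  assumes e: "0 < e" "e < pi" and end_e: "cis e \<notin> spectrum_on S f"
    and sym: "\<And>c. vec.dim (es (cnj c)) = vec.dim (es c)"
  shows "2 * arc_count S f e + vec.dim (es 1) = arc_count S (\<lambda>v. cis (- e) *s f v) (2 * e)"
proof -
  let ?sp = "spectrum_on S f"
  have inspec: "c \<in> ?sp \<longleftrightarrow> vec.dim (es c) \<noteq> 0" for c
  proof -
    have "0 \<in> es c" by (rule vec.subspace_0[OF subspace_es])
    then have "es c = {0} \<longleftrightarrow> es c \<subseteq> {0}"
      by (metis empty_iff subset_refl subset_singletonD)
    then show ?thesis using es_trivial[of c] vec.dim_eq_0[of "es c"] by argo
  qed
  let ?B = "(*) (cis e) ` lower_arc (2 * e)"
  have B: "?B = {cis \<theta> | \<theta>. - e \<le> \<theta> \<and> \<theta> < e}" using rotated_arc[of e "2 * e"] by simp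
  have cn: "cnj ` (?sp \<inter> lower_arc e) = ?sp \<inter> {cis \<theta> | \<theta>. 0 < \<theta> \<and> \<theta> < e}"
  proof (intro equalityI subsetI)
    fix z assume "z \<in> cnj ` (?sp \<inter> lower_arc e)"
    then obtain \<theta> where t: "- e \<le> \<theta>" "\<theta> < 0" "z = cis (- \<theta>)" "cnj z \<in> ?sp"
      unfolding lower_arc_def by (auto simp: cis_cnj)
    have "z \<in> ?sp" using t(4) sym[of z] unfolding inspec by simp
    moreover have "\<theta> \<noteq> - e" using t(3) \<open>z \<in> ?sp\<close> end_e by auto
    ultimately show "z \<in> ?sp \<inter> {cis \<theta> | \<theta>. 0 < \<theta> \<and> \<theta> < e}" using t by force
  next
    fix z assume "z \<in> ?sp \<inter> {cis \<theta> | \<theta>. 0 < \<theta> \<and> \<theta> < e}"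
    then obtain \<theta> where t: "0 < \<theta>" "\<theta> < e" "z = cis \<theta>" "z \<in> ?sp" by blast
    have "cnj z \<in> ?sp" using t(4) sym[of z] unfolding inspec by simp
    moreover have "cnj z \<in> lower_arc e" unfolding lower_arc_def using t by (auto simp: cis_cnj intro!: exI[of _ "- \<theta>"])
    ultimately show "z \<in> cnj ` (?sp \<inter> lower_arc e)" by (metis IntI complex_cnj_cnj image_eqI)
  qed
  have A: "lower_arc e = {cis \<theta> | \<theta>. - e \<le> \<theta> \<and> \<theta> < 0}" unfolding lower_arc_def by auto
  have un: "?sp \<inter> ?B = (?sp \<inter> lower_arc e) \<union> ((?sp \<inter> {1}) \<union> cnj ` (?sp \<inter> lower_arc e))"
    unfolding cn unfolding A B
  proof (intro equalityI subsetI)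
    fix z assume "z \<in> ?sp \<inter> {cis \<theta> | \<theta>. - e \<le> \<theta> \<and> \<theta> < e}"
    then obtain \<theta> where t: "- e \<le> \<theta>" "\<theta> < e" "z = cis \<theta>" "z \<in> ?sp" by blast
    consider "\<theta> < 0" | "\<theta> = 0" | "0 < \<theta>" by linarith
    then show "z \<in> ?sp \<inter> {cis \<theta> | \<theta>. - e \<le> \<theta> \<and> \<theta> < 0} \<union> (?sp \<inter> {1} \<union> ?sp \<inter> {cis \<theta> | \<theta>. 0 < \<theta> \<and> \<theta> < e})"
      using t by cases auto
  next
    fix z assume "z \<in> ?sp \<inter> {cis \<theta> | \<theta>. - e \<le> \<theta> \<and> \<theta> < 0} \<union> (?sp \<inter> {1} \<union> ?sp \<inter> {cis \<theta> | \<theta>. 0 < \<theta> \<and> \<theta> < e})"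
    then consider \<theta> where "- e \<le> \<theta>" "\<theta> < 0" "z = cis \<theta>" "z \<in> ?sp" | "z = 1" "z \<in> ?sp"
      | \<theta> where "0 < \<theta>" "\<theta> < e" "z = cis \<theta>" "z \<in> ?sp" by blast
    then show "z \<in> ?sp \<inter> {cis \<theta> | \<theta>. - e \<le> \<theta> \<and> \<theta> < e}"
    proof cases
      case (1 \<theta>)
      then show ?thesis using e by (intro IntI CollectI exI[of _ \<theta>]) auto
    next
      case 2
      then show ?thesis using e by (intro IntI CollectI exI[of _ 0]) auto
    next
      case (3 \<theta>)
      then show ?thesis using e by (intro IntI CollectI exI[of _ \<theta>]) auto
    qed
  qed
  have d1: "?sp \<inter> lower_arc e \<inter> ((?sp \<inter> {1}) \<union> cnj ` (?sp \<inter> lower_arc e)) = {}"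
  proof -
    have "cis \<theta> \<noteq> cis \<theta>'" if "- e \<le> \<theta>" "\<theta> < 0" "0 < \<theta>'" "\<theta>' < e" for \<theta> \<theta>'
      using cis_inj[of \<theta> \<theta>'] that e by auto
    moreover have "1 \<notin> lower_arc e" using one_not_in_arc e by simp
    ultimately show ?thesis unfolding cn unfolding A by auto
  qed
  have d2: "(?sp \<inter> {1}) \<inter> cnj ` (?sp \<inter> lower_arc e) = {}"
  proof -
    have "cis 0 \<noteq> cis \<theta>'" if "0 < \<theta>'" "\<theta>' < e" for \<theta>'
      using cis_inj[of 0 \<theta>'] that e by auto
    then show ?thesis unfolding cn by auto
  qed
  have "inj_on cnj (?sp \<inter> lower_arc e)" by (simp add: inj_on_def)
  then have s: "(\<Sum>z\<in>cnj ` (?sp \<inter> lower_arc e). vec.dim (es z)) = arc_count S f e"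
    by (simp add: sum.reindex sym arc_count_eq)
  have one: "(\<Sum>z\<in>?sp \<inter> {1}. vec.dim (es z)) = vec.dim (es 1)"
    by (cases "1 \<in> ?sp") (simp_all add: dim_es_trivial)
  have fin: "finite (?sp \<inter> X)" for X using finite_spectrum by simp
  show ?thesis
    unfolding arc_count_rotate minus_minus un
    using sum.union_disjoint[OF fin _ d1, of "\<lambda>z. vec.dim (es z)"]
      sum.union_disjoint[OF fin _ d2, of "\<lambda>z. vec.dim (es z)"] fin s one
    by (simp add: arc_count_eq)
qed

end

section \<open>Continuous families of unitary operators\<close>

lemma continuous_on_vector_scalar [continuous_intros]:
  fixes g :: "'y::topological_space \<Rightarrow> complex ^ 'm"
  assumes "continuous_on A c" "continuous_on A g"
  shows "continuous_on A (\<lambda>p. c p *s g p)"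
  unfolding vector_scalar_mult_def by (intro continuous_intros assms)

lemma vec_subspace_imp_subspace:
  assumes "vec.subspace (W :: (complex ^ 'm) set)"
  shows "subspace W"
  using assms unfolding subspace_def vec.subspace_def by (simp add: scaleR_eq_scalar)

text \<open>
  By homogeneity it suffices to look at unit vectors, and these are compact.
\<close>
lemma eventually_positive_on_subspace:
  fixes Q :: "'x::topological_space \<Rightarrow> complex ^ 'm \<Rightarrow> real"
  assumes cont: "continuous_on UNIV (\<lambda>p. Q (fst p) (snd p))"
    and scale: "\<And>x r v. Q x (r *\<^sub>R v) = r\<^sup>2 * Q x v"
    and W: "vec.subspace W" and pos: "\<And>v. v \<in> W \<Longrightarrow> v \<noteq> 0 \<Longrightarrow> 0 < Q x0 v"
  shows "\<forall>\<^sub>F x in nhds x0. \<forall>v\<in>W. v \<noteq> 0 \<longrightarrow> 0 < Q x v"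
proof -
  define K where "K = sphere 0 1 \<inter> W"
  have "compact K"
    unfolding K_def by (intro compact_Int_closed compact_sphere closed_subspace
        vec_subspace_imp_subspace W)
  moreover define P where "P = (\<lambda>p. Q (fst p) (snd p)) -` {0<..}"
  have "open P"
    unfolding P_def by (rule open_vimage[OF open_greaterThan cont])
  moreover have "{x0} \<times> K \<subseteq> P"
  proof
    fix p assume p: "p \<in> {x0} \<times> K"
    then have "snd p \<in> W" "snd p \<noteq> 0" unfolding K_def by auto
    then show "p \<in> P" unfolding P_def using pos p by auto
  qed
  ultimately have "\<exists>X0. x0 \<in> X0 \<and> open X0 \<and> X0 \<times> K \<subseteq> P"
    by (intro Elementary_Topology.tube_lemma)
  then obtain X0 where X0: "x0 \<in> X0" "open X0" "X0 \<times> K \<subseteq> P" by blast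
  show ?thesis
    unfolding eventually_nhds
  proof (intro exI[of _ X0] conjI X0 ballI impI)
    fix x v assume xv: "x \<in> X0" "v \<in> W" "v \<noteq> 0"
    let ?u = "inverse (norm v) *\<^sub>R v"
    have "?u \<in> K"
      using xv subspace_scale[OF vec_subspace_imp_subspace[OF W]] unfolding K_def by simp
    then have "0 < Q x ?u" using X0 xv unfolding P_def by auto
    then have "0 < (inverse (norm v))\<^sup>2 * Q x v" by (simp only: scale)
    then show "0 < Q x v" by (simp add: zero_less_mult_iff)
  qed
qed

locale unitary_family =
  fixes S :: "(complex ^ 'm) set"
    and k :: "'x::topological_space \<Rightarrow> complex ^ 'm \<Rightarrow> complex ^ 'm \<Rightarrow> complex"
    and f :: "'x \<Rightarrow> complex ^ 'm \<Rightarrow> complex ^ 'm"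
  assumes unitary: "unitary_on S (k x) (f x)"
    and f_cont: "continuous_on UNIV (\<lambda>p. f (fst p) (snd p))"
    and k_cont: "continuous_on UNIV (\<lambda>p. k (fst p) (fst (snd p)) (snd (snd p)))"
begin

sublocale unitary_on S "k x" "f x" for x
  by (rule unitary)

lemma k_comp_cont:
  assumes "continuous_on UNIV g" "continuous_on UNIV h"
  shows "continuous_on UNIV (\<lambda>p. k (fst p) (g p) (h p))"
proof -
  have "continuous_on UNIV ((\<lambda>p. k (fst p) (fst (snd p)) (snd (snd p))) \<circ> (\<lambda>p. (fst p, g p, h p)))"
    by (intro continuous_on_compose continuous_on_subset[OF k_cont] continuous_intros assms) simp
  then show ?thesis by (simp add: o_def)
qed

lemma arc_form_cont:
  "continuous_on UNIV (\<lambda>p. Re (cis (e / 2) * k (fst p) (f (fst p) (snd p)) (snd p))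
      - cos (e / 2) * Re (k (fst p) (snd p) (snd p)))"
  by (intro continuous_intros k_comp_cont f_cont)

lemma arc_form_scale:
  "arc_form x e (r *\<^sub>R v)
    = r\<^sup>2 * (arc_form x e v)"
proof -
  have "k x (f x (r *\<^sub>R v)) (r *\<^sub>R v) = complex_of_real (r\<^sup>2) * k x (f x v) v"
    by (simp add: clin_scale[OF lin] scaleR_eq_scalar k_scale1 k_scale2 power2_eq_square)
  moreover have "k x (r *\<^sub>R v) (r *\<^sub>R v) = complex_of_real (r\<^sup>2) * k x v v"
    by (simp add: scaleR_eq_scalar k_scale1 k_scale2 power2_eq_square)
  moreover have "Re (z * (complex_of_real t * w)) = t * Re (z * w)" for z w t
    by (simp add: algebra_simps)
  moreover have "Re (complex_of_real t * w) = t * Re w" for w t by simp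
  ultimately show ?thesis by (simp only: right_diff_distrib) (simp only: ac_simps)
qed

lemma eventually_not_in_spectrum:
  assumes "c \<notin> spectrum_on S (f x0)"
  shows "\<forall>\<^sub>F x in nhds x0. c \<notin> spectrum_on S (f x)"
proof -
  define Q where "Q x v = (norm (f x v - c *s v))\<^sup>2" for x v
  have "\<forall>\<^sub>F x in nhds x0. \<forall>v\<in>S. v \<noteq> 0 \<longrightarrow> 0 < Q x v"
  proof (rule eventually_positive_on_subspace)
    show "continuous_on UNIV (\<lambda>p. Q (fst p) (snd p))"
      unfolding Q_def by (intro continuous_intros f_cont)
    show "Q x (r *\<^sub>R v) = r\<^sup>2 * Q x v" for x r v
    proof -
      have "f x (r *\<^sub>R v) - c *s (r *\<^sub>R v) = r *\<^sub>R (f x v - c *s v)"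
        by (simp add: clin_scale[OF lin] scaleR_eq_scalar vector_smult_assoc mult.commute
            vector_ssub_ldistrib)
      then show ?thesis unfolding Q_def by (simp add: power_mult_distrib)
    qed
    show "0 < Q x0 v" if "v \<in> S" "v \<noteq> 0" for v
      using assms that unfolding Q_def spectrum_on_def eigenspace_on_def by auto
  qed (rule sub)
  then show ?thesis
    by eventually_elim (auto simp: Q_def spectrum_on_def eigenspace_on_def)
qed

text \<open>
  A positive subspace of maximal dimension at \<open>x0\<close> remains positive nearby.
\<close>
lemma eventually_arc_count_ge:
  assumes e: "0 < e" "e < 2 * pi" and "cis (- e) \<notin> spectrum_on S (f x0)"
  shows "\<forall>\<^sub>F x in nhds x0. arc_count S (f x0) e \<le> arc_count S (f x) e"
proof -
  obtain W where W: "vec.subspace W" "W \<subseteq> S"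
    "\<And>v. v \<in> W \<Longrightarrow> v \<noteq> 0 \<Longrightarrow> 0 < arc_form x0 e v"
    "vec.dim W = arc_count S (f x0) e"
    using ex_positive_subspace[OF assms] by metis
  have "\<forall>\<^sub>F x in nhds x0. \<forall>v\<in>W. v \<noteq> 0 \<longrightarrow>
      0 < arc_form x e v"
    by (rule eventually_positive_on_subspace[OF arc_form_cont arc_form_scale W(1) W(3)])
  then show ?thesis
  proof eventually_elim
    case (elim x)
    then have "vec.dim W \<le> arc_count S (f x) e"
      by (intro positive_subspace_dim_le[OF e W(1,2)]) blast
    then show ?case using W(4) by simp
  qed
qed

text \<open>
  A negative subspace of maximal dimension at \<open>x0\<close> remains negative nearby.
\<close>
lemma eventually_arc_count_le:
  assumes e: "0 < e" "e < 2 * pi"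
  shows "\<forall>\<^sub>F x in nhds x0. arc_count S (f x) e + vec.dim (es x 1)
     \<le> arc_count S (f x0) e + vec.dim (es x0 1)"
proof -
  obtain W where W: "vec.subspace W" "W \<subseteq> S"
    "\<And>v. v \<in> W \<Longrightarrow> v \<noteq> 0 \<Longrightarrow> arc_form x0 e v < 0"
    "vec.dim W + arc_count S (f x0) e + vec.dim (es x0 1) = vec.dim S"
    using ex_negative_subspace[OF assms] by metis
  have "\<forall>\<^sub>F x in nhds x0. \<forall>v\<in>W. v \<noteq> 0 \<longrightarrow>
      0 < - (arc_form x e v)"
  proof (rule eventually_positive_on_subspace[OF continuous_on_minus[OF arc_form_cont] _ W(1)])
    show "- (arc_form x e (r *\<^sub>R v))
      = r\<^sup>2 * - (arc_form x e v)" for x r v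
      by (simp only: arc_form_scale mult_minus_right)
    show "0 < - (arc_form x0 e v)"
      if "v \<in> W" "v \<noteq> 0" for v
      using W(3)[OF that] by linarith
  qed
  then show ?thesis
  proof eventually_elim
    case (elim x)
    have "vec.dim W + arc_count S (f x) e + vec.dim (es x 1) \<le> vec.dim S"
    proof (rule negative_subspace_dim_le[OF e W(1,2)])
      fix v assume "v \<in> W" "v \<noteq> 0"
      then have "0 < - (arc_form x e v)"
        using elim by blast
      then show "arc_form x e v < 0" by linarith
    qed
    then show ?case using W(4) by linarith
  qed
qed

lemma eventually_arc_count_eq:
  assumes e: "0 < e" "e < 2 * pi" and "cis (- e) \<notin> spectrum_on S (f x0)"
    and "\<forall>\<^sub>F x in nhds x0. vec.dim (es x 1) = vec.dim (es x0 1)"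
  shows "\<forall>\<^sub>F x in nhds x0. arc_count S (f x) e = arc_count S (f x0) e"
  using eventually_arc_count_ge[OF assms(1-3)] eventually_arc_count_le[OF e, of x0] assms(4)
  by eventually_elim linarith

lemma rotated_family: "unitary_family S k (\<lambda>x v. cis a *s f x v)"
proof (rule unitary_family.intro)
  show "unitary_on S (k x) (\<lambda>v. cis a *s f x v)" for x by (rule unitary_rotate)
  show "continuous_on UNIV (\<lambda>p. cis a *s f (fst p) (snd p))"
    by (intro continuous_intros f_cont)
qed (rule k_cont)

text \<open>
  If neither end of the turned arc is an eigenvalue, the two semicontinuity bounds coincide.
\<close>
lemma eventually_rotated_arc_count_eq:
  assumes e: "0 < e" "e < 2 * pi"
    and "cis (- a) \<notin> spectrum_on S (f x0)" "cis (- a - e) \<notin> spectrum_on S (f x0)"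
  shows "\<forall>\<^sub>F x in nhds x0. arc_count S (\<lambda>v. cis a *s f x v) e = arc_count S (\<lambda>v. cis a *s f x0 v) e"
proof -
  interpret rot: unitary_family S k "\<lambda>x v. cis a *s f x v" by (rule rotated_family)
  have "\<forall>\<^sub>F x in nhds x0. vec.dim (es x (cis (- a)))
      = vec.dim (es x0 (cis (- a)))"
    using eventually_not_in_spectrum[OF assms(3)]
    by eventually_elim (simp only: dim_es_trivial assms(3) not_False_eq_True)
  moreover have "cis (- e) \<notin> spectrum_on S (\<lambda>v. cis a *s f x0 v)"
    using assms(4) by (simp add: spectrum_rotate cis_mult)
  ultimately show ?thesis
    by (intro rot.eventually_arc_count_eq e) (simp_all only: eigenspace_rotate mult_1_right not_False_eq_True)
qed

abbreviation good :: "real \<Rightarrow> 'x \<Rightarrow> bool" where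
  "good e x \<equiv> cis e \<notin> spectrum_on S (f x) \<and> cis (- e) \<notin> spectrum_on S (f x)"

abbreviation count :: "real \<Rightarrow> 'x \<Rightarrow> int" where
  "count e x \<equiv> int (arc_count S (f x) e)"

lemma compat_less:
  assumes "0 < e" "e < e'" "e' < 2 * pi"
    and "cis (- e) \<notin> spectrum_on S (f x)" "cis (- e') \<notin> spectrum_on S (f x)"
  shows "\<forall>\<^sub>F y in nhds x. count e' y - count e y = count e' x - count e x"
proof -
  have "\<forall>\<^sub>F y in nhds x. arc_count S (\<lambda>v. cis e *s f y v) (e' - e)
      = arc_count S (\<lambda>v. cis e *s f x v) (e' - e)"
    by (rule eventually_rotated_arc_count_eq) (use assms in auto)
  then show ?thesis
    by eventually_elim (simp add: arc_count_split[OF assms(1-3)])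
qed

sublocale gauged good count
proof
  fix e e' :: real and x
  assume e: "0 < e" "e < pi" "good e x"
  show "\<forall>\<^sub>F y in nhds x. good e y"
    using e eventually_not_in_spectrum[of _ x] by (auto intro: eventually_conj)
  assume e': "0 < e'" "e' < pi" "good e' x"
  consider "e < e'" | "e = e'" | "e' < e" by linarith
  then show "\<forall>\<^sub>F y in nhds x. count e y - count e' y = count e x - count e' x"
  proof cases
    case 1
    have "\<forall>\<^sub>F y in nhds x. count e' y - count e y = count e' x - count e x"
      by (rule compat_less) (use 1 e e' in auto)
    then show ?thesis by eventually_elim linarith
  next
    case 3
    show ?thesis by (rule compat_less) (use 3 e e' in auto)
  qed simp
next
  fix x
  let ?sp = "spectrum_on S (f x)"
  have inj: "inj_on cis {0<..<pi}" "inj_on (\<lambda>e. cis (- e)) {0<..<pi}"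
    using cis_inj cis_inj[of "- _" "- _"] by (force simp: inj_on_def abs_less_iff)+
  have "finite {e \<in> {0<..<pi}. cis e \<in> ?sp}" "finite {e \<in> {0<..<pi}. cis (- e) \<in> ?sp}"
    using finite_vimage_IntI[OF finite_spectrum inj(1)] finite_vimage_IntI[OF finite_spectrum inj(2)]
    by (simp_all add: vimage_def Int_def conj_commute)
  moreover have "infinite {0<..<pi}" by (simp add: infinite_Ioo)
  ultimately have "\<not> {0<..<pi} \<subseteq> {e \<in> {0<..<pi}. cis e \<in> ?sp} \<union> {e \<in> {0<..<pi}. cis (- e) \<in> ?sp}"
    using finite_subset by blast
  then show "\<exists>e. 0 < e \<and> e < pi \<and> good e x" by auto
qed

text \<open>
  The count can jump only by eigenvalues that enter or leave 1. This is the condition at the ends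
  in the homotopy theorem.
\<close>
lemma count_locally_constant:
  fixes p :: "'y::topological_space \<Rightarrow> 'x"
  assumes p: "continuous_on UNIV p" and e: "0 < e" "e < pi" "good e (p s0)"
    and "\<And>s. vec.dim (es (p s) 1) = vec.dim (es (p s0) 1)"
  shows "\<forall>\<^sub>F s in nhds s0. count e (p s) = count e (p s0)"
proof -
  have e2: "e < 2 * pi" using e by linarith
  have 1: "\<forall>\<^sub>F s in nhds s0. arc_count S (f (p s0)) e \<le> arc_count S (f (p s)) e"
    by (rule eventually_path[OF p eventually_arc_count_ge[OF e(1) e2]]) (use e in simp)
  have 2: "\<forall>\<^sub>F s in nhds s0. arc_count S (f (p s)) e + vec.dim (es (p s) 1)
     \<le> arc_count S (f (p s0)) e + vec.dim (es (p s0) 1)"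
    by (rule eventually_path[OF p eventually_arc_count_le[OF e(1) e2]])
  from 1 2 show ?thesis
  proof eventually_elim
    case (elim s)
    then show ?case using assms(5)[of s] by simp
  qed
qed

text \<open>
  On each step the number of eigenvalues in a full arc around 1 is constant, and by symmetry it is
  twice the count plus the multiplicity of 1. So each step contributes half of the drop of this
  multiplicity, and the sum telescopes.
\<close>
theorem symmetric_flow:
  assumes "pflow p a b m" "continuous_on UNIV p"
    and sym: "\<And>t c. a \<le> t \<Longrightarrow> t \<le> b \<Longrightarrow>
        vec.dim (es (p t) (cnj c)) = vec.dim (es (p t) c)"
  shows "2 * m = int (vec.dim (es (p a) 1)) - int (vec.dim (es (p b) 1))"
  using assms
proof (induction rule: flow.induct)
  case (flow_refl a)
  then show ?case by simp
next
  case (flow_step a b m c e)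
  note ab = flow_le[OF flow_step.hyps(1)]
  have total: "2 * arc_count S (f (p t)) e + vec.dim (es (p t) 1)
      = arc_count S (\<lambda>v. cis (- e) *s f (p t) v) (2 * e)" if "t \<in> {b..c}" for t
    by (rule arc_count_symmetric) (use flow_step that ab in auto)
  have "arc_count S (\<lambda>v. cis (- e) *s f (p c) v) (2 * e) = arc_count S (\<lambda>v. cis (- e) *s f (p b) v) (2 * e)"
  proof (rule locally_constant_on_interval[of b c "\<lambda>t. arc_count S (\<lambda>v. cis (- e) *s f (p t) v) (2 * e)"])
    fix t assume t: "b \<le> t" "t \<le> c"
    have "\<forall>\<^sub>F y in nhds (p t). arc_count S (\<lambda>v. cis (- e) *s f y v) (2 * e)
        = arc_count S (\<lambda>v. cis (- e) *s f (p t) v) (2 * e)"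
      by (rule eventually_rotated_arc_count_eq) (use flow_step.hyps t in auto)
    from eventually_path[OF flow_step.prems(1) this]
    show "\<forall>\<^sub>F y in nhds t. b \<le> y \<longrightarrow> y \<le> c \<longrightarrow>
        arc_count S (\<lambda>v. cis (- e) *s f (p y) v) (2 * e) = arc_count S (\<lambda>v. cis (- e) *s f (p t) v) (2 * e)"
      by eventually_elim simp
  qed (use flow_step.hyps in simp)
  moreover have "2 * m = int (vec.dim (es (p a) 1)) - int (vec.dim (es (p b) 1))"
    by (rule flow_step.IH) (use flow_step ab in auto)
  ultimately show ?case
    using total[of b] total[of c] flow_step.hyps(2) by simp
qed

end

section \<open>Continuous families of linear maps and of projections\<close>

text \<open>
  Continuity is joint in the parameter and the vector, as compactness of the unit sphere will be used
  uniformly in the parameter.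
\<close>
definition cfam :: "('x::topological_space \<Rightarrow> complex ^ 'a \<Rightarrow> complex ^ 'b) \<Rightarrow> bool" where
  "cfam F \<longleftrightarrow> (\<forall>x. clin (F x)) \<and> continuous_on UNIV (\<lambda>p. F (fst p) (snd p))"

lemma cfam_clin: "cfam F \<Longrightarrow> clin (F x)"
  unfolding cfam_def by blast

lemma clin_imp_linear: "clin f \<Longrightarrow> linear f"
  by (rule linearI) (simp_all only: clin_add clin_scaleR)

lemma clin_compose: "clin f \<Longrightarrow> clin g \<Longrightarrow> clin (\<lambda>v. f (g v))"
  by (rule clinI) (simp_all only: clin_add clin_scale)

lemma clin_plus: "clin f \<Longrightarrow> clin g \<Longrightarrow> clin (\<lambda>v. f v + g v)"
  by (rule clinI) (simp_all only: clin_add clin_scale vector_add_ldistrib ac_simps)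

lemma clin_minus: "clin f \<Longrightarrow> clin g \<Longrightarrow> clin (\<lambda>v. f v - g v)"
  by (rule clinI) (simp_all only: clin_add clin_scale vector_ssub_ldistrib add_diff_add)

lemma clin_smult: "clin f \<Longrightarrow> clin (\<lambda>v. c *s f v)"
  by (rule clinI) (simp_all only: clin_add clin_scale vector_add_ldistrib vector_smult_assoc mult.commute)

lemma clin_id: "clin (\<lambda>v. v)"
  by (rule clinI) simp_all

lemma clin_inv:
  assumes "clin f" "bij f"
  shows "clin (inv f)"
proof (rule clinI)
  have ff: "f (inv f x) = x" for x using assms(2) by (simp add: bij_is_surj surj_f_inv_f)
  have eq: "inv f x = y" if "x = f y" for x y using that assms(2) by (simp add: bij_is_inj)
  show "inv f (x + y) = inv f x + inv f y" for x y
    by (rule eq) (simp add: clin_add[OF assms(1)] ff)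
  show "inv f (c *s x) = c *s inv f x" for c x
    by (rule eq) (simp add: clin_scale[OF assms(1)] ff)
qed

lemma cfam_compose:
  assumes "cfam F" "cfam G"
  shows "cfam (\<lambda>x v. F x (G x v))"
  unfolding cfam_def
proof (intro conjI allI)
  show "clin (\<lambda>v. F x (G x v))" for x by (rule clin_compose[OF cfam_clin[OF assms(1)] cfam_clin[OF assms(2)]])
  have F: "continuous_on UNIV (\<lambda>p. F (fst p) (snd p))" and G: "continuous_on UNIV (\<lambda>p. G (fst p) (snd p))"
    using assms unfolding cfam_def by blast+
  have "continuous_on UNIV ((\<lambda>p. F (fst p) (snd p)) \<circ> (\<lambda>p. (fst p, G (fst p) (snd p))))"
    by (intro continuous_on_compose continuous_on_subset[OF F] continuous_intros G) simp
  then show "continuous_on UNIV (\<lambda>p. F (fst p) (G (fst p) (snd p)))" by (simp add: o_def)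
qed

lemma cfam_reparam:
  fixes p :: "'b::topological_space \<Rightarrow> 'x::topological_space" and F :: "'x \<Rightarrow> complex ^ 'c \<Rightarrow> complex ^ 'd"
  assumes "cfam F" "continuous_on UNIV p"
  shows "cfam (\<lambda>y. F (p y))"
  unfolding cfam_def
proof (intro conjI allI)
  show "clin (F (p x))" for x by (intro cfam_clin assms)
  have F: "continuous_on UNIV (\<lambda>p. F (fst p) (snd p))"
    using assms(1) unfolding cfam_def by blast
  have "continuous_on UNIV (\<lambda>q :: 'b \<times> (complex ^ 'c). p (fst q))"
    by (rule continuous_on_compose2[OF assms(2)]) (auto intro!: continuous_intros)
  then have "continuous_on UNIV ((\<lambda>q. F (fst q) (snd q)) \<circ> (\<lambda>q. (p (fst q), snd q)))"
    by (intro continuous_on_compose continuous_on_subset[OF F] continuous_intros) simp_all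
  then show "continuous_on UNIV (\<lambda>q. F (p (fst q)) (snd q))" by (simp add: o_def)
qed

lemma cfam_add: "cfam F \<Longrightarrow> cfam G \<Longrightarrow> cfam (\<lambda>x v. F x v + G x v)"
  unfolding cfam_def by (auto intro!: clin_plus continuous_intros)

lemma cfam_diff: "cfam F \<Longrightarrow> cfam G \<Longrightarrow> cfam (\<lambda>x v. F x v - G x v)"
  unfolding cfam_def by (auto intro!: clin_minus continuous_intros)

lemma cfam_const:
  assumes "clin f"
  shows "cfam (\<lambda>x. f)"
  unfolding cfam_def
proof (intro conjI allI)
  have "continuous_on UNIV f"
    by (intro linear_continuous_on linear_conv_bounded_linear[THEN iffD1] clin_imp_linear assms)
  then show "continuous_on UNIV (\<lambda>p. f (snd p))"
    by (rule continuous_on_compose2) (auto intro!: continuous_intros)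
qed (rule assms)

lemma cfam_scale:
  "continuous_on UNIV c \<Longrightarrow> cfam F \<Longrightarrow> cfam (\<lambda>x v. c x *s F x v)"
  unfolding cfam_def
  by (auto intro!: clin_smult continuous_intros continuous_on_compose2[of UNIV c])

text \<open>
  Near a parameter the maps are bounded below on the unit sphere by a common constant, so that the
  inverses are bounded by a common constant.
\<close>
lemma cfam_inv:
  fixes F :: "'x::topological_space \<Rightarrow> complex ^ 'm \<Rightarrow> complex ^ 'm"
  assumes F: "cfam F" and bij: "\<And>x. bij (F x)"
  shows "cfam (\<lambda>x. inv (F x))"
  unfolding cfam_def
proof (intro conjI allI)
  show "clin (inv (F x))" for x by (intro clin_inv cfam_clin F bij)
  note lin = cfam_clin[OF F]
  have Fc: "continuous_on UNIV (\<lambda>p. F (fst p) (snd p))" using F unfolding cfam_def by blast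
  have ff: "F x (inv (F x) v) = v" for x v using bij by (simp add: bij_is_surj surj_f_inv_f)
  have "((\<lambda>p. inv (F (fst p)) (snd p)) \<longlongrightarrow> inv (F x0) w0) (at (x0, w0))" for x0 w0
  proof -
    \<comment> \<open>\<open>F x\<close> is bounded below by a common constant near \<open>x0\<close>\<close>
    have "continuous_on (sphere 0 1) (F x0)"
      using linear_continuous_on[OF linear_conv_bounded_linear[THEN iffD1, OF clin_imp_linear[OF lin]]] .
    then have "continuous_on (sphere 0 1) (\<lambda>v. norm (F x0 v))" by (intro continuous_intros)
    moreover have "sphere 0 1 \<noteq> ({} :: (complex ^ 'm) set)" by simp
    ultimately obtain v1 where v1: "v1 \<in> sphere 0 1" "\<And>v. v \<in> sphere 0 1 \<Longrightarrow> norm (F x0 v1) \<le> norm (F x0 v)"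
      using continuous_attains_inf[OF compact_sphere] by metis
    define c where "c = norm (F x0 v1) / 2"
    have "F x0 v1 \<noteq> F x0 0" using v1 bij[of x0] by (auto dest!: bij_is_inj[THEN injD])
    then have c: "0 < c" unfolding c_def clin_0[OF lin] by simp
    have "\<forall>\<^sub>F x in nhds x0. \<forall>v\<in>UNIV. v \<noteq> 0 \<longrightarrow> 0 < (norm (F x v))\<^sup>2 - c\<^sup>2 * (norm v)\<^sup>2"
    proof (rule eventually_positive_on_subspace[where Q = "\<lambda>x v. (norm (F x v))\<^sup>2 - c\<^sup>2 * (norm v)\<^sup>2"])
      show "continuous_on UNIV (\<lambda>p. (norm (F (fst p) (snd p)))\<^sup>2 - c\<^sup>2 * (norm (snd p))\<^sup>2)"
        by (intro continuous_intros Fc)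
      show "(norm (F x (r *\<^sub>R v)))\<^sup>2 - c\<^sup>2 * (norm (r *\<^sub>R v))\<^sup>2
          = r\<^sup>2 * ((norm (F x v))\<^sup>2 - c\<^sup>2 * (norm v)\<^sup>2)" for x r v
        by (simp add: clin_scaleR[OF lin] power_mult_distrib algebra_simps)
      fix v :: "complex ^ 'm" assume v: "v \<noteq> 0"
      have "2 * c \<le> norm (F x0 (inverse (norm v) *\<^sub>R v))"
        unfolding c_def using v1(2)[of "inverse (norm v) *\<^sub>R v"] v by simp
      then have "2 * c * norm v \<le> norm (F x0 v)"
        using v by (simp add: clin_scaleR[OF lin] field_simps)
      moreover have "c * norm v < 2 * c * norm v" using c v by simp
      ultimately have "c * norm v < norm (F x0 v)" by linarith
      then have "(c * norm v)\<^sup>2 < (norm (F x0 v))\<^sup>2"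
        using c by (intro power_strict_mono) auto
      then show "0 < (norm (F x0 v))\<^sup>2 - c\<^sup>2 * (norm v)\<^sup>2" by (simp add: power_mult_distrib)
    qed (rule vec.subspace_UNIV)
    then obtain X0 where X0: "open X0" "x0 \<in> X0"
      "\<And>x v. x \<in> X0 \<Longrightarrow> v \<noteq> 0 \<Longrightarrow> 0 < (norm (F x v))\<^sup>2 - c\<^sup>2 * (norm v)\<^sup>2"
      unfolding eventually_nhds by blast
    have below: "c * norm v \<le> norm (F x v)" if "x \<in> X0" for x v
    proof (cases "v = 0")
      case False
      then have "(c * norm v)\<^sup>2 \<le> (norm (F x v))\<^sup>2"
        using X0(3)[OF that, of v] by (simp add: power_mult_distrib)
      then show ?thesis by (rule power2_le_imp_le) simp
    qed simp
    let ?v0 = "inv (F x0) w0"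
    have "\<forall>\<^sub>F p in at (x0, w0). fst p \<in> X0"
      by (rule topological_tendstoD[OF tendsto_fst[OF tendsto_ident_at] X0(1)]) (use X0 in simp)
    then have "\<forall>\<^sub>F p in at (x0, w0). norm (inv (F (fst p)) (snd p) - ?v0)
        \<le> norm (snd p - F (fst p) ?v0) / c"
    proof eventually_elim
      case (elim p)
      have "c * norm (inv (F (fst p)) (snd p) - ?v0) \<le> norm (F (fst p) (inv (F (fst p)) (snd p) - ?v0))"
        by (rule below[OF elim])
      then show ?case using c by (simp add: clin_diff[OF lin] ff field_simps)
    qed
    moreover have "((\<lambda>p. norm (snd p - F (fst p) ?v0) / c) \<longlongrightarrow> 0) (at (x0, w0))"
    proof -
      have "continuous_on UNIV ((\<lambda>p. F (fst p) (snd p)) \<circ> (\<lambda>p :: 'x \<times> (complex ^ 'm). (fst p, ?v0)))"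
        by (intro continuous_on_compose continuous_on_subset[OF Fc] continuous_intros) simp
      then have "continuous_on UNIV (\<lambda>p. norm (snd p - F (fst p) ?v0) / c)"
        by (intro continuous_intros) (use c in \<open>simp_all add: o_def\<close>)
      then have "((\<lambda>p. norm (snd p - F (fst p) ?v0) / c) \<longlongrightarrow> norm (w0 - F x0 ?v0) / c) (at (x0, w0))"
        by (simp add: continuous_on_def split_beta)
      then show ?thesis by (simp add: ff)
    qed
    ultimately have "((\<lambda>p. inv (F (fst p)) (snd p) - ?v0) \<longlongrightarrow> 0) (at (x0, w0))"
      by (rule Lim_null_comparison)
    then show ?thesis by (simp add: LIM_zero_iff)
  qed
  then show "continuous_on UNIV (\<lambda>p. inv (F (fst p)) (snd p))"
    unfolding continuous_on_def by auto
qed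

definition complementary :: "(complex ^ 'm) set \<Rightarrow> (complex ^ 'm) set \<Rightarrow> bool" where
  "complementary U W \<longleftrightarrow> vec.subspace U \<and> vec.subspace W \<and> U \<inter> W = {0} \<and>
     (\<forall>v. \<exists>u\<in>U. \<exists>w\<in>W. v = u + w)"

definition proj_along :: "(complex ^ 'm) set \<Rightarrow> (complex ^ 'm) set \<Rightarrow> complex ^ 'm \<Rightarrow> complex ^ 'm" where
  "proj_along U W v = (THE u. u \<in> U \<and> v - u \<in> W)"

lemma proj_along_unique:
  assumes "complementary U W" "u \<in> U" "v - u \<in> W"
  shows "proj_along U W v = u"
  unfolding proj_along_def
proof (rule the_equality)
  fix u' assume u': "u' \<in> U \<and> v - u' \<in> W"
  have "u' - u \<in> U" using assms u' unfolding complementary_def by (blast intro: vec.subspace_diff)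
  moreover have "(v - u) - (v - u') \<in> W"
    using assms u' unfolding complementary_def by (blast intro: vec.subspace_diff)
  ultimately have "u' - u \<in> U \<inter> W" by simp
  then show "u' = u" using assms(1) unfolding complementary_def by simp
qed (use assms in simp)

lemma proj_along:
  assumes "complementary U W"
  shows "proj_along U W v \<in> U" "v - proj_along U W v \<in> W"
proof -
  obtain u w where "u \<in> U" "w \<in> W" "v = u + w" using assms unfolding complementary_def by blast
  then have uw: "u \<in> U" "v - u \<in> W" by auto
  then have "proj_along U W v = u" by (rule proj_along_unique[OF assms])
  then show "proj_along U W v \<in> U" "v - proj_along U W v \<in> W" using uw by auto
qed

lemma clin_proj_along:
  assumes "complementary U W"
  shows "clin (proj_along U W)"
proof (rule clinI)
  let ?P = "proj_along U W"
  have S: "vec.subspace U" "vec.subspace W" using assms unfolding complementary_def by auto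
  fix x y c
  show "?P (x + y) = ?P x + ?P y"
  proof (rule proj_along_unique[OF assms])
    have "(x - ?P x) + (y - ?P y) \<in> W" by (intro vec.subspace_add S proj_along assms)
    then show "x + y - (?P x + ?P y) \<in> W" by (simp add: algebra_simps)
  qed (intro vec.subspace_add S proj_along assms)
  show "?P (c *s x) = c *s ?P x"
  proof (rule proj_along_unique[OF assms])
    have "c *s (x - ?P x) \<in> W" by (intro vec.subspace_scale S proj_along assms)
    then show "c *s x - c *s ?P x \<in> W" by (simp add: vector_ssub_ldistrib)
  qed (intro vec.subspace_scale S proj_along assms)
qed

lemma clin_inj_imp_bij:
  fixes f :: "complex ^ 'm \<Rightarrow> complex ^ 'm"
  assumes "clin f" "\<And>v. f v = 0 \<Longrightarrow> v = 0"
  shows "bij f"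
proof -
  have "inj f"
  proof (rule injI)
    fix x y assume "f x = f y"
    then have "f (x - y) = 0" by (simp add: clin_diff[OF assms(1)])
    then show "x = y" using assms(2) by fastforce
  qed
  then show ?thesis using vec.linear_inj_imp_surj[OF assms(1)] by (simp add: bij_def)
qed

text \<open>
  After the choice of a base point \<open>x0\<close> the two moving subspaces are the images of fixed complementary
  subspaces under families \<open>A'\<close> and \<open>G'\<close>. These fit together to one family \<open>N\<close> of isomorphisms, which
  conjugates the fixed projection \<open>P\<close> to the moving one.
\<close>
lemma cfam_proj_along:
  fixes A G :: "'x::topological_space \<Rightarrow> complex ^ 'm \<Rightarrow> complex ^ 'm"
  assumes A: "cfam A" "\<And>x. bij (A x)" and G: "cfam G" "\<And>x. bij (G x)"
    and compl: "\<And>x. complementary (A x ` U) (G x ` W)"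
  shows "cfam (\<lambda>x. proj_along (A x ` U) (G x ` W))"
proof -
  fix x0 :: 'x
  define P where "P = proj_along (A x0 ` U) (G x0 ` W)"
  define A' where "A' = (\<lambda>x v. A x (inv (A x0) v))"
  define G' where "G' = (\<lambda>x v. G x (inv (G x0) v))"
  note P = proj_along[OF compl[of x0], folded P_def]
  have linP: "clin P" unfolding P_def by (rule clin_proj_along[OF compl])
  have A': "cfam A'" unfolding A'_def
    by (rule cfam_compose[OF A(1) cfam_const[OF clin_inv[OF cfam_clin[OF A(1)] A(2)]]])
  have G': "cfam G'" unfolding G'_def
    by (rule cfam_compose[OF G(1) cfam_const[OF clin_inv[OF cfam_clin[OF G(1)] G(2)]]])
  have A'U: "A' x u \<in> A x ` U" if "u \<in> A x0 ` U" for x u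
    using that A(2)[of x0] unfolding A'_def by (auto simp: bij_is_inj)
  have G'W: "G' x u \<in> G x ` W" if "u \<in> G x0 ` W" for x u
    using that G(2)[of x0] unfolding G'_def by (auto simp: bij_is_inj)
  define N where "N = (\<lambda>x v. A' x (P v) + G' x (v - P v))"
  have N: "cfam N" unfolding N_def
    by (rule cfam_add[OF cfam_compose[OF A' cfam_const[OF linP]]
          cfam_compose[OF G' cfam_const[OF clin_minus[OF clin_id linP]]]])
  have bijN: "bij (N x)" for x
  proof (rule clin_inj_imp_bij[OF cfam_clin[OF N]])
    fix v assume "N x v = 0"
    then have eq: "A' x (P v) = - G' x (v - P v)" unfolding N_def by (simp add: eq_neg_iff_add_eq_0)
    have "A' x (P v) \<in> A x ` U" "G' x (v - P v) \<in> G x ` W" using A'U G'W P by auto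
    moreover have "vec.subspace (G x ` W)" using compl[of x] unfolding complementary_def by blast
    ultimately have "A' x (P v) \<in> A x ` U \<inter> G x ` W" using eq vec.subspace_neg by auto
    then have z: "A' x (P v) = 0" "G' x (v - P v) = 0"
      using compl[of x] eq unfolding complementary_def by auto
    have "P v = 0"
      using z(1) unfolding A'_def
      by (metis A(1,2) bij_inv_eq_iff cfam_clin clin_0)
    moreover have "v - P v = 0"
      using z(2) unfolding G'_def
      by (metis G(1,2) bij_inv_eq_iff cfam_clin clin_0)
    ultimately show "v = 0" by simp
  qed
  have "proj_along (A x ` U) (G x ` W) = (\<lambda>v. A' x (P (inv (N x) v)))" for x
  proof
    fix v
    define u where "u = inv (N x) v"
    have "v = N x u" using bijN[of x] unfolding u_def by (simp add: bij_is_surj surj_f_inv_f)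
    then have "v - A' x (P u) = G' x (u - P u)" unfolding N_def by simp
    then have "v - A' x (P (inv (N x) v)) = G' x (inv (N x) v - P (inv (N x) v))"
      unfolding u_def .
    then show "proj_along (A x ` U) (G x ` W) v = A' x (P (inv (N x) v))"
      by (intro proj_along_unique[OF compl]) (use A'U G'W P in auto)
  qed
  moreover have "cfam (\<lambda>x v. A' x (P (inv (N x) v)))"
    by (rule cfam_compose[OF A' cfam_compose[OF cfam_const[OF linP] cfam_inv[OF N bijN]]])
  ultimately show ?thesis by simp
qed

lemma complementary_sym: "complementary U W \<Longrightarrow> complementary W U"
  unfolding complementary_def by (metis Int_commute add.commute)

section \<open>Lagrangian subspaces and the unitary operator of a pair\<close>

text \<open>
  Nondegeneracy is assumed in the form in which it is used: a proper subspace is annihilated by some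
  nonzero vector.
\<close>
locale symplectic_form =
  fixes w :: "complex ^ 'm \<Rightarrow> complex ^ 'm \<Rightarrow> complex"
  assumes w_add: "w (x + y) z = w x z + w y z"
    and w_scale: "w (c *s x) z = c * w x z"
    and w_skew: "w y x = - cnj (w x y)"
    and w_cont: "continuous_on UNIV (\<lambda>p. w (fst p) (snd p))"
    and w_nondeg: "vec.subspace U \<Longrightarrow> U \<noteq> UNIV \<Longrightarrow> \<exists>x. x \<noteq> 0 \<and> (\<forall>y\<in>U. w x y = 0)"
begin

lemma w_add2: "w z (x + y) = w z x + w z y"
  using w_add[of x y z] w_skew[of z "x + y"] w_skew[of z x] w_skew[of z y] by simp

lemma w_scale2: "w z (c *s x) = cnj c * w z x"
  using w_scale[of c x z] w_skew[of z "c *s x"] w_skew[of z x] by simp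

lemma w_zero: "w 0 z = 0" "w z 0 = 0"
  using w_scale[of 0 0 z] w_scale2[of z 0 0] by simp_all

definition lagrangian :: "(complex ^ 'm) set \<Rightarrow> bool" where
  "lagrangian L \<longleftrightarrow> L = {x. \<forall>y\<in>L. w x y = 0}"

lemma lagrangian_isotropic: "lagrangian L \<Longrightarrow> x \<in> L \<Longrightarrow> y \<in> L \<Longrightarrow> w x y = 0"
  unfolding lagrangian_def by blast

lemma lagrangian_maximal: "lagrangian L \<Longrightarrow> (\<And>y. y \<in> L \<Longrightarrow> w x y = 0) \<Longrightarrow> x \<in> L"
  unfolding lagrangian_def by blast

lemma lagrangian_subspace:
  assumes L: "lagrangian L"
  shows "vec.subspace L"
proof (rule vec.subspaceI)
  show "0 \<in> L" by (rule lagrangian_maximal[OF L]) (simp add: w_zero)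
  show "x + y \<in> L" if "x \<in> L" "y \<in> L" for x y
    by (rule lagrangian_maximal[OF L]) (simp add: w_add lagrangian_isotropic[OF L] that)
  show "c *s x \<in> L" if "x \<in> L" for x c
    by (rule lagrangian_maximal[OF L]) (simp add: w_scale lagrangian_isotropic[OF L] that)
qed

text \<open>
  A vector that annihilates both \<open>L\<close> and \<open>V2\<close> lies in \<open>L\<close>, hence is isotropic, and in \<open>V1\<close>, hence
  vanishes if it is isotropic. So \<open>L + V2\<close> cannot be proper.
\<close>
lemma definite_complement_of_lagrangian:
  assumes L: "lagrangian L" and V: "vec.subspace V1" "vec.subspace V2"
    and sum: "\<And>v. \<exists>x\<in>V1. \<exists>y\<in>V2. v = x + y"
    and orth: "\<And>x y. x \<in> V1 \<Longrightarrow> y \<in> V2 \<Longrightarrow> w x y = 0"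
    and def1: "\<And>x. x \<in> V1 \<Longrightarrow> w x x = 0 \<Longrightarrow> x = 0"
    and def2: "\<And>x. x \<in> V2 \<Longrightarrow> w x x = 0 \<Longrightarrow> x = 0"
  shows "complementary L V2"
proof -
  note SL = lagrangian_subspace[OF L]
  have "L \<inter> V2 = {0}"
    using def2 lagrangian_isotropic[OF L] vec.subspace_0[OF SL] vec.subspace_0[OF V(2)] by auto
  moreover have "{x + y | x y. x \<in> L \<and> y \<in> V2} = UNIV"
  proof (rule ccontr)
    assume "\<not> ?thesis"
    then obtain x where x: "x \<noteq> 0" "\<And>u. u \<in> {x + y | x y. x \<in> L \<and> y \<in> V2} \<Longrightarrow> w x u = 0"
      using w_nondeg[OF vec.subspace_sums[OF SL V(2)]] by blast
    have xl: "w x u = 0" if "u \<in> L" for u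
      using that vec.subspace_0[OF V(2)] by (intro x(2)) force
    have xv: "w x u = 0" if "u \<in> V2" for u
      using that vec.subspace_0[OF SL] by (intro x(2)) force
    obtain p q where pq: "p \<in> V1" "q \<in> V2" "x = p + q" using sum by blast
    have "w q q = 0" using xv[OF pq(2)] orth[OF pq(1,2)] pq(3) by (simp add: w_add)
    then have "q = 0" by (rule def2[OF pq(2)])
    then have "x \<in> V1" using pq by simp
    moreover have "x \<in> L" by (rule lagrangian_maximal[OF L xl])
    ultimately show False using def1 lagrangian_isotropic[OF L] x(1) by blast
  qed
  then have "\<exists>u\<in>L. \<exists>y\<in>V2. v = u + y" for v
  proof -
    have "v \<in> {x + y | x y. x \<in> L \<and> y \<in> V2}"
      using \<open>{x + y | x y. x \<in> L \<and> y \<in> V2} = UNIV\<close> by simp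
    then show ?thesis by blast
  qed
  ultimately show ?thesis using SL V(2) unfolding complementary_def by blast
qed

lemma splitting_definite:
  assumes "symplectic_splitting w Vp Vm"
  shows "x \<in> Vp \<Longrightarrow> w x x = 0 \<Longrightarrow> x = 0" "x \<in> Vm \<Longrightarrow> w x x = 0 \<Longrightarrow> x = 0"
  using assms unfolding symplectic_splitting_def by force+

lemma splitting_complementary:
  assumes "symplectic_splitting w Vp Vm"
  shows "complementary Vp Vm"
  using assms unfolding symplectic_splitting_def complementary_def by blast

lemma lagrangian_complementary:
  assumes sp: "symplectic_splitting w Vp Vm" and L: "lagrangian L"
  shows "complementary L Vm" "complementary L Vp"
proof -
  have V: "vec.subspace Vp" "vec.subspace Vm" "\<And>v. \<exists>x\<in>Vp. \<exists>y\<in>Vm. v = x + y"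
    and orth: "\<And>x y. x \<in> Vp \<Longrightarrow> y \<in> Vm \<Longrightarrow> w x y = 0"
    using sp unfolding symplectic_splitting_def by blast+
  show "complementary L Vm"
    by (rule definite_complement_of_lagrangian[OF L V orth])
      (use splitting_definite[OF sp] in auto)
  have sum': "\<exists>x\<in>Vm. \<exists>y\<in>Vp. v = x + y" for v using V(3) by (metis add.commute)
  have orth': "w x y = 0" if "x \<in> Vm" "y \<in> Vp" for x y
    using orth[OF that(2,1)] w_skew[of x y] by simp
  show "complementary L Vp"
    by (rule definite_complement_of_lagrangian[OF L V(2,1) sum' orth'])
      (use splitting_definite[OF sp] in auto)
qed

lemma graph_map_eq:
  assumes sp: "symplectic_splitting w Vp Vm" and L: "lagrangian L"
    and "u \<in> Vm" "x + u \<in> L"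
  shows "graph_map Vm L x = u"
  unfolding graph_map_def
proof (rule the_equality)
  fix y assume y: "y \<in> Vm \<and> x + y \<in> L"
  note c = lagrangian_complementary(1)[OF sp L]
  have "(x + y) - (x + u) \<in> L" "y - u \<in> Vm"
    using c y assms(3,4) unfolding complementary_def by (meson vec.subspace_diff)+
  then have "y - u \<in> L \<inter> Vm" by simp
  then show "y = u" using c unfolding complementary_def by simp
qed (use assms in simp)

lemma pair_op_eq:
  assumes sp: "symplectic_splitting w Vp Vm" and L: "lagrangian L" and M: "lagrangian M"
    and x: "x \<in> Vp" "y \<in> Vm" "x + y \<in> M" and u: "u \<in> Vm" "x + u \<in> L"
  shows "pair_op Vp Vm L M y = u"
proof -
  have "inv_into Vp (graph_map Vm M) y = x"
  proof -
    let ?x = "inv_into Vp (graph_map Vm M) y"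
    have y: "y \<in> graph_map Vm M ` Vp"
      using graph_map_eq[OF sp M x(2,3)] x(1) by blast
    have xp: "?x \<in> Vp" by (rule inv_into_into[OF y])
    obtain y' where y': "y' \<in> Vm" "?x + y' \<in> M"
    proof -
      obtain l v where lv: "l \<in> M" "v \<in> Vm" "?x = l + v"
        using lagrangian_complementary(1)[OF sp M] unfolding complementary_def by blast
      then have "?x + - v \<in> M" by simp
      moreover have "- v \<in> Vm"
        using lv(2) splitting_complementary[OF sp] unfolding complementary_def by (blast intro: vec.subspace_neg)
      ultimately show ?thesis using that by blast
    qed
    have "graph_map Vm M ?x = y'" by (rule graph_map_eq[OF sp M y'])
    moreover have "graph_map Vm M ?x = y" by (rule f_inv_into_f[OF y])
    ultimately have "?x + y \<in> M" using y' by simp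
    then have "(?x + y) - (x + y) \<in> M" "?x - x \<in> Vp"
      using x xp lagrangian_subspace[OF M] splitting_complementary[OF sp]
      unfolding complementary_def by (meson vec.subspace_diff)+
    then have "?x - x \<in> M \<inter> Vp" by simp
    then show ?thesis
      using lagrangian_complementary(2)[OF sp M] unfolding complementary_def by simp
  qed
  then show ?thesis unfolding pair_op_def using graph_map_eq[OF sp L u] by simp
qed

text \<open>
  The operator of a pair as a composition of projections: lift from the negative space to \<open>M\<close> along
  the positive space, move to \<open>L\<close> along the negative space, project back. In this form its
  continuity follows from that of moving projections.
\<close>
lemma pair_op_proj:
  assumes sp: "symplectic_splitting w Vp Vm" and L: "lagrangian L" and M: "lagrangian M"
    and y: "y \<in> Vm"
  defines "l \<equiv> proj_along M Vp y"
  defines "z \<equiv> proj_along L Vm l"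
  defines "u \<equiv> proj_along Vm Vp z"
  shows "pair_op Vp Vm L M y = u" "l \<in> M" "l - y \<in> Vp" "z \<in> L" "u \<in> Vm" "z - u = l - y"
proof -
  note cM = lagrangian_complementary(2)[OF sp M] and cL = lagrangian_complementary(1)[OF sp L]
  note cs = splitting_complementary[OF sp]
  note cV = complementary_sym[OF cs]
  have S: "vec.subspace Vp" "vec.subspace Vm" using cs unfolding complementary_def by auto
  show l: "l \<in> M" unfolding l_def by (rule proj_along[OF cM])
  have "y - l \<in> Vp" unfolding l_def by (rule proj_along[OF cM])
  then have "- (y - l) \<in> Vp" by (rule vec.subspace_neg[OF S(1)])
  then show ly: "l - y \<in> Vp" by simp
  show z: "z \<in> L" unfolding z_def by (rule proj_along[OF cL])
  have zl: "l - z \<in> Vm" unfolding z_def by (rule proj_along[OF cL])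
  show u: "u \<in> Vm" unfolding u_def by (rule proj_along[OF cV])
  have "z - (l - y) \<in> Vm"
    using vec.subspace_diff[OF S(2) y zl] by (simp add: algebra_simps)
  then have "u = z - (l - y)" unfolding u_def
    by (intro proj_along_unique[OF cV]) (use ly in simp_all)
  then show zu: "z - u = l - y" by simp
  show "pair_op Vp Vm L M y = u"
  proof (rule pair_op_eq[OF sp L M ly y _ u])
    show "l - y + y \<in> M" using l by simp
    have "l - y + u = z" using zu by (metis diff_add_cancel)
    then show "l - y + u \<in> L" using z by simp
  qed
qed

lemma eigenspace_pair_op:
  assumes sp: "symplectic_splitting w Vp Vm" and L: "lagrangian L" and M: "lagrangian M"
  shows "y \<in> eigenspace_on Vm (pair_op Vp Vm L M) c \<longleftrightarrow>
    y \<in> Vm \<and> (\<exists>x\<in>Vp. x + y \<in> M \<and> x + c *s y \<in> L)"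
proof (intro iffI conjI)
  assume y: "y \<in> eigenspace_on Vm (pair_op Vp Vm L M) c"
  then show yV: "y \<in> Vm" unfolding eigenspace_on_def by simp
  note p = pair_op_proj[OF sp L M yV]
  let ?l = "proj_along M Vp y"
  have "c *s y = proj_along Vm Vp (proj_along L Vm ?l)"
    using p(1) y unfolding eigenspace_on_def by simp
  then have "(?l - y) + c *s y \<in> L" using p(4,6) by (metis diff_add_cancel)
  moreover have "(?l - y) + y \<in> M" using p(2) by simp
  ultimately show "\<exists>x\<in>Vp. x + y \<in> M \<and> x + c *s y \<in> L" using p(3) by blast
next
  assume y: "y \<in> Vm \<and> (\<exists>x\<in>Vp. x + y \<in> M \<and> x + c *s y \<in> L)"
  have "vec.subspace Vm" using sp unfolding symplectic_splitting_def by blast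
  then have "c *s y \<in> Vm" using y by (intro vec.subspace_scale) auto
  then have "pair_op Vp Vm L M y = c *s y"
    using y pair_op_eq[OF sp L M] by blast
  then show "y \<in> eigenspace_on Vm (pair_op Vp Vm L M) c" using y unfolding eigenspace_on_def by simp
qed

text \<open>
  For the eigenvalue 1 both conditions in \<open>eigenspace_pair_op\<close> concern the same vector \<open>x + y\<close>, whose
  negative part is the eigenvector \<open>y\<close>.
\<close>
lemma dim_eigenspace_one:
  assumes sp: "symplectic_splitting w Vp Vm" and L: "lagrangian L" and M: "lagrangian M"
  shows "vec.dim (eigenspace_on Vm (pair_op Vp Vm L M) 1) = vec.dim (L \<inter> M)"
proof -
  note cs = splitting_complementary[OF sp]
  note cV = complementary_sym[OF cs]
  let ?P = "proj_along Vm Vp"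
  have "eigenspace_on Vm (pair_op Vp Vm L M) 1 = ?P ` (L \<inter> M)"
  proof (intro equalityI subsetI)
    fix y assume "y \<in> eigenspace_on Vm (pair_op Vp Vm L M) 1"
    then obtain x where x: "y \<in> Vm" "x \<in> Vp" "x + y \<in> M" "x + y \<in> L"
      unfolding eigenspace_pair_op[OF sp L M] by auto
    have "?P (x + y) = y" by (rule proj_along_unique[OF cV]) (use x in auto)
    then show "y \<in> ?P ` (L \<inter> M)" using x by (metis IntI image_eqI)
  next
    fix y assume "y \<in> ?P ` (L \<inter> M)"
    then obtain v where v: "v \<in> L" "v \<in> M" "y = ?P v" by blast
    have "y \<in> Vm" "v - y \<in> Vp" unfolding v(3) by (rule proj_along[OF cV])+
    then show "y \<in> eigenspace_on Vm (pair_op Vp Vm L M) 1"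
      unfolding eigenspace_pair_op[OF sp L M] using v by (intro conjI bexI[of _ "v - y"]) auto
  qed
  moreover have "vec.dim (?P ` (L \<inter> M)) = vec.dim (L \<inter> M)"
  proof (rule vec.dim_image_eq[OF clin_proj_along[OF cV]])
    have S: "vec.subspace (L \<inter> M)" by (intro vec.subspace_inter lagrangian_subspace L M)
    show "inj_on ?P (vec.span (L \<inter> M))"
      unfolding vec.span_eq_iff[THEN iffD2, OF S]
    proof (rule inj_onI)
      fix a b assume ab: "a \<in> L \<inter> M" "b \<in> L \<inter> M" "?P a = ?P b"
      have "?P (a - b) = 0" using ab(3) by (simp add: clin_diff[OF clin_proj_along[OF cV]])
      then have "a - b \<in> Vp" using proj_along(2)[OF cV, of "a - b"] by simp
      moreover have "a - b \<in> L" using vec.subspace_diff[OF S ab(1,2)] by blast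
      ultimately have "a - b = 0"
        using lagrangian_complementary(2)[OF sp L] unfolding complementary_def by blast
      then show "a = b" by simp
    qed
  qed
  ultimately show ?thesis by simp
qed

end

lemma arc_count_transfer:
  fixes h h' :: "complex ^ 'm \<Rightarrow> complex ^ 'm"
  assumes g: "clin g" "inj g" and conj: "\<And>v. v \<in> S \<Longrightarrow> h (g v) = g (h' v)"
  shows "eigenspace_on (g ` S) h c = g ` eigenspace_on S h' c"
    and "vec.dim (eigenspace_on (g ` S) h c) = vec.dim (eigenspace_on S h' c)"
    and "spectrum_on (g ` S) h = spectrum_on S h'"
    and "arc_count (g ` S) h e = arc_count S h' e"
proof -
  have es: "eigenspace_on (g ` S) h c = g ` eigenspace_on S h' c" for c
  proof -
    have "h (g v) = c *s g v \<longleftrightarrow> h' v = c *s v" if "v \<in> S" for v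
      unfolding conj[OF that] clin_scale[OF g(1), symmetric] using g(2) by (simp add: inj_eq)
    then show ?thesis unfolding eigenspace_on_def by blast
  qed
  then show "eigenspace_on (g ` S) h c = g ` eigenspace_on S h' c" .
  show dim: "vec.dim (eigenspace_on (g ` S) h c) = vec.dim (eigenspace_on S h' c)" for c
    unfolding es by (rule vec.dim_image_eq[OF g(1)]) (use g(2) in \<open>auto intro: inj_on_subset\<close>)
  show sp: "spectrum_on (g ` S) h = spectrum_on S h'"
    unfolding spectrum_on_def es using clin_0[OF g(1)] g(2)
    by (auto simp: inj_eq) (metis inj_eq)+
  show "arc_count (g ` S) h e = arc_count S h' e"
    unfolding arc_count_eq sp dim by (rule refl)
qed

section \<open>Homotopy invariance of the Maslov index\<close>

lemma flow_iff_subdivision: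
  "flow good d a b m \<longleftrightarrow> (\<exists>N (t :: nat \<Rightarrow> real) (e :: nat \<Rightarrow> real).
     t 0 = a \<and> t N = b \<and> (\<forall>k<N. t k < t (Suc k)) \<and> (\<forall>k<N. 0 < e k \<and> e k < pi) \<and>
     (\<forall>k<N. \<forall>s\<in>{t k..t (Suc k)}. good (e k) s) \<and>
     m = - (\<Sum>k<N. d (e k) (t k) - d (e k) (t (Suc k))))" (is "_ \<longleftrightarrow> (\<exists>N t e. ?sub N t e b m)")
proof
  assume "flow good d a b m"
  then show "\<exists>N t e. ?sub N t e b m"
  proof (induction rule: flow.induct)
    case (flow_refl a)
    show ?case by (rule exI[of _ 0], rule exI[of _ "\<lambda>_. a"]) simp
  next
    case (flow_step a b m c e0)
    then obtain N t e where h: "t 0 = a" "t N = b" "\<forall>k<N. t k < t (Suc k)" "\<forall>k<N. 0 < e k \<and> e k < pi"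
      "\<forall>k<N. \<forall>s\<in>{t k..t (Suc k)}. good (e k) s" "m = - (\<Sum>k<N. d (e k) (t k) - d (e k) (t (Suc k)))"
      by blast
    let ?t = "t(Suc N := c)" and ?e = "e(N := e0)"
    have "(\<Sum>k<N. d (?e k) (?t k) - d (?e k) (?t (Suc k))) = (\<Sum>k<N. d (e k) (t k) - d (e k) (t (Suc k)))"
      by (rule sum.cong) auto
    then show ?case
      using h flow_step.hyps
      by (intro exI[of _ "Suc N"] exI[of _ ?t] exI[of _ ?e]) (auto simp: less_Suc_eq)
  qed
next
  assume "\<exists>N t e. ?sub N t e b m"
  then obtain N t e where "?sub N t e b m" by blast
  then show "flow good d a b m"
  proof (induction N arbitrary: b m)
    case 0
    then show ?case using flow_refl[of good d a] by auto
  next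
    case (Suc N)
    have "flow good d a (t N) (- (\<Sum>k<N. d (e k) (t k) - d (e k) (t (Suc k))))"
      by (rule Suc.IH) (use Suc.prems in auto)
    moreover have "t N < b" using Suc.prems by auto
    ultimately have "flow good d a b (- (\<Sum>k<N. d (e k) (t k) - d (e k) (t (Suc k)))
        + (d (e N) b - d (e N) (t N)))"
      by (rule flow_step) (use Suc.prems in auto)
    moreover have "m = - (\<Sum>k<N. d (e k) (t k) - d (e k) (t (Suc k))) + (d (e N) b - d (e N) (t N))"
      using Suc.prems by auto
    ultimately show ?case by simp
  qed
qed

lemma maslov_value_iff_flow:
  "maslov_value w L M a b m \<longleftrightarrow> (\<exists>Vp Vm. symplectic_splitting w Vp Vm \<and>
     flow (\<lambda>e t. cis e \<notin> spectrum_on Vm (pair_op Vp Vm (L t) (M t)) \<and>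
                cis (- e) \<notin> spectrum_on Vm (pair_op Vp Vm (L t) (M t)))
          (\<lambda>e t. int (arc_count Vm (pair_op Vp Vm (L t) (M t)) e)) a b m)"
  unfolding maslov_value_def flow_iff_subdivision by blast

text \<open>
  The splitting is allowed to move with the parameter. With a fixed splitting this is the value of
  the Maslov index; moving splittings make invariance under a path of symplectic maps a case of
  homotopy invariance.
\<close>
definition maslov_flow :: "(real \<Rightarrow> (complex ^ 'm) set) \<Rightarrow> (real \<Rightarrow> (complex ^ 'm) set) \<Rightarrow>
    (real \<Rightarrow> (complex ^ 'm) set) \<Rightarrow> (real \<Rightarrow> (complex ^ 'm) set) \<Rightarrow> real \<Rightarrow> real \<Rightarrow> int \<Rightarrow> bool" where
  "maslov_flow Vp Vm L M = flow
     (\<lambda>e t. cis e \<notin> spectrum_on (Vm t) (pair_op (Vp t) (Vm t) (L t) (M t)) \<and>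
           cis (- e) \<notin> spectrum_on (Vm t) (pair_op (Vp t) (Vm t) (L t) (M t)))
     (\<lambda>e t. int (arc_count (Vm t) (pair_op (Vp t) (Vm t) (L t) (M t)) e))"

text \<open>
  All data are images of fixed subspaces under continuous families of isomorphisms. So the operators
  of the pairs can be transported to the fixed space \<open>Vm\<close>, on which they are unitary for a form that
  moves.
\<close>
locale symplectic_family = symplectic_form w
  for w :: "complex ^ 'm \<Rightarrow> complex ^ 'm \<Rightarrow> complex" +
  fixes G A B :: "'x::topological_space \<Rightarrow> complex ^ 'm \<Rightarrow> complex ^ 'm"
    and Vp Vm la mu :: "(complex ^ 'm) set"
  assumes G: "cfam G" and bij_G: "bij (G x)"
    and A: "cfam A" and bij_A: "bij (A x)"
    and B: "cfam B" and bij_B: "bij (B x)"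
    and splitting: "symplectic_splitting w (G x ` Vp) (G x ` Vm)"
    and lagrangian_A: "lagrangian (A x ` la)"
    and lagrangian_B: "lagrangian (B x ` mu)"
begin

definition pairing :: "'x \<Rightarrow> complex ^ 'm \<Rightarrow> complex ^ 'm \<Rightarrow> complex" where
  "pairing x v v' = \<i> * w (G x v) (G x v')"

definition op :: "'x \<Rightarrow> complex ^ 'm \<Rightarrow> complex ^ 'm" where
  "op x v = inv (G x) (proj_along (G x ` Vm) (G x ` Vp) (proj_along (A x ` la) (G x ` Vm)
     (proj_along (B x ` mu) (G x ` Vp) (G x v))))"

lemmas cG = cfam_clin[OF G]

lemma op_cfam: "cfam op"
proof -
  have 1: "cfam (\<lambda>x. proj_along (G x ` Vm) (G x ` Vp))"
    by (rule cfam_proj_along[OF G bij_G G bij_G complementary_sym[OF splitting_complementary[OF splitting]]])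
  have 2: "cfam (\<lambda>x. proj_along (A x ` la) (G x ` Vm))"
    by (rule cfam_proj_along[OF A bij_A G bij_G lagrangian_complementary(1)[OF splitting lagrangian_A]])
  have 3: "cfam (\<lambda>x. proj_along (B x ` mu) (G x ` Vp))"
    by (rule cfam_proj_along[OF B bij_B G bij_G lagrangian_complementary(2)[OF splitting lagrangian_B]])
  have "cfam (\<lambda>x v. inv (G x) (proj_along (G x ` Vm) (G x ` Vp) (proj_along (A x ` la) (G x ` Vm)
     (proj_along (B x ` mu) (G x ` Vp) (G x v)))))"
    by (rule cfam_compose[OF cfam_inv[OF G bij_G] cfam_compose[OF 1 cfam_compose[OF 2 cfam_compose[OF 3 G]]]])
  then show ?thesis unfolding op_def .
qed

lemma Vm_eq: "Vm = inv (G x) ` (G x ` Vm)"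
  using bij_G[of x] by (simp add: image_comp bij_is_inj)

lemma subspace_Vm: "vec.subspace Vm"
proof -
  fix x
  have "vec.subspace (inv (G x) ` (G x ` Vm))"
    by (rule vec.linear_subspace_image[OF clin_inv[OF cG bij_G]])
      (use splitting[of x] in \<open>simp add: symplectic_splitting_def\<close>)
  then show ?thesis using Vm_eq[of x] by simp
qed

lemma op_step:
  assumes "v \<in> Vm"
  shows "op x v \<in> Vm" "pair_op (G x ` Vp) (G x ` Vm) (A x ` la) (B x ` mu) (G x v) = G x (op x v)"
    and "\<exists>p\<in>G x ` Vp. p + G x v \<in> B x ` mu \<and> p + G x (op x v) \<in> A x ` la"
proof -
  have v: "G x v \<in> G x ` Vm" using assms by blast
  note p = pair_op_proj[OF splitting[of x] lagrangian_A lagrangian_B v]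
  let ?l = "proj_along (B x ` mu) (G x ` Vp) (G x v)"
  let ?z = "proj_along (A x ` la) (G x ` Vm) ?l"
  let ?u = "proj_along (G x ` Vm) (G x ` Vp) ?z"
  have gu: "G x (op x v) = ?u" unfolding op_def using bij_G[of x] by (simp add: bij_is_surj surj_f_inv_f)
  then show "pair_op (G x ` Vp) (G x ` Vm) (A x ` la) (B x ` mu) (G x v) = G x (op x v)"
    using p(1) by simp
  have "G x (op x v) \<in> G x ` Vm" using gu p(5) by simp
  then show "op x v \<in> Vm" using bij_G[of x] by (simp add: bij_is_inj inj_image_mem_iff)
  have "?l - G x v + G x v \<in> B x ` mu" using p(2) by simp
  moreover have "?l - G x v + G x (op x v) \<in> A x ` la"
    unfolding gu using p(4,6) by (metis diff_add_cancel)
  ultimately show "\<exists>p\<in>G x ` Vp. p + G x v \<in> B x ` mu \<and> p + G x (op x v) \<in> A x ` la"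
    using p(3) by blast
qed

text \<open>
  The form vanishes between the vectors \<open>p + G x u\<close> of the second Lagrangian, and between the vectors
  \<open>p + G x (op x u)\<close> of the first. As the positive parts \<open>p\<close> are the same, the products of the negative
  parts agree.
\<close>
lemma op_unitary: "unitary_on Vm (pairing x) (op x)"
proof (rule unitary_on.intro)
  show "hermitian_form (pairing x)"
    unfolding hermitian_form_def
  proof (intro conjI allI)
    show "pairing x v u = cnj (pairing x u v)" for u v
      unfolding pairing_def using w_skew[of "G x v" "G x u"] by simp
  qed (simp_all add: pairing_def clin_add[OF cG] clin_scale[OF cG] w_add w_scale algebra_simps)
  show "0 < Re (pairing x v v)" if "v \<in> Vm" "v \<noteq> 0" for v
  proof -
    have "G x v \<noteq> G x 0" using that(2) bij_G[of x] by (simp add: bij_is_inj inj_eq)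
    then have "G x v \<noteq> 0" by (simp add: clin_0[OF cG])
    then have "Re (- \<i> * w (G x v) (G x v)) < 0"
      using splitting[of x] that(1) unfolding symplectic_splitting_def by blast
    then show ?thesis unfolding pairing_def by simp
  qed
  show "pairing x (op x u) (op x v) = pairing x u v" if uv: "u \<in> Vm" "v \<in> Vm" for u v
  proof -
    obtain p where p: "p \<in> G x ` Vp" "p + G x u \<in> B x ` mu" "p + G x (op x u) \<in> A x ` la"
      using op_step(3)[OF uv(1)] by blast
    obtain q where q: "q \<in> G x ` Vp" "q + G x v \<in> B x ` mu" "q + G x (op x v) \<in> A x ` la"
      using op_step(3)[OF uv(2)] by blast
    have orth: "w y z = 0" "w z y = 0" if "y \<in> G x ` Vp" "z \<in> G x ` Vm" for y z
    proof -
      show "w y z = 0" using splitting[of x] that unfolding symplectic_splitting_def by blast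
      then show "w z y = 0" using w_skew[of z y] by simp
    qed
    have m: "G x u \<in> G x ` Vm" "G x v \<in> G x ` Vm" "G x (op x u) \<in> G x ` Vm" "G x (op x v) \<in> G x ` Vm"
      using uv op_step(1) by auto
    have "w (p + G x u) (q + G x v) = 0"
      by (rule lagrangian_isotropic[OF lagrangian_B p(2) q(2)])
    moreover have "w (p + G x (op x u)) (q + G x (op x v)) = 0"
      by (rule lagrangian_isotropic[OF lagrangian_A p(3) q(3)])
    ultimately have "w (G x (op x u)) (G x (op x v)) = w (G x u) (G x v)"
      using orth(1)[OF p(1) m(2)] orth(1)[OF p(1) m(4)] orth(2)[OF q(1) m(1)] orth(2)[OF q(1) m(3)]
      by (simp add: w_add w_add2) (metis add_left_cancel)
    then show ?thesis unfolding pairing_def by simp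
  qed
qed (use subspace_Vm op_step(1) cfam_clin[OF op_cfam] in auto)

sublocale unitary_family Vm pairing op
proof (rule unitary_family.intro)
  show "continuous_on UNIV (\<lambda>p. op (fst p) (snd p))" using op_cfam unfolding cfam_def by blast
  have Gc: "continuous_on UNIV (\<lambda>p. G (fst p) (snd p))" using G unfolding cfam_def by blast
  have G1: "continuous_on UNIV (\<lambda>p :: 'x \<times> (complex ^ 'm) \<times> (complex ^ 'm). G (fst p) (fst (snd p)))"
    by (rule continuous_on_compose2[OF Gc, of UNIV "\<lambda>p. (fst p, fst (snd p))", simplified])
      (intro continuous_intros)
  have G2: "continuous_on UNIV (\<lambda>p :: 'x \<times> (complex ^ 'm) \<times> (complex ^ 'm). G (fst p) (snd (snd p)))"
    by (rule continuous_on_compose2[OF Gc, of UNIV "\<lambda>p. (fst p, snd (snd p))", simplified])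
      (intro continuous_intros)
  have "continuous_on UNIV (\<lambda>p :: 'x \<times> (complex ^ 'm) \<times> (complex ^ 'm).
      w (G (fst p) (fst (snd p))) (G (fst p) (snd (snd p))))"
    by (rule continuous_on_compose2[OF w_cont, of UNIV
          "\<lambda>p. (G (fst p) (fst (snd p)), G (fst p) (snd (snd p)))", simplified])
      (intro continuous_intros G1 G2)
  then show "continuous_on UNIV (\<lambda>p. pairing (fst p) (fst (snd p)) (snd (snd p)))"
    unfolding pairing_def by (intro continuous_intros)
qed (rule op_unitary)

lemma pair_op_transfer:
  defines "P \<equiv> \<lambda>x. pair_op (G x ` Vp) (G x ` Vm) (A x ` la) (B x ` mu)"
  shows "vec.dim (eigenspace_on (G x ` Vm) (P x) c) = vec.dim (eigenspace_on Vm (op x) c)"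
    and "spectrum_on (G x ` Vm) (P x) = spectrum_on Vm (op x)"
    and "arc_count (G x ` Vm) (P x) e = arc_count Vm (op x) e"
  unfolding P_def
  by (rule arc_count_transfer[where g = "G x" and h' = "op x",
        OF cG bij_is_inj[OF bij_G] op_step(2)]; assumption)+

lemma pflow_iff_maslov_flow:
  "pflow p a b m \<longleftrightarrow> maslov_flow (\<lambda>t. G (p t) ` Vp) (\<lambda>t. G (p t) ` Vm) (\<lambda>t. A (p t) ` la) (\<lambda>t. B (p t) ` mu) a b m"
  unfolding maslov_flow_def pair_op_transfer by (rule refl)

lemma dim_kernel: "vec.dim (eigenspace_on Vm (op x) 1) = vec.dim (A x ` la \<inter> B x ` mu)"
  using pair_op_transfer(1)[of x 1] dim_eigenspace_one[OF splitting lagrangian_A lagrangian_B] by simp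

end

theorem maslov_flow_homotopy:
  fixes G A B :: "real \<times> real \<Rightarrow> complex ^ 'm \<Rightarrow> complex ^ 'm"
  assumes "symplectic_family w G A B Vp Vm la mu"
    and dim_a: "\<And>s. vec.dim (A (s, a) ` la \<inter> B (s, a) ` mu) = na"
    and dim_b: "\<And>s. vec.dim (A (s, b) ` la \<inter> B (s, b) ` mu) = nb"
    and m: "maslov_flow (\<lambda>t. G (0, t) ` Vp) (\<lambda>t. G (0, t) ` Vm) (\<lambda>t. A (0, t) ` la) (\<lambda>t. B (0, t) ` mu) a b m"
  shows "maslov_flow (\<lambda>t. G (1, t) ` Vp) (\<lambda>t. G (1, t) ` Vm) (\<lambda>t. A (1, t) ` la) (\<lambda>t. B (1, t) ` mu) a b m"
proof -
  interpret symplectic_family w G A B Vp Vm la mu by fact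
  have "pflow (\<lambda>t. (1, t)) a b m"
  proof (rule flow_homotopy[of "\<lambda>q. q" a b])
    show "pflow (\<lambda>t. (0, t)) a b m" using m unfolding pflow_iff_maslov_flow .
    then show "a \<le> b" by (rule flow_le)
    have cp: "continuous_on UNIV (\<lambda>s :: real. (s, t))" for t :: real by (intro continuous_intros)
    show "\<forall>\<^sub>F s in nhds s0. count e (s, a) = count e (s0, a)"
      if "0 < e" "e < pi" "good e (s0, a)" for e s0
      by (rule count_locally_constant[OF cp that]) (simp add: dim_kernel dim_a)
    show "\<forall>\<^sub>F s in nhds s0. count e (s, b) = count e (s0, b)"
      if "0 < e" "e < pi" "good e (s0, b)" for e s0
      by (rule count_locally_constant[OF cp that]) (simp add: dim_kernel dim_b)
  qed simp
  then show ?thesis unfolding pflow_iff_maslov_flow .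
qed

context symplectic_form
begin

text \<open>
  A vector of the second positive space is deformed by damping its negative part with respect to the
  first splitting. The damping makes it only more positive, and at the end the vector lies in the
  first positive space. Negative vectors are treated in the same way.
\<close>
lemma splitting_path:
  assumes sp0: "symplectic_splitting w Vp0 Vm0" and sp1: "symplectic_splitting w Vp1 Vm1"
  obtains G :: "real \<Rightarrow> complex ^ 'm \<Rightarrow> complex ^ 'm" where "cfam G" "\<And>s. bij (G s)"
    "\<And>s. symplectic_splitting w (G s ` Vp1) (G s ` Vm1)"
    "G 0 ` Vp1 = Vp0" "G 0 ` Vm1 = Vm0" "G 1 ` Vp1 = Vp1" "G 1 ` Vm1 = Vm1"
proof
  note c0 = splitting_complementary[OF sp0] and c1 = splitting_complementary[OF sp1]
  define P0 where "P0 = proj_along Vp0 Vm0"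
  define P1 where "P1 = proj_along Vp1 Vm1"
  have l0: "clin P0" and l1: "clin P1" unfolding P0_def P1_def by (rule clin_proj_along; fact)+
  have S0: "vec.subspace Vp0" "vec.subspace Vm0" and S1: "vec.subspace Vp1" "vec.subspace Vm1"
    using c0 c1 unfolding complementary_def by auto
  have P0: "P0 v \<in> Vp0" "v - P0 v \<in> Vm0" for v unfolding P0_def by (rule proj_along[OF c0])+
  have P1: "P1 v \<in> Vp1" "v - P1 v \<in> Vm1" for v unfolding P1_def by (rule proj_along[OF c1])+
  define r where "r s = complex_of_real (max 0 (min 1 s))" for s
  have r01: "r 0 = 0" "r 1 = 1" unfolding r_def by auto
  have rreal: "cnj (r s) = r s" for s unfolding r_def by simp
  \<comment> \<open>damp the component of a vector of the second splitting that lies in the wrong part of the first\<close>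
  define Gp where "Gp s v = P0 v + r s *s (v - P0 v)" for s v
  define Gm where "Gm s v = (v - P0 v) + r s *s P0 v" for s v
  define G where "G s v = Gp s (P1 v) + Gm s (v - P1 v)" for s v
  have cr: "continuous_on UNIV r" unfolding r_def by (intro continuous_intros)
  have id: "cfam (\<lambda>s v. v)" by (rule cfam_const[OF clin_id])
  note cP0 = cfam_const[OF l0] and cP1 = cfam_const[OF l1]
  have cGp: "cfam Gp" unfolding Gp_def
    by (rule cfam_add[OF cP0 cfam_scale[OF cr cfam_diff[OF id cP0]]])
  have cGm: "cfam Gm" unfolding Gm_def
    by (rule cfam_add[OF cfam_diff[OF id cP0] cfam_scale[OF cr cP0]])
  show cG: "cfam G" unfolding G_def
    by (rule cfam_add[OF cfam_compose[OF cGp cP1] cfam_compose[OF cGm cfam_diff[OF id cP1]]])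
  note lG = cfam_clin[OF cG] and lGp = cfam_clin[OF cGp] and lGm = cfam_clin[OF cGm]
  have Gx: "G s x = Gp s x" if "x \<in> Vp1" for s x
  proof -
    have "P1 x = x" unfolding P1_def by (rule proj_along_unique[OF c1]) (use that vec.subspace_0[OF S1(2)] in auto)
    then show ?thesis unfolding G_def by (simp add: clin_0[OF lGm])
  qed
  have Gy: "G s y = Gm s y" if "y \<in> Vm1" for s y
  proof -
    have "P1 y = 0" unfolding P1_def by (rule proj_along_unique[OF c1]) (use that vec.subspace_0[OF S1(1)] in auto)
    then show ?thesis unfolding G_def by (simp add: clin_0[OF lGp])
  qed
  have orth0: "w (P0 u) (v - P0 v) = 0" "w (v - P0 v) (P0 u) = 0" for u v
  proof -
    show "w (P0 u) (v - P0 v) = 0" using sp0 P0 unfolding symplectic_splitting_def by blast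
    then show "w (v - P0 v) (P0 u) = 0" using w_skew[of "v - P0 v" "P0 u"] by simp
  qed
  have split: "w u v = w (P0 u) (P0 v) + w (u - P0 u) (v - P0 v)" for u v
  proof -
    have "w u v = w (P0 u + (u - P0 u)) (P0 v + (v - P0 v))" by simp
    then show ?thesis unfolding w_add w_add2 orth0 by simp
  qed
  have orth: "w (G s x) (G s y) = 0" if "x \<in> Vp1" "y \<in> Vm1" for s x y
  proof -
    have "w (G s x) (G s y) = r s * (w (P0 x) (P0 y) + w (x - P0 x) (y - P0 y))"
      unfolding Gx[OF that(1)] Gy[OF that(2)] Gp_def Gm_def w_add w_add2 w_scale w_scale2 orth0 rreal
      by (simp add: algebra_simps)
    also have "\<dots> = r s * w x y" using split[of x y] by simp
    also have "\<dots> = 0" using sp1 that unfolding symplectic_splitting_def by simp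
    finally show ?thesis .
  qed
  have q: "0 \<le> Re (- \<i> * w (P0 v) (P0 v))" "Re (- \<i> * w (v - P0 v) (v - P0 v)) \<le> 0" for v
    using sp0 P0[of v] w_zero unfolding symplectic_splitting_def
    by (metis complex_Re_of_int less_eq_real_def mult_zero_right of_int_0)+
  have rr: "r s * r s = complex_of_real ((max 0 (min 1 s))\<^sup>2)" for s
    unfolding r_def by (simp add: power2_eq_square)
  have sq: "(max 0 (min 1 s))\<^sup>2 \<le> 1" "0 \<le> (max 0 (min 1 s))\<^sup>2" for s :: real
    by (auto simp: power_le_one)
  have split_Re: "Re (- \<i> * w v v) = Re (- \<i> * w (P0 v) (P0 v)) + Re (- \<i> * w (v - P0 v) (v - P0 v))" for v
    using split[of v v] by (simp add: algebra_simps)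
  have pos: "0 < Re (- \<i> * w (G s x) (G s x))" if x: "x \<in> Vp1" "x \<noteq> 0" for s x
  proof -
    let ?t = "(max 0 (min 1 s))\<^sup>2"
    have "w (G s x) (G s x) = w (P0 x) (P0 x) + complex_of_real ?t * w (x - P0 x) (x - P0 x)"
      unfolding Gx[OF x(1)] Gp_def w_add w_add2 w_scale w_scale2 orth0 rreal rr[symmetric]
      by (simp add: algebra_simps)
    then have "Re (- \<i> * w (G s x) (G s x))
        = Re (- \<i> * w (P0 x) (P0 x)) + ?t * Re (- \<i> * w (x - P0 x) (x - P0 x))"
      by (simp add: algebra_simps)
    moreover have "1 * Re (- \<i> * w (x - P0 x) (x - P0 x)) \<le> ?t * Re (- \<i> * w (x - P0 x) (x - P0 x))"
      by (rule mult_right_mono_neg[OF sq(1) q(2)])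
    moreover have "0 < Re (- \<i> * w x x)" using sp1 x unfolding symplectic_splitting_def by blast
    ultimately show ?thesis using split_Re[of x] by linarith
  qed
  have neg: "Re (- \<i> * w (G s y) (G s y)) < 0" if y: "y \<in> Vm1" "y \<noteq> 0" for s y
  proof -
    let ?t = "(max 0 (min 1 s))\<^sup>2"
    have "w (G s y) (G s y) = w (y - P0 y) (y - P0 y) + complex_of_real ?t * w (P0 y) (P0 y)"
      unfolding Gy[OF y(1)] Gm_def w_add w_add2 w_scale w_scale2 orth0 rreal rr[symmetric]
      by (simp add: algebra_simps)
    then have "Re (- \<i> * w (G s y) (G s y))
        = Re (- \<i> * w (y - P0 y) (y - P0 y)) + ?t * Re (- \<i> * w (P0 y) (P0 y))"
      by (simp add: algebra_simps)
    moreover have "?t * Re (- \<i> * w (P0 y) (P0 y)) \<le> 1 * Re (- \<i> * w (P0 y) (P0 y))"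
      by (rule mult_right_mono[OF sq(1) q(1)])
    moreover have "Re (- \<i> * w y y) < 0" using sp1 y unfolding symplectic_splitting_def by blast
    ultimately show ?thesis using split_Re[of y] by linarith
  qed
  have dec: "P1 v \<in> Vp1" "v - P1 v \<in> Vm1" "G s v = G s (P1 v) + G s (v - P1 v)" for s v
    using P1 clin_add[OF lG, of s "P1 v" "v - P1 v"] by simp_all
  show bijG: "bij (G s)" for s
  proof (rule clin_inj_imp_bij[OF lG])
    fix v assume v: "G s v = 0"
    let ?x = "P1 v" and ?y = "v - P1 v"
    have "w (G s ?x) (G s ?x) = w (G s ?x) (G s v)" "w (G s ?y) (G s ?y) = w (G s v) (G s ?y)"
      using orth[OF dec(1,2)[of v]] unfolding dec(3)[of s v] w_add w_add2 by simp_all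
    then have "w (G s ?x) (G s ?x) = 0" "w (G s ?y) (G s ?y) = 0" using v by (simp_all add: w_zero)
    then have "?x = 0" "?y = 0" using pos[OF dec(1), of v s] neg[OF dec(2), of v s] by fastforce+
    then show "v = 0" by simp
  qed
  have surj: "\<exists>x\<in>Vp1. \<exists>y\<in>Vm1. v = G s x + G s y" for s v
  proof -
    have "G s (inv (G s) v) = v" using bijG[of s] by (simp add: bij_is_surj surj_f_inv_f)
    then show ?thesis using dec(1,2)[of "inv (G s) v"] dec(3)[of s "inv (G s) v"] by metis
  qed
  show spG: "symplectic_splitting w (G s ` Vp1) (G s ` Vm1)" for s
    unfolding symplectic_splitting_def
  proof (intro conjI)
    show sub: "vec.subspace (G s ` Vp1)" "vec.subspace (G s ` Vm1)"
      by (intro vec.linear_subspace_image lG S1)+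
    show "\<forall>x\<in>G s ` Vp1. x \<noteq> 0 \<longrightarrow> 0 < Re (- \<i> * w x x)"
      using pos clin_0[OF lG] by blast
    moreover show "\<forall>x\<in>G s ` Vm1. x \<noteq> 0 \<longrightarrow> Re (- \<i> * w x x) < 0"
      using neg clin_0[OF lG] by blast
    ultimately show "G s ` Vp1 \<inter> G s ` Vm1 = {0}"
      using vec.subspace_0[OF sub(1)] vec.subspace_0[OF sub(2)] by (auto, fastforce)
    show "\<forall>v. \<exists>x\<in>G s ` Vp1. \<exists>y\<in>G s ` Vm1. v = x + y" using surj by blast
    show "\<forall>x\<in>G s ` Vp1. \<forall>y\<in>G s ` Vm1. w x y = 0" using orth by blast
  qed
  have G1: "G 1 v = v" for v unfolding G_def Gp_def Gm_def r01 by simp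
  show "G 1 ` Vp1 = Vp1" "G 1 ` Vm1 = Vm1" unfolding G1 by simp_all
  have g0x: "G 0 x \<in> Vp0" if "x \<in> Vp1" for x unfolding Gx[OF that] Gp_def r01 using P0 by simp
  have g0y: "G 0 y \<in> Vm0" if "y \<in> Vm1" for y unfolding Gy[OF that] Gm_def r01 using P0 by simp
  have int0: "u = 0" if "u \<in> Vp0" "u \<in> Vm0" for u
    using that c0 unfolding complementary_def by blast
  show "G 0 ` Vp1 = Vp0"
  proof (intro equalityI subsetI)
    fix v assume v: "v \<in> Vp0"
    obtain x y where xy: "x \<in> Vp1" "y \<in> Vm1" "v = G 0 x + G 0 y" using surj by blast
    have "G 0 y \<in> Vp0" using vec.subspace_diff[OF S0(1) v g0x[OF xy(1)]] xy(3) by simp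
    then have "G 0 y = 0" using int0 g0y[OF xy(2)] by blast
    then show "v \<in> G 0 ` Vp1" using xy by simp
  qed (use g0x in blast)
  show "G 0 ` Vm1 = Vm0"
  proof (intro equalityI subsetI)
    fix v assume v: "v \<in> Vm0"
    obtain x y where xy: "x \<in> Vp1" "y \<in> Vm1" "v = G 0 x + G 0 y" using surj by blast
    have "G 0 x \<in> Vm0" using vec.subspace_diff[OF S0(2) v g0y[OF xy(2)]] xy(3) by simp
    then have "G 0 x = 0" using int0 g0x[OF xy(1)] by blast
    then show "v \<in> G 0 ` Vm1" using xy by simp
  qed (use g0y in blast)
qed

end

context symplectic_form
begin

lemma maslov_flow_cong:
  assumes "maslov_flow Vp Vm L M a b m"
    and "\<And>t. a \<le> t \<Longrightarrow> t \<le> b \<Longrightarrow> L t = L' t" "\<And>t. a \<le> t \<Longrightarrow> t \<le> b \<Longrightarrow> M t = M' t"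
    and "\<And>t. a \<le> t \<Longrightarrow> t \<le> b \<Longrightarrow> Vp t = Vp' t" "\<And>t. a \<le> t \<Longrightarrow> t \<le> b \<Longrightarrow> Vm t = Vm' t"
  shows "maslov_flow Vp' Vm' L' M' a b m"
  using assms(1) unfolding maslov_flow_def by (rule flow_cong) (simp_all add: assms(2-))

lemma maslov_flow_splitting_independent:
  fixes A B :: "real \<Rightarrow> complex ^ 'm \<Rightarrow> complex ^ 'm"
  assumes A: "cfam A" "\<And>t. bij (A t)" "\<And>t. lagrangian (A t ` la)"
    and B: "cfam B" "\<And>t. bij (B t)" "\<And>t. lagrangian (B t ` mu)"
    and sp0: "symplectic_splitting w Vp0 Vm0" and sp1: "symplectic_splitting w Vp1 Vm1"
    and m: "maslov_flow (\<lambda>t. Vp0) (\<lambda>t. Vm0) (\<lambda>t. A t ` la) (\<lambda>t. B t ` mu) a b m"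
  shows "maslov_flow (\<lambda>t. Vp1) (\<lambda>t. Vm1) (\<lambda>t. A t ` la) (\<lambda>t. B t ` mu) a b m"
proof -
  obtain G :: "real \<Rightarrow> complex ^ 'm \<Rightarrow> complex ^ 'm" where G: "cfam G" "\<And>s. bij (G s)"
    "\<And>s. symplectic_splitting w (G s ` Vp1) (G s ` Vm1)"
    and ends: "G 0 ` Vp1 = Vp0" "G 0 ` Vm1 = Vm0" "G 1 ` Vp1 = Vp1" "G 1 ` Vm1 = Vm1"
    by (rule splitting_path[OF sp0 sp1]) (rule that; assumption)
  have fam: "symplectic_family w (\<lambda>q. G (fst q)) (\<lambda>q :: real \<times> real. A (snd q)) (\<lambda>q. B (snd q)) Vp1 Vm1 la mu"
  proof (unfold_locales)
    show "cfam (\<lambda>q :: real \<times> real. G (fst q))" "cfam (\<lambda>q :: real \<times> real. A (snd q))"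
      "cfam (\<lambda>q :: real \<times> real. B (snd q))"
      by (rule cfam_reparam[OF G(1)] cfam_reparam[OF A(1)] cfam_reparam[OF B(1)]; intro continuous_intros)+
    fix q :: "real \<times> real"
    show "bij (G (fst q))" "bij (A (snd q))" "bij (B (snd q))"
      "symplectic_splitting w (G (fst q) ` Vp1) (G (fst q) ` Vm1)"
      "lagrangian (A (snd q) ` la)" "lagrangian (B (snd q) ` mu)"
      by (rule G A B)+
  qed
  have "maslov_flow (\<lambda>t. G (fst (1 :: real, t)) ` Vp1) (\<lambda>t. G (fst (1 :: real, t)) ` Vm1)
      (\<lambda>t. A (snd (1 :: real, t)) ` la) (\<lambda>t. B (snd (1 :: real, t)) ` mu) a b m"
  proof (rule maslov_flow_homotopy[OF fam])
    show "maslov_flow (\<lambda>t. G (fst (0 :: real, t)) ` Vp1) (\<lambda>t. G (fst (0 :: real, t)) ` Vm1)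
      (\<lambda>t. A (snd (0 :: real, t)) ` la) (\<lambda>t. B (snd (0 :: real, t)) ` mu) a b m"
      unfolding fst_conv snd_conv ends by (rule m)
  qed (simp_all only: snd_conv)
  then show ?thesis unfolding fst_conv snd_conv ends .
qed

lemma const_family:
  fixes A B :: "'x::topological_space \<Rightarrow> complex ^ 'm \<Rightarrow> complex ^ 'm"
  assumes "cfam A" "\<And>t. bij (A t)" "\<And>t. lagrangian (A t ` la)"
    and "cfam B" "\<And>t. bij (B t)" "\<And>t. lagrangian (B t ` mu)"
    and "symplectic_splitting w Vp Vm"
  shows "symplectic_family w (\<lambda>_ v. v) A B Vp Vm la mu"
proof unfold_locales
  show "cfam (\<lambda>_ :: 'x. \<lambda>v :: complex ^ 'm. v)" by (rule cfam_const[OF clin_id])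
  show "bij (\<lambda>v :: complex ^ 'm. v)" by (rule bij_id[unfolded id_def])
qed (use assms in auto)

text \<open>
  Another value of the index comes from some splitting; deformed to the splitting \<open>Vp\<close>, \<open>Vm\<close> it is a value
  of the same flow as \<open>m\<close>.
\<close>
theorem Mas_eq:
  fixes A B :: "real \<Rightarrow> complex ^ 'm \<Rightarrow> complex ^ 'm"
  assumes fA: "cfam A" "\<And>t. bij (A t)" "\<And>t. lagrangian (A t ` la)"
    and fB: "cfam B" "\<And>t. bij (B t)" "\<And>t. lagrangian (B t ` mu)"
    and L: "\<And>t. a \<le> t \<Longrightarrow> t \<le> b \<Longrightarrow> L t = A t ` la" and M: "\<And>t. a \<le> t \<Longrightarrow> t \<le> b \<Longrightarrow> M t = B t ` mu"
    and sp: "symplectic_splitting w Vp Vm"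
    and m: "maslov_flow (\<lambda>t. Vp) (\<lambda>t. Vm) (\<lambda>t. A t ` la) (\<lambda>t. B t ` mu) a b m"
  shows "Mas w L M a b = m"
  unfolding Mas_def
proof (rule the_equality)
  have "maslov_flow (\<lambda>t. Vp) (\<lambda>t. Vm) L M a b m"
    by (rule maslov_flow_cong[OF m]) (simp_all add: L M)
  then show "maslov_value w L M a b m"
    unfolding maslov_value_iff_flow maslov_flow_def using sp by blast
next
  interpret symplectic_family w "\<lambda>_ v. v" A B Vp Vm la mu by (rule const_family[OF fA fB sp])
  fix m' assume "maslov_value w L M a b m'"
  then obtain Vp' Vm' where sp': "symplectic_splitting w Vp' Vm'"
    and "maslov_flow (\<lambda>t. Vp') (\<lambda>t. Vm') L M a b m'"
    unfolding maslov_value_iff_flow maslov_flow_def by blast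
  then have "maslov_flow (\<lambda>t. Vp') (\<lambda>t. Vm') (\<lambda>t. A t ` la) (\<lambda>t. B t ` mu) a b m'"
    by (elim maslov_flow_cong) (simp_all add: L M)
  then have "maslov_flow (\<lambda>t. Vp) (\<lambda>t. Vm) (\<lambda>t. A t ` la) (\<lambda>t. B t ` mu) a b m'"
    by (rule maslov_flow_splitting_independent[OF fA fB sp' sp])
  then have "pflow (\<lambda>t. t) a b m'" unfolding pflow_iff_maslov_flow by simp
  moreover have "pflow (\<lambda>t. t) a b m" using m unfolding pflow_iff_maslov_flow by simp
  ultimately show "m' = m" by (rule flow_unique) simp
qed

lemma splitting_image:
  assumes S: "clin S" "bij S" "\<And>x y. w (S x) (S y) = w x y" and sp: "symplectic_splitting w Vp Vm"
  shows "symplectic_splitting w (S ` Vp) (S ` Vm)"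
  unfolding symplectic_splitting_def
proof (intro conjI)
  have V: "vec.subspace Vp" "vec.subspace Vm" "Vp \<inter> Vm = {0}" "\<And>v. \<exists>x\<in>Vp. \<exists>y\<in>Vm. v = x + y"
    using sp unfolding symplectic_splitting_def by blast+
  show "vec.subspace (S ` Vp)" "vec.subspace (S ` Vm)"
    by (intro vec.linear_subspace_image S V)+
  show "S ` Vp \<inter> S ` Vm = {0}"
    unfolding image_Int[OF bij_is_inj[OF S(2)], symmetric] V(3) using clin_0[OF S(1)] by simp
  show "\<forall>v. \<exists>x\<in>S ` Vp. \<exists>y\<in>S ` Vm. v = x + y"
  proof
    fix v
    obtain x y where xy: "x \<in> Vp" "y \<in> Vm" "inv S v = x + y" using V(4) by blast
    have "v = S (inv S v)" using S(2) by (simp add: bij_is_surj surj_f_inv_f)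
    then have "v = S x + S y" using xy(3) by (simp add: clin_add[OF S(1)])
    then show "\<exists>x\<in>S ` Vp. \<exists>y\<in>S ` Vm. v = x + y" using xy by blast
  qed
  show "\<forall>x\<in>S ` Vp. \<forall>y\<in>S ` Vm. w x y = 0" "\<forall>x\<in>S ` Vp. x \<noteq> 0 \<longrightarrow> 0 < Re (- \<i> * w x x)"
    "\<forall>x\<in>S ` Vm. x \<noteq> 0 \<longrightarrow> Re (- \<i> * w x x) < 0"
    using sp clin_0[OF S(1)] unfolding symplectic_splitting_def by (auto simp: S(3))
qed

lemma lagrangian_image:
  assumes S: "bij S" "\<And>x y. w (S x) (S y) = w x y" and L: "lagrangian L"
  shows "lagrangian (S ` L)"
  unfolding lagrangian_def
proof (intro equalityI subsetI)
  fix x assume "x \<in> {x. \<forall>y\<in>S ` L. w x y = 0}"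
  then have x: "w x (S y) = 0" if "y \<in> L" for y using that by blast
  have s: "S (inv S x) = x" using S(1) by (simp add: bij_is_surj surj_f_inv_f)
  have "inv S x \<in> L"
    by (rule lagrangian_maximal[OF L]) (use x S(2)[of "inv S x"] s in simp)
  then show "x \<in> S ` L" using s by (metis image_eqI)
qed (use lagrangian_isotropic[OF L] S(2) in auto)

lemma maslov_flow_image:
  assumes m: "maslov_flow Vp Vm L M a b m"
    and S: "\<And>t. clin (S t)" "\<And>t. bij (S t)" "\<And>t x y. w (S t x) (S t y) = w x y"
    and sp: "\<And>t. symplectic_splitting w (Vp t) (Vm t)"
    and L: "\<And>t. lagrangian (L t)" and M: "\<And>t. lagrangian (M t)"
  shows "maslov_flow (\<lambda>t. S t ` Vp t) (\<lambda>t. S t ` Vm t) (\<lambda>t. S t ` L t) (\<lambda>t. S t ` M t) a b m"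
proof -
  have conj: "pair_op (S t ` Vp t) (S t ` Vm t) (S t ` L t) (S t ` M t) (S t y)
      = S t (pair_op (Vp t) (Vm t) (L t) (M t) y)" if y: "y \<in> Vm t" for t y
  proof -
    note p = pair_op_proj[OF sp L M y]
    let ?l = "proj_along (M t) (Vp t) y"
    let ?u = "pair_op (Vp t) (Vm t) (L t) (M t) y"
    have u: "?u \<in> Vm t" "?l - y + ?u \<in> L t"
      using p(1,4,5,6) by (simp, metis diff_add_cancel)
    show ?thesis
    proof (rule pair_op_eq)
      show "symplectic_splitting w (S t ` Vp t) (S t ` Vm t)" by (rule splitting_image[OF S sp])
      show "lagrangian (S t ` L t)" "lagrangian (S t ` M t)" by (rule lagrangian_image[OF S(2,3)]; rule L M)+
      show "S t (?l - y) \<in> S t ` Vp t" "S t y \<in> S t ` Vm t" "S t ?u \<in> S t ` Vm t"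
        using p(3) y u(1) by blast+
      have "S t (?l - y + y) \<in> S t ` M t" using p(2) by simp
      then show "S t (?l - y) + S t y \<in> S t ` M t" unfolding clin_add[OF S(1)] .
      have "S t (?l - y + ?u) \<in> S t ` L t" using u(2) by blast
      then show "S t (?l - y) + S t ?u \<in> S t ` L t" unfolding clin_add[OF S(1)] .
    qed
  qed
  have tr: "spectrum_on (S t ` Vm t) (pair_op (S t ` Vp t) (S t ` Vm t) (S t ` L t) (S t ` M t))
        = spectrum_on (Vm t) (pair_op (Vp t) (Vm t) (L t) (M t))"
    "arc_count (S t ` Vm t) (pair_op (S t ` Vp t) (S t ` Vm t) (S t ` L t) (S t ` M t)) e
        = arc_count (Vm t) (pair_op (Vp t) (Vm t) (L t) (M t)) e" for t e
    by (rule arc_count_transfer[where g = "S t" and S = "Vm t"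
          and h' = "pair_op (Vp t) (Vm t) (L t) (M t)", OF S(1) bij_is_inj[OF S(2)] conj]; assumption)+
  show ?thesis using m unfolding maslov_flow_def tr .
qed

text \<open>
  Let \<open>y\<close> be an eigenvector with eigenvalue \<open>c\<close>, that is \<open>x + y \<in> M\<close> and \<open>x + c y \<in> L\<close> for some positive
  \<open>x\<close>. Applying \<open>\<tau>\<close> exchanges the roles of \<open>x\<close> and \<open>y\<close>: now \<open>\<tau> y\<close> is positive, \<open>\<tau> y + \<tau> x \<in> M\<close>, and
  \<open>\<tau> y + cnj c \<tau> x \<in> L\<close> as \<open>c cnj c = 1\<close>. So \<open>\<tau> x\<close> is an eigenvector for \<open>cnj c\<close>.
\<close>
lemma dim_eigenspace_cnj_le:
  assumes sp: "symplectic_splitting w Vp Vm" and L: "lagrangian L" and M: "lagrangian M"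
    and \<tau>: "clin \<tau>" "inj \<tau>" "\<tau> ` Vp \<subseteq> Vm" "\<tau> ` Vm \<subseteq> Vp" "\<tau> ` L \<subseteq> L" "\<tau> ` M \<subseteq> M"
  shows "vec.dim (eigenspace_on Vm (pair_op Vp Vm L M) c)
    \<le> vec.dim (eigenspace_on Vm (pair_op Vp Vm L M) (cnj c))" (is "vec.dim (?E c) \<le> _")
proof -
  note cM = lagrangian_complementary(2)[OF sp M] and cs = splitting_complementary[OF sp]
  have SM: "vec.subspace M" and SL: "vec.subspace L" and SVm: "vec.subspace Vm"
    using lagrangian_subspace L M cs unfolding complementary_def by auto
  define T where "T y = \<tau> (proj_along M Vp y - y)" for y
  have linT: "clin T" unfolding T_def
    by (rule clin_compose[OF \<tau>(1) clin_minus[OF clin_proj_along[OF cM] clin_id]])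
  have T_eq: "T y = \<tau> x" if "x \<in> Vp" "x + y \<in> M" for x y
  proof -
    have "- x \<in> Vp" using that(1) cs unfolding complementary_def by (blast intro: vec.subspace_neg)
    then have "proj_along M Vp y = x + y"
      by (intro proj_along_unique[OF cM]) (use that in simp_all)
    then show ?thesis unfolding T_def by simp
  qed
  have ex: "\<exists>x\<in>Vp. x + y \<in> M \<and> x + c *s y \<in> L" "y \<in> Vm" if "y \<in> ?E c" for y
    using that unfolding eigenspace_pair_op[OF sp L M] by blast+
  have im: "T ` ?E c \<subseteq> ?E (cnj c)"
  proof
    fix v assume "v \<in> T ` ?E c"
    then obtain y where y: "y \<in> ?E c" "v = T y" by blast
    obtain x where x: "x \<in> Vp" "x + y \<in> M" "x + c *s y \<in> L" using ex(1)[OF y(1)] by blast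
    note yV = ex(2)[OF y(1)]
    have v: "v = \<tau> x" using T_eq x y by simp
    show "v \<in> ?E (cnj c)"
    proof (cases "y = 0")
      case True
      then have "v = 0" using y(2) clin_0[OF linT] by simp
      then show ?thesis unfolding eigenspace_pair_op[OF sp L M]
        using vec.subspace_0[OF SVm] vec.subspace_0[OF SM] vec.subspace_0[OF SL] cs
        by (intro conjI bexI[of _ 0]) (auto simp: complementary_def vec.subspace_0)
    next
      case False
      have orth: "w x y = 0" "w y x = 0"
      proof -
        show "w x y = 0" using sp x(1) yV unfolding symplectic_splitting_def by blast
        then show "w y x = 0" using w_skew[of y x] by simp
      qed
      have "w x x + w y y = 0"
        using lagrangian_isotropic[OF M x(2,2)] orth by (simp add: w_add w_add2)
      moreover have "w x x + c * cnj c * w y y = 0"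
        using lagrangian_isotropic[OF L x(3,3)] orth by (simp add: w_add w_add2 w_scale w_scale2 ac_simps)
      ultimately have "w y y = c * cnj c * w y y" by (metis add_left_cancel)
      moreover have "w y y \<noteq> 0" using splitting_definite(2)[OF sp yV] False by blast
      ultimately have cc: "c * cnj c = 1" by simp
      have "\<tau> y + v \<in> M" using \<tau>(6) x(2) unfolding v by (metis add.commute clin_add[OF \<tau>(1)] image_subset_iff)
      moreover have "cnj c *s \<tau> (x + c *s y) \<in> L"
        by (intro vec.subspace_scale SL) (use \<tau>(5) x(3) in blast)
      then have "\<tau> y + cnj c *s v \<in> L"
        unfolding v using cc by (simp add: clin_add[OF \<tau>(1)] clin_scale[OF \<tau>(1)] vector_add_ldistrib
            vector_smult_assoc mult.commute add.commute)
      moreover have "\<tau> y \<in> Vp" "v \<in> Vm" using \<tau>(3,4) yV x(1) unfolding v by blast+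
      ultimately show ?thesis unfolding eigenspace_pair_op[OF sp L M] by blast
    qed
  qed
  have "vec.subspace (?E c)"
  proof -
    have L': "lagrangian ((\<lambda>v. v) ` L)" and M': "lagrangian ((\<lambda>v. v) ` M)"
      unfolding image_ident by (fact L, fact M)
    note i = cfam_const[OF clin_id] bij_id[unfolded id_def]
    interpret symplectic_family w "\<lambda>_ :: real. \<lambda>v. v" "\<lambda>_ v. v" "\<lambda>_ v. v" Vp Vm L M
      by (rule const_family[OF i L' i M' sp])
    have "?E c = (\<lambda>v. v) ` eigenspace_on Vm (op 0) c"
      using arc_count_transfer(1)[where g = "\<lambda>v. v" and S = Vm and h' = "op 0"
          and h = "pair_op Vp Vm L M", OF clin_id _ op_step(2)[of _ 0, simplified]] by simp
    then show ?thesis using subspace_es[of 0 c] by simp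
  qed
  then have span: "vec.span (?E c) = ?E c" by simp
  have "inj_on T (vec.span (?E c))"
    unfolding span
  proof (rule inj_onI)
    fix y y' assume yy: "y \<in> ?E c" "y' \<in> ?E c" "T y = T y'"
    let ?z = "y - y'"
    have "\<tau> (proj_along M Vp ?z - ?z) = \<tau> 0"
      using yy(3) clin_diff[OF linT, of y y'] clin_0[OF \<tau>(1)] unfolding T_def by simp
    then have "proj_along M Vp ?z = ?z" using \<tau>(2) by (simp add: inj_eq)
    then have "?z \<in> M" using proj_along(1)[OF cM, of ?z] by simp
    moreover have "?z \<in> Vm" using ex(2) yy SVm by (blast intro: vec.subspace_diff)
    ultimately have "?z = 0" using lagrangian_complementary(1)[OF sp M] unfolding complementary_def by blast
    then show "y = y'" by simp
  qed
  then have "vec.dim (?E c) = vec.dim (T ` ?E c)" by (simp add: vec.dim_image_eq[OF linT])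
  also have "\<dots> \<le> vec.dim (?E (cnj c))" by (rule vec.dim_subset[OF im])
  finally show ?thesis .
qed

end

section \<open>Transforming a path by symplectic maps\<close>

lemma flow_constant:
  assumes "flow good d a b m" "\<And>e s t. d e s = d e t"
  shows "m = 0"
  using assms(1)
proof (induction rule: flow.induct)
  case (flow_step a b m c e)
  then show ?case using assms(2)[of e c b] by simp
qed simp

context symplectic_form
begin

lemma maslov_flow_symmetric:
  fixes A B :: "real \<Rightarrow> complex ^ 'm \<Rightarrow> complex ^ 'm"
  assumes fA: "cfam A" "\<And>t. bij (A t)" "\<And>t. lagrangian (A t ` la)"
    and fB: "cfam B" "\<And>t. bij (B t)" "\<And>t. lagrangian (B t ` mu)"
    and sp: "symplectic_splitting w Vp Vm"
    and \<tau>: "clin \<tau>" "inj \<tau>" "\<tau> ` Vp \<subseteq> Vm" "\<tau> ` Vm \<subseteq> Vp"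
      "\<And>t. \<tau> ` A t ` la \<subseteq> A t ` la" "\<And>t. \<tau> ` B t ` mu \<subseteq> B t ` mu"
    and m: "maslov_flow (\<lambda>t. Vp) (\<lambda>t. Vm) (\<lambda>t. A t ` la) (\<lambda>t. B t ` mu) a b m"
  shows "2 * m = int (vec.dim (A a ` la \<inter> B a ` mu)) - int (vec.dim (A b ` la \<inter> B b ` mu))"
proof -
  interpret symplectic_family w "\<lambda>_ v. v" A B Vp Vm la mu by (rule const_family[OF fA fB sp])
  have le: "vec.dim (eigenspace_on Vm (op t) c) \<le> vec.dim (eigenspace_on Vm (op t) (cnj c))" for t c
    using dim_eigenspace_cnj_le[OF sp fA(3)[of t] fB(3)[of t] \<tau>(1-4) \<tau>(5)[of t] \<tau>(6)[of t], of c]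
      pair_op_transfer(1)[of t c] pair_op_transfer(1)[of t "cnj c"] by simp
  have "pflow (\<lambda>t. t) a b m" using m unfolding pflow_iff_maslov_flow by simp
  then have "2 * m = int (vec.dim (eigenspace_on Vm (op a) 1)) - int (vec.dim (eigenspace_on Vm (op b) 1))"
  proof (rule symmetric_flow)
    show "vec.dim (eigenspace_on Vm (op t) (cnj c)) = vec.dim (eigenspace_on Vm (op t) c)" for t c
      using le[of t c] le[of t "cnj c"] by simp
  qed simp
  then show ?thesis unfolding dim_kernel .
qed

text \<open>
  On the interval from \<open>- T\<close> to \<open>T\<close> two paths of pairs are compared, where \<open>B q\<close> stands for
  \<open>S(\<beta>)\<^sup>-\<^sup>1 S(T)\<close>. For \<open>s = 0\<close> the path rests until time 0 and then is the image of the transformed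
  pair under \<open>S(t)\<^sup>-\<^sup>1\<close>. For \<open>s = 1\<close> the subspace \<open>W\<close> moves before time 0, against the fixed
  \<open>A 0 ` la\<close>, and rests afterwards. The splitting moves with \<open>S(\<alpha>)\<^sup>-\<^sup>1 S(0)\<close>, so that it starts at the
  symmetric splitting and, for \<open>s = 1\<close>, stays there.
\<close>
theorem maslov_index_difference:
  fixes S A :: "real \<Rightarrow> complex ^ 'm \<Rightarrow> complex ^ 'm"
  assumes T: "0 \<le> T"
    and S: "cfam S" "\<And>t. bij (S t)" "\<And>t x y. w (S t x) (S t y) = w x y"
    and A: "cfam A" "\<And>t. bij (A t)" "\<And>t. lagrangian (A t ` la)"
    and W: "lagrangian W"
    and sp: "symplectic_splitting w Vp Vm"
    and \<tau>: "clin \<tau>" "inj \<tau>" "\<tau> ` Vp \<subseteq> Vm" "\<tau> ` Vm \<subseteq> Vp" "\<tau> ` A 0 ` la \<subseteq> A 0 ` la" "\<tau> ` W \<subseteq> W"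
      "\<And>t v. \<tau> (S t v) = S t (\<tau> v)"
  shows "2 * (Mas w (\<lambda>t. S t ` A t ` la) (\<lambda>t. S T ` W) 0 T - Mas w (\<lambda>t. A t ` la) (\<lambda>t. W) 0 T)
    = int (vec.dim (S 0 ` A 0 ` la \<inter> S T ` W)) - int (vec.dim (A 0 ` la \<inter> W))"
proof -
  define R where "R t = inv (S t)" for t
  have RS: "R t (S t v) = v" for t v unfolding R_def using S(2)[of t] by (simp add: bij_is_inj)
  have SR: "S t (R t v) = v" for t v unfolding R_def using S(2)[of t] by (simp add: bij_is_surj surj_f_inv_f)
  have cR: "cfam R" unfolding R_def by (rule cfam_inv[OF S(1,2)])
  have bR: "bij (R t)" for t unfolding R_def by (rule bij_imp_bij_inv[OF S(2)])
  have wR: "w (R t x) (R t y) = w x y" for t x y using S(3)[of t "R t x" "R t y"] SR by simp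
  have \<tau>R: "\<tau> (R t v) = R t (\<tau> v)" for t v
    using \<tau>(7)[of t "R t v"] RS[of t "\<tau> (R t v)"] SR[of t v] by simp
  define \<alpha> where "\<alpha> q = (1 - fst q) * max (snd q) 0" for q :: "real \<times> real"
  define \<beta> where "\<beta> q = (1 - fst q) * max (snd q) 0 + fst q * min (snd q + T) T" for q :: "real \<times> real"
  define G where "G q v = R (\<alpha> q) (S 0 v)" for q v
  define A' where "A' q = A (max (snd q) 0)" for q :: "real \<times> real"
  define B where "B q v = R (\<beta> q) (S T v)" for q v
  have c\<alpha>: "continuous_on UNIV \<alpha>" and c\<beta>: "continuous_on UNIV \<beta>"
    unfolding \<alpha>_def \<beta>_def by (intro continuous_intros)+
  note cS0 = cfam_const[OF cfam_clin[OF S(1)]]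
  have fG: "cfam G" unfolding G_def by (rule cfam_compose[OF cfam_reparam[OF cR c\<alpha>] cS0])
  have fB: "cfam B" unfolding B_def by (rule cfam_compose[OF cfam_reparam[OF cR c\<beta>] cS0])
  have fA': "cfam A'" unfolding A'_def by (rule cfam_reparam[OF A(1)]) (intro continuous_intros)
  have bG: "bij (G q)" for q unfolding G_def using bij_comp[OF S(2) bR] by (simp add: o_def)
  have bB: "bij (B q)" for q unfolding B_def using bij_comp[OF S(2) bR] by (simp add: o_def)
  have lG: "clin (G q)" for q by (rule cfam_clin[OF fG])
  have spG: "symplectic_splitting w (G q ` Vp) (G q ` Vm)" for q
    by (rule splitting_image[OF lG bG _ sp]) (simp add: G_def S(3) wR)
  have lagB: "lagrangian (B q ` W)" for q
    by (rule lagrangian_image[OF bB _ W]) (simp add: B_def S(3) wR)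
  have lagA': "lagrangian (A' q ` la)" for q unfolding A'_def by (rule A(3))
  have fam: "symplectic_family w G A' B Vp Vm la W"
  proof unfold_locales
    show "bij (A' q)" for q unfolding A'_def by (rule A(2))
  qed (rule fG fA' fB bG bB spG lagA' lagB)+
  interpret fam: symplectic_family w G A' B Vp Vm la W by (rule fam)
  have vertical: "continuous_on UNIV (\<lambda>t. (s, t))" for s :: real by (intro continuous_intros)

  \<comment> \<open>the resting part before time 0 contributes nothing\<close>
  obtain m1 where m1: "fam.pflow (\<lambda>t. (0, t)) 0 T m1"
    using fam.flow_exists[OF T vertical] by blast
  obtain m0 where m0: "fam.pflow (\<lambda>t. (0, t)) (- T) 0 m0"
    using fam.flow_exists[OF _ vertical, of "- T" 0] T by auto
  have "maslov_flow (\<lambda>t. G (0, 0) ` Vp) (\<lambda>t. G (0, 0) ` Vm) (\<lambda>t. A' (0, 0) ` la) (\<lambda>t. B (0, 0) ` W) (- T) 0 m0"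
    by (rule maslov_flow_cong[OF m0[unfolded fam.pflow_iff_maslov_flow]])
      (simp_all add: G_def A'_def B_def \<alpha>_def \<beta>_def)
  then have "m0 = 0" unfolding maslov_flow_def by (rule flow_constant) (rule refl)
  with flow_trans[OF m1 m0] have "fam.pflow (\<lambda>t. (0, t)) (- T) T m1" by simp
  then have deformed: "fam.pflow (\<lambda>t. (1, t)) (- T) T m1"
    unfolding fam.pflow_iff_maslov_flow
  proof (rule maslov_flow_homotopy[OF fam _ _, rotated 2])
    show "vec.dim (A' (s, - T) ` la \<inter> B (s, - T) ` W) = vec.dim (A' (0, - T) ` la \<inter> B (0, - T) ` W)" for s
      using T by (simp add: A'_def B_def \<beta>_def max_def)
    show "vec.dim (A' (s, T) ` la \<inter> B (s, T) ` W) = vec.dim (A' (0, T) ` la \<inter> B (0, T) ` W)" for s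
      using T by (simp add: A'_def B_def \<beta>_def max_def algebra_simps)
  qed
  obtain ma mb where ma: "fam.pflow (\<lambda>t. (1, t)) (- T) 0 ma" and mb: "fam.pflow (\<lambda>t. (1, t)) 0 T mb"
    and m1_eq: "m1 = ma + mb"
    using flow_split[OF deformed, of 0] T by auto

  have "Mas w (\<lambda>t. A t ` la) (\<lambda>t. W) 0 T = mb"
  proof (rule Mas_eq[OF A cfam_const[OF clin_id] _ _ refl _ sp])
    show "bij (\<lambda>v :: complex ^ 'm. v)" by (rule bij_id[unfolded id_def])
    show "lagrangian ((\<lambda>v. v) ` W)" using W by simp
    show "maslov_flow (\<lambda>t. Vp) (\<lambda>t. Vm) (\<lambda>t. A t ` la) (\<lambda>t. (\<lambda>v. v) ` W) 0 T mb"
      by (rule maslov_flow_cong[OF mb[unfolded fam.pflow_iff_maslov_flow]])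
        (use T in \<open>simp_all add: G_def A'_def B_def \<alpha>_def \<beta>_def RS max_def min_def\<close>)
  qed simp
  moreover have "Mas w (\<lambda>t. S t ` A t ` la) (\<lambda>t. S T ` W) 0 T = m1"
  proof (rule Mas_eq[where A = "\<lambda>t v. S t (A t v)" and B = "\<lambda>t. S T" and la = la and mu = W
        and Vp = "S 0 ` Vp" and Vm = "S 0 ` Vm"])
    show "cfam (\<lambda>t v. S t (A t v))" by (rule cfam_compose[OF S(1) A(1)])
    show "bij (\<lambda>v. S t (A t v))" for t using bij_comp[OF A(2) S(2)] by (simp add: o_def)
    show "lagrangian ((\<lambda>v. S t (A t v)) ` la)" for t
      using lagrangian_image[OF S(2,3) A(3), of t t] by (simp add: image_image)
    show "cfam (\<lambda>t :: real. S T)" by (rule cS0)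
    show "bij (S T)" by (rule S(2))
    show "lagrangian (S T ` W)" by (rule lagrangian_image[OF S(2,3) W])
    show "symplectic_splitting w (S 0 ` Vp) (S 0 ` Vm)"
      by (rule splitting_image[OF cfam_clin[OF S(1)] S(2,3) sp])
    have "maslov_flow (\<lambda>t. S t ` G (0, t) ` Vp) (\<lambda>t. S t ` G (0, t) ` Vm) (\<lambda>t. S t ` A' (0, t) ` la)
        (\<lambda>t. S t ` B (0, t) ` W) 0 T m1"
      by (rule maslov_flow_image[OF m1[unfolded fam.pflow_iff_maslov_flow] cfam_clin[OF S(1)] S(2,3)])
        (rule spG lagA' lagB)+
    then show "maslov_flow (\<lambda>t. S 0 ` Vp) (\<lambda>t. S 0 ` Vm) (\<lambda>t. (\<lambda>v. S t (A t v)) ` la) (\<lambda>t. S T ` W) 0 T m1"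
      by (rule maslov_flow_cong)
        (simp_all add: G_def A'_def B_def \<alpha>_def \<beta>_def SR image_image)
  qed (simp_all add: image_image)
  moreover have "2 * ma = int (vec.dim (A 0 ` la \<inter> B (0, 0) ` W)) - int (vec.dim (A 0 ` la \<inter> W))"
  proof -
    define B' where "B' t v = R (min (t + T) T) (S T v)" for t v
    have "cfam B'" unfolding B'_def
      by (rule cfam_compose[OF cfam_reparam[OF cR] cS0]) (intro continuous_intros)
    moreover have "bij (B' t)" for t unfolding B'_def using bij_comp[OF S(2) bR] by (simp add: o_def)
    moreover have "lagrangian (B' t ` W)" for t
      by (rule lagrangian_image[OF _ _ W]) (simp_all add: \<open>\<And>t. bij (B' t)\<close> B'_def S(3) wR)
    moreover have "\<tau> ` B' t ` W \<subseteq> B' t ` W" for t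
    proof -
      have "\<tau> (B' t v) = B' t (\<tau> v)" for v unfolding B'_def by (simp add: \<tau>R \<tau>(7))
      then show ?thesis using \<tau>(6) by (auto simp: image_subset_iff)
    qed
    moreover have "maslov_flow (\<lambda>t. Vp) (\<lambda>t. Vm) (\<lambda>t. A 0 ` la) (\<lambda>t. B' t ` W) (- T) 0 ma"
      by (rule maslov_flow_cong[OF ma[unfolded fam.pflow_iff_maslov_flow]])
        (simp_all add: G_def A'_def B_def B'_def \<alpha>_def \<beta>_def RS max_def)
    ultimately have "2 * ma = int (vec.dim (A 0 ` la \<inter> B' (- T) ` W)) - int (vec.dim (A 0 ` la \<inter> B' 0 ` W))"
      by (intro maslov_flow_symmetric[where A = "\<lambda>t. A 0" and B = B' and la = la and mu = W,
            OF cfam_const[OF cfam_clin[OF A(1)]] A(2,3) _ _ _ sp \<tau>(1-5)])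
    moreover have "B' (- T) ` W = B (0, 0) ` W" "B' 0 ` W = W"
      using T unfolding B'_def B_def \<beta>_def by (simp_all add: RS)
    ultimately show ?thesis by simp
  qed
  moreover have "vec.dim (A 0 ` la \<inter> B (0, 0) ` W) = vec.dim (S 0 ` A 0 ` la \<inter> S T ` W)"
  proof -
    have "S 0 ` (A 0 ` la \<inter> B (0, 0) ` W) = S 0 ` A 0 ` la \<inter> S T ` W"
      unfolding image_Int[OF bij_is_inj[OF S(2)]] by (simp add: B_def \<beta>_def image_image SR)
    moreover have "vec.dim (S 0 ` (A 0 ` la \<inter> B (0, 0) ` W)) = vec.dim (A 0 ` la \<inter> B (0, 0) ` W)"
      by (rule vec.dim_image_eq[OF cfam_clin[OF S(1)]])
        (rule inj_on_subset[OF bij_is_inj[OF S(2)] subset_UNIV])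
    ultimately show ?thesis by simp
  qed
  ultimately show ?thesis using m1_eq by simp
qed

end

lemma Mas_cong:
  assumes "\<And>t. a \<le> t \<Longrightarrow> t \<le> b \<Longrightarrow> L t = L' t" "\<And>t. a \<le> t \<Longrightarrow> t \<le> b \<Longrightarrow> M t = M' t"
  shows "Mas w L M a b = Mas w L' M' a b"
proof -
  have "maslov_value w L M a b m \<longleftrightarrow> maslov_value w L' M' a b m" for m
    unfolding maslov_value_iff_flow
    by (intro ex_cong1 conj_cong refl iffI; erule flow_cong) (simp_all add: assms)
  then have "maslov_value w L M a b = maslov_value w L' M' a b" by (rule ext)
  then show ?thesis unfolding Mas_def by simp
qed

section \<open>Pairs of vectors and the Hermitian form\<close>

lemma vpair_simps [simp]: "vfst (vpair x y) = x" "vsnd (vpair x y) = y" "vpair (vfst v) (vsnd v) = v"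
  by (simp_all add: vpair_def vfst_def vsnd_def vec_eq_iff split: sum.split)

lemma vpair_eq_iff: "vpair x y = vpair x' y' \<longleftrightarrow> x = x' \<and> y = y'"
  by (metis vpair_simps(1,2))

lemma vpair_all: "(\<forall>v. P v) \<longleftrightarrow> (\<forall>x y. P (vpair x y))"
  by (metis vpair_simps(3))

lemma vpair_cases: obtains x y where "v = vpair x y"
  by (metis vpair_simps(3))

lemma vpair_arith:
  fixes x x' :: "complex ^ 'a" and y y' :: "complex ^ 'b"
  shows "vpair x y + vpair x' y' = vpair (x + x') (y + y')"
    and "vpair x y - vpair x' y' = vpair (x - x') (y - y')"
    and "c *s vpair x y = vpair (c *s x) (c *s y)"
    and "- vpair x y = vpair (- x) (- y)"
    and "vpair (0 :: complex ^ 'a) (0 :: complex ^ 'b) = 0"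
  by (simp_all add: vpair_def vec_eq_iff split: sum.split)

lemma clin_vfst: "clin vfst" and clin_vsnd: "clin vsnd"
  by (rule clinI; simp add: vfst_def vsnd_def vec_eq_iff)+

lemma clin_vpair:
  assumes "clin f" "clin g"
  shows "clin (\<lambda>v. vpair (f v) (g v))"
  by (rule clinI) (simp_all add: vpair_arith clin_add[OF assms(1)] clin_add[OF assms(2)]
      clin_scale[OF assms(1)] clin_scale[OF assms(2)])

lemma clin_matrix: "clin ((*v) A)"
  by (rule clinI) (simp_all add: matrix_vector_right_distrib vector_scalar_commute)

lemma clin_uminus: "clin uminus"
  by (rule clinI) (simp_all add: vec_eq_iff)

lemma clin_zero: "clin (\<lambda>v. 0)"
  by (rule clinI) simp_all

lemma cfam_vpair:
  assumes "cfam F" "cfam G"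
  shows "cfam (\<lambda>x v. vpair (F x v) (G x v))"
proof -
  have "cfam (\<lambda>x v. vpair (F x v) 0 + vpair 0 (G x v))"
    by (rule cfam_add[OF cfam_compose[OF cfam_const[OF clin_vpair[OF clin_id clin_zero]] assms(1)]
          cfam_compose[OF cfam_const[OF clin_vpair[OF clin_zero clin_id]] assms(2)]])
  then show ?thesis by (simp add: vpair_arith)
qed

lemma cfam_matrix:
  fixes M :: "'x::topological_space \<Rightarrow> complex ^ 'a ^ 'b"
  assumes "continuous_on UNIV M"
  shows "cfam (\<lambda>x. (*v) (M x))"
  unfolding cfam_def
proof (intro conjI allI clin_matrix)
  have "continuous_on UNIV (\<lambda>p :: 'x \<times> (complex ^ 'a). M (fst p))"
    by (rule continuous_on_compose2[OF assms]) (auto intro!: continuous_intros)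
  then show "continuous_on UNIV (\<lambda>p :: 'x \<times> (complex ^ 'a). M (fst p) *v snd p)"
    unfolding matrix_vector_mult_def by (intro continuous_intros)
qed

lemma herm_sym: "herm y x = cnj (herm x y)"
  by (simp add: herm_def mult.commute)

lemma herm_add1: "herm (x + y) z = herm x z + herm y z"
  by (simp add: herm_def sum.distrib distrib_right)

lemma herm_scale1: "herm (c *s x) z = c * herm x z"
  by (simp add: herm_def sum_distrib_left mult.assoc)

lemma herm_minus1: "herm (- x) z = - herm x z"
  by (simp add: herm_def sum_negf)

lemma herm_diff1: "herm (x - y) z = herm x z - herm y z"
  by (simp add: herm_def sum_subtractf left_diff_distrib)

lemma herm_zero1: "herm 0 z = 0"
  by (simp add: herm_def)

lemma herm_add2: "herm x (y + z) = herm x y + herm x z"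
  by (simp add: herm_def sum.distrib distrib_left)

lemma herm_scale2: "herm x (c *s z) = cnj c * herm x z"
  by (simp add: herm_def sum_distrib_left mult.left_commute)

lemma herm_minus2: "herm x (- z) = - herm x z"
  by (simp add: herm_def sum_negf)

lemma herm_diff2: "herm x (y - z) = herm x y - herm x z"
  by (simp add: herm_def sum_subtractf right_diff_distrib)

lemma herm_zero2: "herm x 0 = 0"
  by (simp add: herm_def)

lemmas herm_linear = herm_add1 herm_scale1 herm_minus1 herm_diff1 herm_zero1
  herm_add2 herm_scale2 herm_minus2 herm_diff2 herm_zero2

lemma sum_over_sum_type:
  "(\<Sum>i\<in>UNIV. f i) = (\<Sum>i\<in>UNIV. f (Inl i)) + (\<Sum>i\<in>UNIV. f (Inr i))"
  for f :: "'a::finite + 'b::finite \<Rightarrow> 'c::comm_monoid_add"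
  using sum.Plus[of "UNIV :: 'a set" "UNIV :: 'b set" f] by (simp add: UNIV_Plus_UNIV)

lemma herm_vpair: "herm (vpair a b) (vpair c d) = herm a c + herm b d"
  by (simp add: herm_def vpair_def sum_over_sum_type)

lemma inner_eq_Re_herm: "x \<bullet> y = Re (herm x y)"
  by (simp add: inner_vec_def herm_def inner_complex_def)

lemma herm_eq_0: "herm x x = 0 \<Longrightarrow> x = 0"
  using inner_eq_zero_iff[of x] inner_eq_Re_herm[of x x] by simp

lemma herm_ctranspose: "herm (A *v x) y = herm x (ctranspose A *v y)"
proof -
  have "herm (A *v x) y = (\<Sum>i\<in>UNIV. \<Sum>j\<in>UNIV. A $ i $ j * x $ j * cnj (y $ i))"
    by (simp add: herm_def matrix_vector_mult_def sum_distrib_right)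
  also have "\<dots> = (\<Sum>j\<in>UNIV. \<Sum>i\<in>UNIV. A $ i $ j * x $ j * cnj (y $ i))"
    by (rule sum.swap)
  also have "\<dots> = herm x (ctranspose A *v y)"
    by (simp add: herm_def matrix_vector_mult_def ctranspose_def sum_distrib_left ac_simps)
  finally show ?thesis .
qed

lemma ctranspose_ctranspose: "ctranspose (ctranspose A) = A"
  by (simp add: ctranspose_def vec_eq_iff)

lemma herm_ctranspose': "herm (ctranspose A *v x) y = herm x (A *v y)"
  using herm_ctranspose[of "ctranspose A"] by (simp add: ctranspose_ctranspose)

definition hperp :: "(complex ^ 'm) set \<Rightarrow> (complex ^ 'm) set" where
  "hperp U = {x. \<forall>y\<in>U. herm x y = 0}"

lemma hperp_complementary:
  assumes U: "vec.subspace U"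
  shows "complementary U (hperp U)"
  unfolding complementary_def
proof (intro conjI allI)
  show "vec.subspace U" by fact
  show "vec.subspace (hperp U)"
    unfolding hperp_def by (rule vec.subspaceI) (simp_all add: herm_linear)
  show "U \<inter> hperp U = {0}"
    using herm_eq_0 vec.subspace_0[OF U] unfolding hperp_def by (auto simp: herm_linear)
  fix v
  have spanU: "span U = U"
    by (rule span_eq_iff[THEN iffD2, OF vec_subspace_imp_subspace[OF U]])
  obtain y z where yz: "y \<in> span U" "\<And>u. u \<in> span U \<Longrightarrow> orthogonal z u" "v = y + z"
    by (rule orthogonal_subspace_decomp_exists[of U v]) (rule that; assumption)
  have re: "Re (herm z u) = 0" if "u \<in> U" for u
    using yz(2)[of u] that unfolding spanU orthogonal_def inner_eq_Re_herm by blast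
  have "herm z u = 0" if u: "u \<in> U" for u
  proof -
    have "Re (herm z (\<i> *s u)) = 0" by (rule re[OF vec.subspace_scale[OF U u]])
    then have "Im (herm z u) = 0" by (simp add: herm_linear)
    then show ?thesis using re[OF u] by (simp add: complex_eq_iff)
  qed
  then have "z \<in> hperp U" unfolding hperp_def by blast
  then show "\<exists>u\<in>U. \<exists>w\<in>hperp U. v = u + w" using yz(1,3) unfolding spanU by blast
qed

lemma hperp_subspace: "vec.subspace U \<Longrightarrow> vec.subspace (hperp U)"
  using hperp_complementary unfolding complementary_def by blast

lemma hperp_hperp:
  assumes U: "vec.subspace U"
  shows "hperp (hperp U) = U"
proof (intro equalityI subsetI)
  fix x assume x: "x \<in> hperp (hperp U)"
  obtain u z where uz: "u \<in> U" "z \<in> hperp U" "x = u + z"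
    using hperp_complementary[OF U] unfolding complementary_def by blast
  have "herm x z = 0" using x uz(2) unfolding hperp_def by blast
  moreover have "herm u z = 0" using uz(1,2) herm_sym[of u z] unfolding hperp_def by simp
  ultimately have "herm z z = 0" unfolding uz(3) by (simp add: herm_linear)
  then have "z = 0" by (rule herm_eq_0)
  then show "x \<in> U" using uz by simp
next
  fix x assume "x \<in> U"
  then show "x \<in> hperp (hperp U)" unfolding hperp_def using herm_sym[of x] by simp
qed

lemma dim_hperp:
  fixes U :: "(complex ^ 'm) set"
  assumes U: "vec.subspace U"
  shows "vec.dim U + vec.dim (hperp U) = CARD('m)"
proof -
  note c = hperp_complementary[OF U, unfolded complementary_def]
  have "{x + y | x y. x \<in> U \<and> y \<in> hperp U} = UNIV" using c by blast
  then have "vec.dim (UNIV :: (complex ^ 'm) set) + vec.dim (U \<inter> hperp U) = vec.dim U + vec.dim (hperp U)"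
    using vec.dim_sums_Int[of U "hperp U"] c by simp
  moreover have "vec.dim (U \<inter> hperp U) = 0" using c by simp
  ultimately show ?thesis unfolding vec_dim_card by linarith
qed

section \<open>The standard splitting and the symmetry\<close>

lemma symplectic_form_of_involution:
  fixes K :: "complex ^ 'm \<Rightarrow> complex ^ 'm"
  assumes K: "clin K" "\<And>v. K (K v) = v" "\<And>x y. herm (K x) y = herm x (K y)"
  shows "symplectic_form (\<lambda>x y. \<i> * herm (K x) y)"
    and "symplectic_splitting (\<lambda>x y. \<i> * herm (K x) y) {v. K v = v} {v. K v = - v}"
proof -
  have "continuous_on UNIV K"
    by (intro linear_continuous_on linear_conv_bounded_linear[THEN iffD1] clin_imp_linear K)
  then have Kc: "continuous_on UNIV (\<lambda>p :: (complex ^ 'm) \<times> (complex ^ 'm). K (fst p))"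
    by (rule continuous_on_compose2) (auto intro!: continuous_intros)
  show "symplectic_form (\<lambda>x y. \<i> * herm (K x) y)"
  proof
    show "\<i> * herm (K y) x = - cnj (\<i> * herm (K x) y)" for x y
      using herm_sym[of x "K y"] K(3)[of x y] herm_sym[of "K y" x] by simp
    show "continuous_on UNIV (\<lambda>p. \<i> * herm (K (fst p)) (snd p))"
      unfolding herm_def by (intro continuous_intros Kc)
    fix U :: "(complex ^ 'm) set" assume U: "vec.subspace U" "U \<noteq> UNIV"
    have "hperp U \<noteq> {0}"
    proof
      assume "hperp U = {0}"
      then have "\<And>v. v \<in> U" using hperp_complementary[OF U(1)] unfolding complementary_def by fastforce
      then show False using U(2) by blast
    qed
    moreover have "0 \<in> hperp U" unfolding hperp_def by (simp add: herm_linear)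
    ultimately obtain x where x: "x \<in> hperp U" "x \<noteq> 0" by blast
    have "K x \<noteq> 0" using K(2)[of x] clin_0[OF K(1)] x(2) by auto
    moreover have "\<forall>y\<in>U. \<i> * herm (K (K x)) y = 0" using x(1) unfolding K(2) hperp_def by simp
    ultimately show "\<exists>x. x \<noteq> 0 \<and> (\<forall>y\<in>U. \<i> * herm (K x) y = 0)" by blast
  qed (simp_all add: clin_add[OF K(1)] clin_scale[OF K(1)] herm_linear algebra_simps)
  have pos: "0 < Re (herm x x)" if "x \<noteq> 0" for x :: "complex ^ 'm"
    using that inner_gt_zero_iff[of x] inner_eq_Re_herm[of x x] by simp
  show "symplectic_splitting (\<lambda>x y. \<i> * herm (K x) y) {v. K v = v} {v. K v = - v}"
    unfolding symplectic_splitting_def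
  proof (intro conjI)
    show "vec.subspace {v. K v = v}" "vec.subspace {v. K v = - v}"
      by (rule vec.subspaceI; simp add: clin_0[OF K(1)] clin_add[OF K(1)] clin_scale[OF K(1)])+
    show "{v. K v = v} \<inter> {v. K v = - v} = {0}"
    proof (intro equalityI subsetI)
      fix v assume "v \<in> {v. K v = v} \<inter> {v. K v = - v}"
      then have "K v = v" "K v = - v" by auto
      then have "v $ i = - (v $ i)" for i by (metis vector_uminus_component)
      then show "v \<in> {0}" by (simp add: vec_eq_iff)
    qed (simp add: clin_0[OF K(1)])
    show "\<forall>v. \<exists>x\<in>{v. K v = v}. \<exists>y\<in>{v. K v = - v}. v = x + y"
    proof
      fix v
      let ?x = "(1 / 2) *s (v + K v)" and ?y = "(1 / 2) *s (v - K v)"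
      have "K ?x = ?x" "K ?y = - ?y"
        by (simp_all add: clin_add[OF K(1)] clin_diff[OF K(1)] clin_scale[OF K(1)] K(2) vec_eq_iff)
      moreover have "v = ?x + ?y" by (simp add: vec_eq_iff field_simps)
      ultimately show "\<exists>x\<in>{v. K v = v}. \<exists>y\<in>{v. K v = - v}. v = x + y" by blast
    qed
    show "\<forall>x\<in>{v. K v = v}. \<forall>y\<in>{v. K v = - v}. \<i> * herm (K x) y = 0"
    proof (intro ballI)
      fix x y assume "x \<in> {v. K v = v}" "y \<in> {v. K v = - v}"
      then have "herm x y = - herm x y" using K(3)[of x y] by (simp add: herm_linear)
      then show "\<i> * herm (K x) y = 0" using \<open>x \<in> _\<close> by simp
    qed
  qed (use pos in \<open>simp_all add: herm_linear\<close>)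
qed

lemma block_mat_vpair: "block_mat A B C D *v vpair x y = vpair (A *v x + B *v y) (C *v x + D *v y)"
  by (simp add: vec_eq_iff block_mat_def vpair_def matrix_vector_mult_def
      sum_over_sum_type split: sum.split)

lemma J2_vpair: "J2 *v vpair x y = vpair (- y) x" for x y :: "complex ^ 'n"
proof -
  have "(- A) *v y = - (A *v y)" for A :: "complex ^ 'n ^ 'n"
    by (simp add: vec_eq_iff matrix_vector_mult_def sum_negf)
  then show ?thesis unfolding J2_def block_mat_vpair by simp
qed

lemma omega_vpair: "omega (vpair x1 x2) (vpair y1 y2) = herm x1 y2 - herm x2 y1"
  by (simp add: omega_def J2_vpair herm_vpair herm_linear)

text \<open>
  The selfadjoint involution whose eigenspaces for \<open>1\<close> and \<open>- 1\<close> are the positive and the negative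
  space of the standard splitting.
\<close>
definition polarity :: "complex ^ (('n::finite + 'n) + ('n + 'n)) \<Rightarrow> complex ^ (('n + 'n) + ('n + 'n))" where
  "polarity v = vpair (\<i> *s (J2 *v vfst v)) (- \<i> *s (J2 *v vsnd v))"

lemma J2_J2: "J2 *v (J2 *v u) = - u"
  by (rule vpair_cases[of u]) (simp add: J2_vpair vpair_arith)

lemma J2_skew: "herm (J2 *v x) y = - herm x (J2 *v y)"
  by (rule vpair_cases[of x], rule vpair_cases[of y]) (simp add: J2_vpair herm_vpair herm_linear)

lemma polarity:
  "clin polarity" "polarity (polarity v) = v" "herm (polarity x) y = herm x (polarity y)"
  "omega_sum x y = \<i> * herm (polarity x) y"
proof -
  show "clin polarity" unfolding polarity_def
    by (rule clin_vpair[OF clin_smult[OF clin_compose[OF clin_matrix clin_vfst]]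
          clin_smult[OF clin_compose[OF clin_matrix clin_vsnd]]])
  show "polarity (polarity v) = v"
    by (simp add: polarity_def clin_neg[OF clin_matrix] clin_scale[OF clin_matrix] J2_J2 vector_smult_assoc
        vec.scale_minus_right)
  show "herm (polarity x) y = herm x (polarity y)"
    by (rule vpair_cases[of x], rule vpair_cases[of y])
      (simp add: polarity_def herm_vpair herm_linear J2_skew)
  show "omega_sum x y = \<i> * herm (polarity x) y"
    by (rule vpair_cases[of x], rule vpair_cases[of y])
      (simp add: polarity_def omega_sum_def omega_def herm_vpair herm_linear algebra_simps)
qed

lemma omega_sum_eq: "omega_sum = (\<lambda>x y. \<i> * herm (polarity x) y)"
  by (intro ext polarity(4))

interpretation omega_sum: symplectic_form omega_sum
  unfolding omega_sum_eq by (rule symplectic_form_of_involution(1)[OF polarity(1-3)])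

lemma standard_splitting: "symplectic_splitting omega_sum {v. polarity v = v} {v. polarity v = - v}"
  unfolding omega_sum_eq by (rule symplectic_form_of_involution(2)[OF polarity(1-3)])

abbreviation pair_map :: "(complex ^ 'a \<Rightarrow> complex ^ 'c) \<Rightarrow> (complex ^ 'b \<Rightarrow> complex ^ 'd)
    \<Rightarrow> complex ^ ('a + 'b) \<Rightarrow> complex ^ ('c + 'd)" where
  "pair_map f g v \<equiv> vpair (f (vfst v)) (g (vsnd v))"

lemma clin_pair_map: "clin f \<Longrightarrow> clin g \<Longrightarrow> clin (pair_map f g)"
  by (rule clin_vpair[OF clin_compose[OF _ clin_vfst] clin_compose[OF _ clin_vsnd]])

lemma cfam_pair_map: "cfam F \<Longrightarrow> cfam G \<Longrightarrow> cfam (\<lambda>x. pair_map (F x) (G x))"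
  by (rule cfam_vpair[OF cfam_compose[OF _ cfam_const[OF clin_vfst]] cfam_compose[OF _ cfam_const[OF clin_vsnd]]])

lemma bij_pair_map:
  fixes f :: "complex ^ 'a \<Rightarrow> complex ^ 'a" and g :: "complex ^ 'b \<Rightarrow> complex ^ 'b"
  assumes "bij f" "bij g"
  shows "bij (pair_map f g)"
proof (rule bij_betw_byWitness[where f' = "pair_map (inv f) (inv g)"])
  show "\<forall>v\<in>UNIV. pair_map (inv f) (inv g) (pair_map f g v) = v"
    using assms by (simp add: bij_is_inj)
  show "\<forall>v\<in>UNIV. pair_map f g (pair_map (inv f) (inv g) v) = v"
    using assms by (simp add: bij_is_surj surj_f_inv_f)
qed auto

lemma bij_matrix:
  fixes M :: "complex ^ 'a ^ 'a"
  assumes "invertible M"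
  shows "bij ((*v) M)" "inv ((*v) M) = (*v) (matrix_inv M)"
proof -
  have M: "M ** matrix_inv M = mat 1" "matrix_inv M ** M = mat 1"
    using assms unfolding invertible_def matrix_inv_def by (metis (mono_tags, lifting) someI_ex)+
  show b: "bij ((*v) M)"
    by (rule bij_betw_byWitness[where f' = "(*v) (matrix_inv M)"])
      (simp_all add: matrix_vector_mul_assoc M)
  show "inv ((*v) M) = (*v) (matrix_inv M)"
    by (rule inv_equality) (simp_all add: matrix_vector_mul_assoc M)
qed

lemma matrix_inv_vector:
  fixes M :: "complex ^ 'a ^ 'a"
  assumes "invertible M"
  shows "M *v (matrix_inv M *v v) = v" "matrix_inv M *v (M *v v) = v"
proof -
  note b = bij_matrix[OF assms]
  show "M *v (matrix_inv M *v v) = v"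
    using surj_f_inv_f[OF bij_is_surj[OF b(1)], of v] unfolding b(2) .
  show "matrix_inv M *v (M *v v) = v"
    using inv_f_f[OF bij_is_inj[OF b(1)], of v] unfolding b(2) .
qed

lemma invertible_ctranspose:
  fixes M :: "complex ^ 'a ^ 'a"
  assumes "invertible M"
  shows "invertible (ctranspose M)"
proof -
  obtain N where N: "M ** N = mat 1" "N ** M = mat 1" using assms unfolding invertible_def by blast
  have mult: "ctranspose (A ** B) = ctranspose B ** ctranspose A" for A B :: "complex ^ 'a ^ 'a"
    by (simp add: ctranspose_def matrix_matrix_mult_def vec_eq_iff mult.commute)
  have one: "ctranspose (mat 1) = (mat 1 :: complex ^ 'a ^ 'a)"
    by (simp add: ctranspose_def mat_def vec_eq_iff)
  have "ctranspose M ** ctranspose N = mat 1" "ctranspose N ** ctranspose M = mat 1"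
    by (simp_all only: mult[symmetric] N one)
  then show ?thesis unfolding invertible_def by blast
qed

lemma continuous_on_ctranspose:
  assumes "continuous_on X M"
  shows "continuous_on X (\<lambda>x. ctranspose (M x))"
  unfolding ctranspose_def by (intro continuous_intros assms)

lemma omega_sum_vpair: "omega_sum (vpair x y) (vpair x' y') = - omega x x' + omega y y'"
  by (simp add: omega_sum_def)

lemma omega_linear:
  "omega (x + y) z = omega x z + omega y z" "omega (x - y) z = omega x z - omega y z"
  "omega 0 z = 0"
  unfolding omega_def by (simp_all add: clin_add[OF clin_matrix] clin_diff[OF clin_matrix] clin_0[OF clin_matrix] herm_linear)

lemma omega_nondegenerate:
  assumes "\<And>z. omega x z = 0"
  shows "x = 0"
proof -
  have "J2 *v x = 0" by (rule herm_eq_0) (use assms[of "J2 *v x"] in \<open>simp add: omega_def\<close>)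
  then show ?thesis using J2_J2[of x] clin_0[OF clin_matrix, of J2] by simp
qed

lemma Gr_iff: "vpair x y \<in> Gr M \<longleftrightarrow> y = M *v x"
  unfolding Gr_def by (auto simp: vpair_eq_iff)

lemma lagrangian_diagonal:
  "omega_sum.lagrangian (Gr (mat 1 :: complex ^ ('n::finite + 'n) ^ ('n + 'n)))"
  unfolding omega_sum.lagrangian_def
proof (intro equalityI subsetI)
  fix v :: "complex ^ (('n + 'n) + ('n + 'n))"
  assume v: "v \<in> Gr (mat 1)"
  obtain x y where "v = vpair x y" by (rule vpair_cases)
  then have v: "v = vpair x x" using v by (simp add: Gr_iff)
  show "v \<in> {v. \<forall>u\<in>Gr (mat 1). omega_sum v u = 0}"
    unfolding v Gr_def by (auto simp: omega_sum_vpair)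
next
  fix v :: "complex ^ (('n + 'n) + ('n + 'n))"
  assume v: "v \<in> {v. \<forall>u\<in>Gr (mat 1). omega_sum v u = 0}"
  obtain x y where xy: "v = vpair x y" by (rule vpair_cases)
  have "omega (y - x) z = 0" for z
  proof -
    have "vpair z z \<in> Gr (mat 1)" by (simp add: Gr_iff)
    then have "omega_sum v (vpair z z) = 0" using v by blast
    then show ?thesis unfolding xy omega_sum_vpair by (simp add: omega_linear)
  qed
  then have "y - x = 0" by (rule omega_nondegenerate)
  then show "v \<in> Gr (mat 1)" unfolding xy by (simp add: Gr_iff)
qed

text \<open>
  An involution that reverses the sign of the symplectic form, so that it exchanges positive and
  negative vectors.
\<close>
definition reflect :: "complex ^ (('n::finite + 'n) + ('n + 'n)) \<Rightarrow> complex ^ (('n + 'n) + ('n + 'n))" where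
  "reflect = pair_map (pair_map (\<lambda>x. x) uminus) (pair_map (\<lambda>x. x) uminus)"

lemma clin_reflect: "clin reflect"
  unfolding reflect_def by (intro clin_pair_map clin_id clin_uminus)

lemma reflect_reflect: "reflect (reflect v) = v"
  unfolding reflect_def by simp

lemma reflect_polarity: "polarity (reflect v) = - reflect (polarity v)"
  for v :: "complex ^ (('n::finite + 'n) + ('n + 'n))"
proof -
  have J: "J2 *v pair_map (\<lambda>x. x) uminus u = - pair_map (\<lambda>x. x) uminus (J2 *v u)" for u :: "complex ^ ('n + 'n)"
    by (rule vpair_cases[of u]) (simp add: J2_vpair vpair_arith)
  have P: "pair_map (\<lambda>x. x) uminus (c *s u) = c *s pair_map (\<lambda>x. x) uminus u" for c and u :: "complex ^ ('n + 'n)"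
    by (rule clin_scale[OF clin_pair_map[OF clin_id clin_uminus]])
  show ?thesis
    unfolding reflect_def polarity_def vpair_simps P J by (simp add: vpair_arith)
qed

lemma reflect_swaps_splitting:
  "reflect ` {v. polarity v = v} \<subseteq> {v. polarity v = - v}" "reflect ` {v. polarity v = - v} \<subseteq> {v. polarity v = v}"
  by (auto simp: reflect_polarity clin_neg[OF clin_reflect])

lemma clin_flip: "clin (pair_map (\<lambda>x. x) uminus)"
  by (rule clin_pair_map[OF clin_id clin_uminus])

section \<open>The subspaces attached to a boundary condition\<close>

lemma ann2b_eq: "ann2b Q = {v. pair_map (\<lambda>x. x) uminus v \<in> hperp Q}"
proof -
  have "vpair x1 x2 \<in> ann2b Q \<longleftrightarrow> vpair x1 (- x2) \<in> hperp Q" for x1 x2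
    unfolding ann2b_def hperp_def Ball_def vpair_all
    by (auto simp: vpair_eq_iff herm_vpair herm_linear)
  then show ?thesis
    by (intro set_eqI) (metis (no_types, lifting) mem_Collect_eq vpair_simps(3))
qed

lemma ann2b_vpair: "vpair x1 x2 \<in> ann2b Q \<longleftrightarrow> (\<forall>y1 y2. vpair y1 y2 \<in> Q \<longrightarrow> herm x1 y1 = herm x2 y2)"
  unfolding ann2b_def by (auto simp: vpair_eq_iff)

lemma ann2b_image: "ann2b Q = pair_map (\<lambda>x. x) uminus ` hperp Q"
proof (intro equalityI subsetI)
  fix v assume "v \<in> ann2b Q"
  then have "pair_map (\<lambda>x. x) uminus v \<in> hperp Q" unfolding ann2b_eq by simp
  moreover have "v = pair_map (\<lambda>x. x) uminus (pair_map (\<lambda>x. x) uminus v)" by simp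
  ultimately show "v \<in> pair_map (\<lambda>x. x) uminus ` hperp Q" by blast
qed (auto simp: ann2b_eq)

lemma ann2b_subspace: "vec.subspace Q \<Longrightarrow> vec.subspace (ann2b Q)"
  unfolding ann2b_image by (rule vec.linear_subspace_image[OF clin_flip hperp_subspace])

lemma inj_flip: "inj (pair_map (\<lambda>x :: complex ^ 'a::finite. x) (uminus :: complex ^ 'b \<Rightarrow> complex ^ 'b::finite))"
  by (rule inj_on_inverseI[where g = "pair_map (\<lambda>x. x) uminus"]) simp

lemma dim_ann2b:
  fixes Q :: "(complex ^ ('n::finite + 'n)) set"
  assumes "vec.subspace Q"
  shows "vec.dim Q + vec.dim (ann2b Q) = 2 * CARD('n)"
proof -
  have "vec.dim (ann2b Q) = vec.dim (hperp Q)"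
    unfolding ann2b_image by (rule vec.dim_image_eq[OF clin_flip inj_on_subset[OF inj_flip subset_UNIV]])
  then show ?thesis using dim_hperp[OF assms] by simp
qed

lemma ann2b_ann2b:
  assumes "vec.subspace Q"
  shows "ann2b (ann2b Q) = Q"
proof (intro equalityI subsetI)
  fix v assume v: "v \<in> ann2b (ann2b Q)"
  have "v \<in> hperp (hperp Q)"
    unfolding hperp_def[of "hperp Q"]
  proof (intro CollectI ballI)
    fix y assume "y \<in> hperp Q"
    then have "pair_map (\<lambda>x. x) uminus y \<in> ann2b Q" unfolding ann2b_image by blast
    then have "herm (pair_map (\<lambda>x. x) uminus v) (pair_map (\<lambda>x. x) uminus y) = 0"
      using v unfolding ann2b_eq[of "ann2b Q"] hperp_def by blast
    then show "herm v y = 0"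
      by (rule_tac vpair_cases[of v], rule_tac vpair_cases[of y]) (simp add: herm_vpair herm_linear)
  qed
  then show "v \<in> Q" unfolding hperp_hperp[OF assms] .
next
  fix v assume v: "v \<in> Q"
  show "v \<in> ann2b (ann2b Q)"
    unfolding ann2b_eq[of "ann2b Q"] hperp_def
  proof (intro CollectI ballI)
    fix y assume "y \<in> ann2b Q"
    then have "herm (pair_map (\<lambda>x. x) uminus y) v = 0" using v unfolding ann2b_eq hperp_def by blast
    then have "herm v (pair_map (\<lambda>x. x) uminus y) = 0" using herm_sym[of v] by simp
    then show "herm (pair_map (\<lambda>x. x) uminus v) y = 0"
      by (rule_tac vpair_cases[of v], rule_tac vpair_cases[of y]) (simp add: herm_vpair herm_linear)
  qed
qed

lemma W2_iff: "vpair (vpair x1 x2) (vpair x3 x4) \<in> W2 Q \<longleftrightarrow> vpair x1 x3 \<in> ann2b Q \<and> vpair x2 x4 \<in> Q"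
  unfolding W2_def by (auto simp: vpair_eq_iff)

text \<open>
  The form pairs the components \<open>(x1, x3)\<close> of one vector with the components \<open>(y2, y4)\<close> of the other, by
  the same indefinite Hermitian form that defines \<open>ann2b\<close>. So the annihilator of \<open>W2 Q\<close> is
  formed from the annihilators of its two parts, and \<open>ann2b (ann2b Q) = Q\<close>.
\<close>
lemma lagrangian_W2:
  fixes Q :: "(complex ^ ('n::finite + 'n)) set"
  assumes Q: "vec.subspace Q"
  shows "omega_sum.lagrangian (W2 Q)"
proof -
  have form: "omega_sum (vpair (vpair x1 x2) (vpair x3 x4)) (vpair (vpair y1 y2) (vpair y3 y4))
      = - (herm x1 y2 - herm x3 y4) + (herm x2 y1 - herm x4 y3)"
    for x1 x2 x3 x4 y1 y2 y3 y4 :: "complex ^ 'n"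
    by (simp add: omega_sum_vpair omega_vpair)
  have ann: "vpair x1 x3 \<in> ann2b Q \<Longrightarrow> vpair y2 y4 \<in> Q \<Longrightarrow> herm x1 y2 = herm x3 y4"
    for x1 x3 y2 y4 :: "complex ^ 'n"
    unfolding ann2b_vpair by blast
  show ?thesis unfolding omega_sum.lagrangian_def
  proof (intro equalityI subsetI)
    fix v assume v: "v \<in> W2 Q"
    then obtain x1 x2 x3 x4 where x: "v = vpair (vpair x1 x2) (vpair x3 x4)"
      "vpair x1 x3 \<in> ann2b Q" "vpair x2 x4 \<in> Q"
      unfolding W2_def by blast
    show "v \<in> {v. \<forall>u\<in>W2 Q. omega_sum v u = 0}"
    proof (intro CollectI ballI)
      fix u assume "u \<in> W2 Q"
      then obtain y1 y2 y3 y4 where y: "u = vpair (vpair y1 y2) (vpair y3 y4)"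
        "vpair y1 y3 \<in> ann2b Q" "vpair y2 y4 \<in> Q"
        unfolding W2_def by blast
      have "herm y1 x2 = herm y3 x4" by (rule ann[OF y(2) x(3)])
      then have "herm x2 y1 = herm x4 y3" using herm_sym[of x2 y1] herm_sym[of x4 y3] by simp
      then show "omega_sum v u = 0" unfolding x(1) y(1) form using ann[OF x(2) y(3)] by simp
    qed
  next
    fix v assume v: "v \<in> {v. \<forall>u\<in>W2 Q. omega_sum v u = 0}"
    obtain x1 x2 x3 x4 where x: "v = vpair (vpair x1 x2) (vpair x3 x4)"
      by (rule vpair_cases[of v], rule vpair_cases[of "vfst v"], rule vpair_cases[of "vsnd v"]) simp
    have "vpair x1 x3 \<in> ann2b Q"
      unfolding ann2b_vpair
    proof (intro allI impI)
      fix y2 y4 assume "vpair y2 y4 \<in> Q"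
      then have "vpair (vpair 0 y2) (vpair 0 y4) \<in> W2 Q"
        unfolding W2_iff vpair_arith using vec.subspace_0[OF ann2b_subspace[OF Q]] by simp
      then have "omega_sum v (vpair (vpair 0 y2) (vpair 0 y4)) = 0" using v by blast
      then show "herm x1 y2 = herm x3 y4" unfolding x form by (simp add: herm_linear)
    qed
    moreover have "vpair x2 x4 \<in> ann2b (ann2b Q)"
      unfolding ann2b_vpair[of x2]
    proof (intro allI impI)
      fix y1 y3 assume "vpair y1 y3 \<in> ann2b Q"
      then have "vpair (vpair y1 0) (vpair y3 0) \<in> W2 Q"
        unfolding W2_iff vpair_arith using vec.subspace_0[OF Q] by simp
      then have "omega_sum v (vpair (vpair y1 0) (vpair y3 0)) = 0" using v by blast
      then show "herm x2 y1 = herm x4 y3" unfolding x form by (simp add: herm_linear)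
    qed
    ultimately show "v \<in> W2 Q" unfolding x W2_iff ann2b_ann2b[OF Q] by simp
  qed
qed

lemma diagonal_subspace: "vec.subspace (Gr (mat 1 :: complex ^ 'n ^ 'n))"
  unfolding Gr_def
proof (rule vec.subspaceI)
  let ?D = "{vpair x (mat 1 *v x) | x :: complex ^ 'n. True}"
  show "0 \<in> ?D" by (intro CollectI exI[of _ 0]) (simp add: vpair_arith)
  fix u v c assume uv: "u \<in> ?D"
  then obtain x where x: "u = vpair x x" by auto
  show "c *s u \<in> ?D" unfolding x vpair_arith by auto
  assume "v \<in> ?D"
  then obtain y where y: "v = vpair y y" by auto
  show "u + v \<in> ?D" unfolding x y vpair_arith by auto
qed

lemma dim_diagonal: "vec.dim (Gr (mat 1 :: complex ^ 'n ^ 'n)) = CARD('n::finite)"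
proof -
  have c: "clin (\<lambda>x :: complex ^ 'n. vpair x x)" by (rule clin_vpair[OF clin_id clin_id])
  have "Gr (mat 1 :: complex ^ 'n ^ 'n) = (\<lambda>x. vpair x x) ` UNIV" unfolding Gr_def by auto
  moreover have "vec.dim ((\<lambda>x :: complex ^ 'n. vpair x x) ` UNIV) = vec.dim (UNIV :: (complex ^ 'n) set)"
    by (rule vec.dim_image_eq[OF c]) (simp add: inj_on_def vpair_eq_iff)
  ultimately show ?thesis unfolding vec_dim_card by simp
qed

text \<open>
  The diagonal \<open>\<Delta>\<close> is its own annihilator, so \<open>\<Delta> \<inter> ann2b Q\<close> is the annihilator of \<open>\<Delta> + Q\<close>.
\<close>
lemma dim_diagonal_ann2b:
  fixes Q :: "(complex ^ ('n::finite + 'n)) set"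
  assumes Q: "vec.subspace Q"
  shows "vec.dim (Gr (mat 1) \<inter> ann2b Q) + vec.dim Q = CARD('n) + vec.dim (Gr (mat 1) \<inter> Q)"
proof -
  let ?D = "Gr (mat 1 :: complex ^ 'n ^ 'n)"
  let ?S = "{x + y | x y. x \<in> ?D \<and> y \<in> Q}"
  have S: "vec.subspace ?S" by (rule vec.subspace_sums[OF diagonal_subspace Q])
  have "ann2b ?S = ?D \<inter> ann2b Q"
  proof (intro set_eqI)
    fix v :: "complex ^ ('n + 'n)"
    obtain x1 x2 where v: "v = vpair x1 x2" by (rule vpair_cases)
    show "v \<in> ann2b ?S \<longleftrightarrow> v \<in> ?D \<inter> ann2b Q"
    proof
      assume a: "v \<in> ann2b ?S"
      have QS: "q \<in> ?S" if "q \<in> Q" for q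
        using that vec.subspace_0[OF diagonal_subspace] by (intro CollectI exI[of _ 0] exI[of _ q]) simp
      have DS: "u \<in> ?S" if "u \<in> ?D" for u
        using that vec.subspace_0[OF Q] by (intro CollectI exI[of _ u] exI[of _ 0]) simp
      have "v \<in> ann2b Q" using a QS unfolding v ann2b_vpair by blast
      moreover have "herm x1 y = herm x2 y" for y
        using a DS[of "vpair y y"] unfolding v ann2b_vpair by (simp add: Gr_iff)
      then have "herm (x2 - x1) (x2 - x1) = 0" by (simp add: herm_linear)
      then have "x2 - x1 = 0" by (rule herm_eq_0)
      then have "v \<in> ?D" unfolding v by (simp add: Gr_iff)
      ultimately show "v \<in> ?D \<inter> ann2b Q" by blast
    next
      assume a: "v \<in> ?D \<inter> ann2b Q"
      then have eq: "x2 = x1" unfolding v by (simp add: Gr_iff)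
      show "v \<in> ann2b ?S"
        unfolding v ann2b_vpair
      proof (intro allI impI)
        fix y1 y2 assume "vpair y1 y2 \<in> ?S"
        then obtain z q where zq: "vpair y1 y2 = vpair z z + q" "q \<in> Q"
          unfolding Gr_def by auto
        obtain q1 q2 where q: "q = vpair q1 q2" by (rule vpair_cases)
        have y: "y1 = z + q1" "y2 = z + q2" using zq(1) unfolding q vpair_arith vpair_eq_iff by auto
        have "herm x1 q1 = herm x2 q2" using a zq(2) unfolding v q Int_iff ann2b_vpair by blast
        then show "herm x1 y1 = herm x2 y2" unfolding y eq herm_linear by simp
      qed
    qed
  qed
  then have "vec.dim ?S + vec.dim (?D \<inter> ann2b Q) = 2 * CARD('n)"
    using dim_ann2b[OF S] by simp
  moreover have "vec.dim ?S + vec.dim (?D \<inter> Q) = vec.dim ?D + vec.dim Q"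
    by (rule vec.dim_sums_Int[OF diagonal_subspace Q])
  ultimately show ?thesis unfolding dim_diagonal by linarith
qed

lemma dim_diagonal_W2:
  fixes Q :: "(complex ^ ('n::finite + 'n)) set"
  assumes Q: "vec.subspace Q"
  shows "vec.dim (Gr (mat 1) \<inter> W2 Q) = vec.dim (Gr (mat 1) \<inter> ann2b Q) + vec.dim (Gr (mat 1) \<inter> Q)"
proof -
  let ?D = "Gr (mat 1 :: complex ^ 'n ^ 'n)"
  define f where "f = (\<lambda>v :: complex ^ ('n + 'n). vpair (vpair (vfst v) (0 :: complex ^ 'n)) (vpair (vsnd v) (0 :: complex ^ 'n)))"
  define g where "g = (\<lambda>v :: complex ^ ('n + 'n). vpair (vpair (0 :: complex ^ 'n) (vfst v)) (vpair (0 :: complex ^ 'n) (vsnd v)))"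
  have f: "clin f" and g: "clin g" unfolding f_def g_def
    by (intro clin_vpair clin_vfst clin_vsnd clin_zero)+
  have sub: "vec.subspace (?D \<inter> ann2b Q)" "vec.subspace (?D \<inter> Q)"
    by (intro vec.subspace_inter diagonal_subspace ann2b_subspace Q)+
  have inj: "inj f" "inj g"
    by (rule inj_on_inverseI[where g = "\<lambda>u. vpair (vfst (vfst u)) (vfst (vsnd u))"], simp add: f_def)
      (rule inj_on_inverseI[where g = "\<lambda>u. vpair (vsnd (vfst u)) (vsnd (vsnd u))"], simp add: g_def)
  have L: "Gr (mat 1) \<inter> W2 Q = {x + y | x y. x \<in> f ` (?D \<inter> ann2b Q) \<and> y \<in> g ` (?D \<inter> Q)}" (is "?L = ?R")
  proof (intro equalityI subsetI)
    fix v assume v: "v \<in> ?L"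
    then obtain x1 x2 x3 x4 where x: "v = vpair (vpair x1 x2) (vpair x3 x4)"
      "vpair x1 x3 \<in> ann2b Q" "vpair x2 x4 \<in> Q"
      unfolding W2_def by blast
    have "x3 = x1" "x4 = x2" using v unfolding x by (auto simp: Gr_iff vpair_eq_iff)
    then have "vpair x1 x3 \<in> ?D \<inter> ann2b Q" "vpair x2 x4 \<in> ?D \<inter> Q" using x by (auto simp: Gr_iff)
    moreover have "v = f (vpair x1 x3) + g (vpair x2 x4)"
      unfolding x f_def g_def by (simp add: vpair_arith)
    ultimately show "v \<in> ?R" by blast
  next
    fix v assume "v \<in> ?R"
    then obtain p q where pq: "p \<in> ?D" "p \<in> ann2b Q" "q \<in> ?D" "q \<in> Q" "v = f p + g q" by blast
    obtain x1 x3 where p: "p = vpair x1 x3" by (rule vpair_cases)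
    obtain x2 x4 where q: "q = vpair x2 x4" by (rule vpair_cases)
    have v: "v = vpair (vpair x1 x2) (vpair x3 x4)"
      unfolding pq(5) p q f_def g_def by (simp add: vpair_arith)
    have "x3 = x1" "x4 = x2" using pq unfolding p q by (auto simp: Gr_iff)
    then show "v \<in> ?L" using pq(2,4) unfolding v p q W2_iff Int_iff by (simp add: Gr_iff W2_iff)
  qed
  have "f ` (?D \<inter> ann2b Q) \<inter> g ` (?D \<inter> Q) \<subseteq> {0}"
    unfolding f_def g_def by (auto simp: vpair_eq_iff vpair_arith)
  then have "vec.dim (f ` (?D \<inter> ann2b Q) \<inter> g ` (?D \<inter> Q)) = 0" by simp
  moreover have "vec.dim (f ` (?D \<inter> ann2b Q)) = vec.dim (?D \<inter> ann2b Q)"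
    by (rule vec.dim_image_eq[OF f inj_on_subset[OF inj(1) subset_UNIV]])
  moreover have "vec.dim (g ` (?D \<inter> Q)) = vec.dim (?D \<inter> Q)"
    by (rule vec.dim_image_eq[OF g inj_on_subset[OF inj(2) subset_UNIV]])
  ultimately show ?thesis unfolding L
    using vec.dim_sums_Int[OF vec.linear_subspace_image[OF f sub(1)] vec.linear_subspace_image[OF g sub(2)]]
    by linarith
qed

section \<open>The index formula\<close>

theorem theorem2p3:
  fixes T :: real
    and R R' :: "(complex ^ ('n::finite + 'n)) set"
    and a :: "real \<Rightarrow> complex ^ 'n ^ 'n"
    and \<gamma> \<gamma>' :: "real \<Rightarrow> complex ^ ('n + 'n) ^ ('n + 'n)"
  assumes "0 \<le> T"
    and "vec.subspace R"
    and "continuous_on {0..T} a"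
    and "\<And>t. t \<in> {0..T} \<Longrightarrow> invertible (a t)"
    and "R' = {vpair x y | x y. vpair (a 0 *v x) (a T *v y) \<in> R}"
    and "continuous_on {0..T} \<gamma>"
    and "\<And>t. t \<in> {0..T} \<Longrightarrow> invertible (\<gamma> t)"
    and "\<And>t. t \<in> {0..T} \<Longrightarrow> ctranspose (\<gamma> t) ** J2 ** \<gamma> t = J2"
    and "\<gamma> 0 = mat 1"
    and "\<And>t. t \<in> {0..T} \<Longrightarrow> \<gamma>' t =
           block_diag (ctranspose (a t)) (matrix_inv (a t)) ** \<gamma> t
             ** block_diag (matrix_inv (ctranspose (a 0))) (a 0)"
  shows "maslov_type_index (W2 R') T \<gamma>' - maslov_type_index (W2 R) T \<gamma>
       = int (vec.dim (Gr (mat 1 :: complex ^ 'n ^ 'n) \<inter> ann2b R'))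
       - int (vec.dim (Gr (mat 1 :: complex ^ 'n ^ 'n) \<inter> ann2b R))"
proof -
  \<comment> \<open>both paths are prolonged by constants to the whole line\<close>
  define cl where "cl t = max 0 (min t T)" for t :: real
  have cl_in: "cl t \<in> {0..T}" for t using assms(1) unfolding cl_def by auto
  have cl_eq: "cl t = t" if "0 \<le> t" "t \<le> T" for t using that unfolding cl_def by simp
  have cl0: "cl 0 = 0" and clT: "cl T = T" using assms(1) unfolding cl_def by auto
  have cl_cont: "continuous_on UNIV cl" unfolding cl_def by (intro continuous_intros)
  define b where "b t = a (cl t)" for t
  define g where "g t = \<gamma> (cl t)" for t
  have b_cont: "continuous_on UNIV b" unfolding b_def
    by (rule continuous_on_compose2[OF assms(3) cl_cont]) (use cl_in in blast)
  have g_cont: "continuous_on UNIV g" unfolding g_def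
    by (rule continuous_on_compose2[OF assms(6) cl_cont]) (use cl_in in blast)
  have b_inv: "invertible (b t)" for t unfolding b_def by (rule assms(4)[OF cl_in])
  have g_inv: "invertible (g t)" for t unfolding g_def by (rule assms(7)[OF cl_in])
  have g_symp: "ctranspose (g t) ** J2 ** g t = J2" for t unfolding g_def by (rule assms(8)[OF cl_in])
  note bc_inv = invertible_ctranspose[OF b_inv]

  define D where "D t = pair_map ((*v) (ctranspose (b t))) ((*v) (matrix_inv (b t)))" for t
  define S where "S t = pair_map (D 0) (D t)" for t
  define A where "A t = pair_map (\<lambda>v :: complex ^ ('n + 'n). v) ((*v) (g t))" for t
  have cD: "cfam D"
  proof -
    have "cfam (\<lambda>t. (*v) (ctranspose (b t)))" by (rule cfam_matrix[OF continuous_on_ctranspose[OF b_cont]])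
    moreover have "cfam (\<lambda>t. (*v) (matrix_inv (b t)))"
      using cfam_inv[OF cfam_matrix[OF b_cont] bij_matrix(1)[OF b_inv]] unfolding bij_matrix(2)[OF b_inv] .
    ultimately show ?thesis unfolding D_def by (rule cfam_pair_map)
  qed
  have binv_bij: "bij ((*v) (matrix_inv (b t)))" for t
    using bij_imp_bij_inv[OF bij_matrix(1)[OF b_inv, of t]] unfolding bij_matrix(2)[OF b_inv] .
  have D_bij: "bij (D t)" for t
    unfolding D_def by (rule bij_pair_map[OF bij_matrix(1)[OF bc_inv] binv_bij])
  note b_binv = matrix_inv_vector[OF b_inv] and bc_binv = matrix_inv_vector[OF bc_inv]
  have omega_D: "omega (D t x) (D t y) = omega x y" for t x y
    by (rule vpair_cases[of x], rule vpair_cases[of y])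
      (simp add: D_def omega_vpair herm_ctranspose' herm_ctranspose[symmetric] b_binv)
  have omega_g: "omega (g t *v x) (g t *v y) = omega x y" for t x y
  proof -
    have "omega (g t *v x) (g t *v y) = herm (ctranspose (g t) *v (J2 *v (g t *v x))) y"
      unfolding omega_def herm_ctranspose' ..
    also have "ctranspose (g t) *v (J2 *v (g t *v x)) = J2 *v x"
      using g_symp[of t] by (simp only: matrix_vector_mul_assoc matrix_mul_assoc)
    finally show ?thesis unfolding omega_def .
  qed
  have cS: "cfam S" unfolding S_def by (rule cfam_pair_map[OF cfam_const[OF cfam_clin[OF cD]] cD])
  have S_bij: "bij (S t)" for t unfolding S_def by (rule bij_pair_map[OF D_bij D_bij])
  have S_omega: "omega_sum (S t x) (S t y) = omega_sum x y" for t x y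
    unfolding S_def by (simp add: omega_sum_def omega_D)
  have cA: "cfam A" unfolding A_def by (rule cfam_pair_map[OF cfam_const[OF clin_id] cfam_matrix[OF g_cont]])
  have A_bij: "bij (A t)" for t
    unfolding A_def by (rule bij_pair_map[OF bij_id[unfolded id_def] bij_matrix(1)[OF g_inv]])
  have A_omega: "omega_sum (A t x) (A t y) = omega_sum x y" for t x y
    unfolding A_def by (simp add: omega_sum_def omega_g)
  let ?\<Delta> = "Gr (mat 1 :: complex ^ ('n + 'n) ^ ('n + 'n))"
  have A_lag: "omega_sum.lagrangian (A t ` ?\<Delta>)" for t
    by (rule omega_sum.lagrangian_image[OF A_bij A_omega lagrangian_diagonal])
  have A_Gr: "A t ` ?\<Delta> = Gr (g t)" for t
  proof -
    have "Gr M = (\<lambda>x. vpair x (M *v x)) ` UNIV" for M :: "complex ^ ('n + 'n) ^ ('n + 'n)"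
      unfolding Gr_def by auto
    then show ?thesis unfolding A_def by (simp add: image_image)
  qed
  have g0: "g 0 = mat 1" unfolding g_def cl0 by (rule assms(9))
  have A0: "A 0 ` ?\<Delta> = ?\<Delta>" unfolding A_Gr g0 ..

  have reflect_S: "reflect (S t v) = S t (reflect v)" for t v
  proof -
    have "pair_map (\<lambda>x. x) uminus (D t u) = D t (pair_map (\<lambda>x. x) uminus u)" for t u
      unfolding D_def by (simp add: clin_neg[OF clin_matrix])
    then show ?thesis unfolding reflect_def S_def by simp
  qed
  have reflect_diagonal: "reflect ` ?\<Delta> \<subseteq> ?\<Delta>"
    unfolding reflect_def by (auto simp: Gr_def vpair_eq_iff)
  have reflect_W2: "reflect ` W2 R \<subseteq> W2 R"
  proof -
    have neg: "- u \<in> R" if "u \<in> R" for u by (rule vec.subspace_neg[OF assms(2) that])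
    show ?thesis
    proof
      fix v assume "v \<in> reflect ` W2 R"
      then obtain x1 x2 x3 x4 where x: "v = reflect (vpair (vpair x1 x2) (vpair x3 x4))"
        "vpair x1 x3 \<in> ann2b R" "vpair x2 x4 \<in> R"
        unfolding W2_def by blast
      have "v = vpair (vpair x1 (- x2)) (vpair x3 (- x4))" unfolding x(1) reflect_def by simp
      moreover have "vpair (- x2) (- x4) \<in> R" using neg[OF x(3)] unfolding vpair_arith .
      ultimately show "v \<in> W2 R" using x(2) by (simp add: W2_iff)
    qed
  qed
  have inj_reflect: "inj reflect" by (rule inj_on_inverseI[where g = reflect]) (rule reflect_reflect)

  have main: "2 * (Mas omega_sum (\<lambda>t. S t ` A t ` ?\<Delta>) (\<lambda>t. S T ` W2 R) 0 T
      - Mas omega_sum (\<lambda>t. A t ` ?\<Delta>) (\<lambda>t. W2 R) 0 T)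
    = int (vec.dim (S 0 ` A 0 ` ?\<Delta> \<inter> S T ` W2 R)) - int (vec.dim (A 0 ` ?\<Delta> \<inter> W2 R))"
    by (rule omega_sum.maslov_index_difference[OF assms(1) cS S_bij S_omega cA A_bij A_lag
          lagrangian_W2[OF assms(2)] standard_splitting clin_reflect inj_reflect reflect_swaps_splitting])
      (simp_all add: A0 reflect_diagonal reflect_W2 reflect_S)

  have b0: "b 0 = a 0" and bT: "b T = a T" unfolding b_def cl0 clT by simp_all
  have R'_iff: "vpair x y \<in> R' \<longleftrightarrow> vpair (b 0 *v x) (b T *v y) \<in> R" for x y
    unfolding assms(5) b0 bT by (auto simp: vpair_eq_iff)
  have ann_R': "vpair (ctranspose (b 0) *v y1) (ctranspose (b T) *v y3) \<in> ann2b R' \<longleftrightarrow> vpair y1 y3 \<in> ann2b R"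
    for y1 y3
  proof -
    have "(\<forall>z1 z2. vpair (b 0 *v z1) (b T *v z2) \<in> R \<longrightarrow> herm y1 (b 0 *v z1) = herm y3 (b T *v z2))
      \<longleftrightarrow> (\<forall>w1 w2. vpair w1 w2 \<in> R \<longrightarrow> herm y1 w1 = herm y3 w2)" (is "?l \<longleftrightarrow> ?r")
    proof
      assume l: ?l
      show ?r
      proof (intro allI impI)
        fix w1 w2 assume "vpair w1 w2 \<in> R"
        then show "herm y1 w1 = herm y3 w2"
          using l[rule_format, of "matrix_inv (b 0) *v w1" "matrix_inv (b T) *v w2"] by (simp add: b_binv)
      qed
    next
      assume r: ?r
      show ?l by (intro allI impI r[rule_format])
    qed
    then show ?thesis unfolding ann2b_vpair R'_iff herm_ctranspose' .
  qed
  have W2_R': "W2 R' = S T ` W2 R"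
  proof -
    have iff: "S T u \<in> W2 R' \<longleftrightarrow> u \<in> W2 R" for u
    proof -
      obtain y1 y2 y3 y4 where u: "u = vpair (vpair y1 y2) (vpair y3 y4)"
        by (rule vpair_cases[of u], rule vpair_cases[of "vfst u"], rule vpair_cases[of "vsnd u"]) simp
      have "S T u = vpair (vpair (ctranspose (b 0) *v y1) (matrix_inv (b 0) *v y2))
          (vpair (ctranspose (b T) *v y3) (matrix_inv (b T) *v y4))"
        unfolding u S_def D_def by simp
      then show ?thesis unfolding u by (simp add: W2_iff ann_R' R'_iff b_binv)
    qed
    show ?thesis
    proof (intro equalityI subsetI)
      fix v assume v: "v \<in> W2 R'"
      have s: "S T (inv (S T) v) = v" by (rule surj_f_inv_f[OF bij_is_surj[OF S_bij]])
      then have "inv (S T) v \<in> W2 R" using v iff[of "inv (S T) v"] by simp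
      then show "v \<in> S T ` W2 R" using s by (metis image_eqI)
    qed (use iff in blast)
  qed
  define E where "E = (\<lambda>u. block_diag (matrix_inv (ctranspose (a 0))) (a 0) *v u)"
  have DE: "D 0 (E u) = u" "E (D 0 u) = u" for u
    by (rule_tac [!] vpair_cases[of u])
      (simp_all add: D_def E_def block_mat_vpair b0[symmetric] b_binv bc_binv)
  have S0: "S 0 ` ?\<Delta> = ?\<Delta>"
  proof (intro equalityI subsetI)
    fix v assume "v \<in> ?\<Delta>"
    then obtain x where "v = vpair x x" unfolding Gr_def by auto
    then have "v = S 0 (vpair (E x) (E x))" unfolding S_def by (simp add: DE)
    moreover have "vpair (E x) (E x) \<in> ?\<Delta>" by (simp add: Gr_iff)
    ultimately show "v \<in> S 0 ` ?\<Delta>" by blast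
  qed (auto simp: Gr_def S_def vpair_eq_iff)
  have Gr_\<gamma>': "Gr (\<gamma>' t) = S t ` A t ` ?\<Delta>" if t: "0 \<le> t" "t \<le> T" for t
  proof -
    have \<gamma>': "\<gamma>' t *v u = D t (g t *v E u)" for u
    proof -
      have bt: "b t = a t" "g t = \<gamma> t" unfolding b_def g_def cl_eq[OF t] by simp_all
      have "\<gamma>' t *v u = block_diag (ctranspose (b t)) (matrix_inv (b t)) *v (g t *v E u)"
        unfolding E_def bt using assms(10)[of t] t
        by (simp add: matrix_vector_mul_assoc matrix_mul_assoc)
      also have "\<dots> = D t (g t *v E u)"
        by (rule vpair_cases[of "g t *v E u"]) (simp add: D_def block_mat_vpair)
      finally show ?thesis .
    qed
    show ?thesis
      unfolding A_Gr
    proof (intro equalityI subsetI)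
      fix v assume "v \<in> Gr (\<gamma>' t)"
      then obtain x where "v = vpair x (\<gamma>' t *v x)" unfolding Gr_def by blast
      then have "v = S t (vpair (E x) (g t *v E x))" unfolding S_def \<gamma>' by (simp add: DE)
      moreover have "vpair (E x) (g t *v E x) \<in> Gr (g t)" by (simp add: Gr_iff)
      ultimately show "v \<in> S t ` Gr (g t)" by blast
    next
      fix v assume "v \<in> S t ` Gr (g t)"
      then obtain x where "v = S t (vpair x (g t *v x))" unfolding Gr_def by blast
      then have "v = vpair (D 0 x) (\<gamma>' t *v D 0 x)" unfolding S_def \<gamma>' by (simp add: DE)
      then show "v \<in> Gr (\<gamma>' t)" by (simp add: Gr_iff)
    qed
  qed
  have R'_sub: "vec.subspace R'" and R'_dim: "vec.dim R' = vec.dim R"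
  proof -
    let ?f = "pair_map ((*v) (matrix_inv (b 0))) ((*v) (matrix_inv (b T)))"
    have f: "clin ?f" by (rule clin_pair_map[OF clin_matrix clin_matrix])
    have inj: "inj ?f" by (rule bij_is_inj[OF bij_pair_map[OF binv_bij binv_bij]])
    have "R' = ?f ` R"
    proof (intro equalityI subsetI)
      fix v assume v: "v \<in> R'"
      obtain x y where xy: "v = vpair x y" by (rule vpair_cases)
      have "v = ?f (vpair (b 0 *v x) (b T *v y))" unfolding xy by (simp add: b_binv)
      moreover have "vpair (b 0 *v x) (b T *v y) \<in> R" using v unfolding xy R'_iff .
      ultimately show "v \<in> ?f ` R" by blast
    next
      fix v assume "v \<in> ?f ` R"
      then obtain u where u: "u \<in> R" "v = ?f u" by blast
      then show "v \<in> R'" by (simp add: R'_iff b_binv)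
    qed
    then show "vec.subspace R'" "vec.dim R' = vec.dim R"
      using vec.linear_subspace_image[OF f assms(2)]
        vec.dim_image_eq[OF f inj_on_subset[OF inj subset_UNIV], of R] by simp_all
  qed
  have "maslov_type_index (W2 R') T \<gamma>' = Mas omega_sum (\<lambda>t. S t ` A t ` ?\<Delta>) (\<lambda>t. S T ` W2 R) 0 T"
    unfolding maslov_type_index_def W2_R' by (rule Mas_cong) (simp_all add: Gr_\<gamma>')
  moreover have "maslov_type_index (W2 R) T \<gamma> = Mas omega_sum (\<lambda>t. A t ` ?\<Delta>) (\<lambda>t. W2 R) 0 T"
    unfolding maslov_type_index_def by (rule Mas_cong) (simp_all add: A_Gr g_def cl_eq)
  ultimately have "2 * (maslov_type_index (W2 R') T \<gamma>' - maslov_type_index (W2 R) T \<gamma>)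
      = int (vec.dim (?\<Delta> \<inter> W2 R')) - int (vec.dim (?\<Delta> \<inter> W2 R))"
    using main unfolding A0 S0 W2_R' by simp
  moreover have "x = int p - int q" if "2 * x = int (p + p') - int (q + q')" "p + c = n + p'" "q + c = n + q'"
    for x :: int and p p' q q' c n
    using that by linarith
  ultimately show ?thesis
    using dim_diagonal_ann2b[OF R'_sub] dim_diagonal_ann2b[OF assms(2)]
    unfolding dim_diagonal_W2[OF R'_sub] dim_diagonal_W2[OF assms(2)] R'_dim by blast
qed

end
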